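(* For every integer $n \geq 40$ there exists a planar hypohamiltonian graph on exactly $n$ vertices.
   Context: All graphs are finite and simple. A graph $G$ is hypohamiltonian if $G$ has no Hamiltonian cycle, but for every vertex $v$ of $G$ the graph $G - v$ has a Hamiltonian cycle. *)

theory Defs
  imports "HOL-Analysis.Analysis" "Graph_Theory.Graph_Theory"
begin

text \<open>
  Finite simple graphs are the symmetric loop-free digraphs of \<^locale>\<open>pair_graph\<close>: an
  undirected edge \<open>uv\<close> is the pair of arcs \<open>(u, v)\<close>, \<open>(v, u)\<close>. The predicate
  \<^const>\<open>pre_digraph.cycle\<close> therefore also accepts \<open>u, v, u\<close>, which is not a cycle of an undirected
  graph and is ruled out below by the bound on the length.
\<close>

definition hamiltonian_cycle :: "('a, 'b) pre_digraph \<Rightarrow> 'b awalk \<Rightarrow> bool" where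
  "hamiltonian_cycle G p \<longleftrightarrow>
     pre_digraph.cycle G p \<and> length p \<ge> 3 \<and> tail G ` set p = verts G"

definition hypohamiltonian :: "('a, 'b) pre_digraph \<Rightarrow> bool" where
  "hypohamiltonian G \<longleftrightarrow>
     (\<nexists>p. hamiltonian_cycle G p) \<and>
     (\<forall>v \<in> verts G. \<exists>p. hamiltonian_cycle (pre_digraph.del_vert G v) p)"

text \<open>
  A drawing in the plane without crossings: \<open>pt\<close> places the vertices and \<open>cv {u, v}\<close> is the point
  set of the curve that represents the edge \<open>uv\<close> (one curve for both of its arcs).
\<close>

definition plane_drawing ::
    "'a pair_pre_digraph \<Rightarrow> ('a \<Rightarrow> complex) \<Rightarrow> ('a set \<Rightarrow> complex set) \<Rightarrow> bool" where
  "plane_drawing G pt cv \<longleftrightarrow>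
     inj_on pt (pverts G) \<and>
     (\<forall>(u, v) \<in> parcs G.
        (\<exists>g. arc g \<and> pathstart g = pt u \<and> pathfinish g = pt v \<and> path_image g = cv {u, v}) \<and>
        cv {u, v} \<inter> pt ` pverts G = {pt u, pt v}) \<and>
     (\<forall>(u, v) \<in> parcs G. \<forall>(x, y) \<in> parcs G. {u, v} \<noteq> {x, y} \<longrightarrow>
        cv {u, v} \<inter> cv {x, y} \<subseteq> pt ` ({u, v} \<inter> {x, y}))"

definition planar :: "'a pair_pre_digraph \<Rightarrow> bool" where
  "planar G \<longleftrightarrow> (\<exists>pt cv. plane_drawing G pt cv)"

end

theory Submission
  imports Defs
begin

text \<open>
  Call a 4-cycle \<open>v1 v2 v3 v4\<close> of a hypohamiltonian graph good if every vertex-deleted subgraph has a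
  Hamiltonian cycle that uses an edge of the 4-cycle, and one that uses both remaining edges when the
  deleted vertex lies on the 4-cycle. Thomassen's operation deletes the edges \<open>v1 v2\<close> and \<open>v3 v4\<close> and
  adds a new 4-cycle \<open>z1 z2 z3 z4\<close> with the edges \<open>vi zi\<close>. A Hamiltonian cycle of the new graph meets
  the new 4-cycle in one or two paths between consecutive \<open>zi\<close>, and contracting these gives a
  Hamiltonian cycle of the old graph. Conversely, Hamiltonian cycles of the vertex-deleted subgraphs
  are rerouted through the new vertices, and the new 4-cycle is good again. If the drawing lies in a
  box whose corners are the vertices of the 4-cycle, the new vertices are the corners of a box twice
  as large. So four graphs on 36, 37, 38 and 39 vertices give all larger orders.
\<close>

section \<open>Cycles as sets of edges\<close>

text \<open>The lifting works because every Hamiltonian cycle of a vertex-deleted old graph offers a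
  place to collect the new vertices. A used edge among \<open>{v1, v2}\<close> and
  \<open>{v3, v4}\<close> must be replaced anyway, and if neither is used, goodness supplies one of
  the surviving sides \<open>{v2, v3}\<close>, \<open>{v4, v1}\<close>, which can be replaced
  instead. In the other direction a Hamiltonian cycle cannot pass through the new square between
  opposite corners: each corner has degree three, and the corner left out would keep only its spoke
  \<open>vi zi\<close>. Hence every passage joins neighbours, whose old partners are adjacent in the
  old graph. The remaining obstacle is non-Hamiltonicity of the four small graphs. A Hamiltonian
  cycle is relaxed to a set of edges with two members at each vertex and at least one member across
  each cut of an explicit list; the lists are rich enough to make even this contradictory. The
  positive claims need only explicit lists of vertices, and planarity needs only signs of integer
  determinants.\<close>

fun path_edges :: "'a list \<Rightarrow> 'a set set" where
  "path_edges (x # y # xs) = insert {x, y} (path_edges (y # xs))"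
| "path_edges _ = {}"

text \<open>For the empty list the closing vertex \<open>hd []\<close> is unspecified, but a list
  with one entry has no path edges. The value is therefore empty, and invariance under rotation
  needs no exception.\<close>

definition cycle_edges :: "'a list \<Rightarrow> 'a set set" where
  "cycle_edges xs = path_edges (xs @ [hd xs])"

text \<open>As a set of edges a cycle has neither a starting point nor a direction. The length bound
  excludes \<open>[x, y]\<close>, whose closed walk runs along one edge twice.\<close>

definition cycle_on :: "'a set \<Rightarrow> 'a set set \<Rightarrow> bool" where
  "cycle_on V C \<longleftrightarrow>
     (\<exists>xs. distinct xs \<and> 3 \<le> length xs \<and> set xs = V \<and> cycle_edges xs = C)"

lemma path_edges_append:
  "path_edges (xs @ y # ys) = path_edges (xs @ [y]) \<union> path_edges (y # ys)"
proof (induction xs)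
  case (Cons x xs)
  then show ?case by (cases xs) auto
qed simp

lemma path_edges_snoc2: "path_edges (xs @ [x, y]) = insert {x, y} (path_edges (xs @ [x]))"
  by (simp add: path_edges_append[of xs x "[y]"])

lemma path_edges_rev: "path_edges (rev xs) = path_edges xs"
proof (induction xs)
  case (Cons x xs)
  then show ?case
    by (cases xs) (simp_all add: path_edges_snoc2 insert_commute)
qed simp

lemma path_edges_Cons: "ys \<noteq> [] \<Longrightarrow> path_edges (y # ys) = insert {y, hd ys} (path_edges ys)"
  by (cases ys) auto

lemma path_edges_subset: "e \<in> path_edges xs \<Longrightarrow> e \<subseteq> set xs"
  by (induction xs rule: path_edges.induct) auto

lemma path_edges_card: "distinct xs \<Longrightarrow> e \<in> path_edges xs \<Longrightarrow> card e = 2"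
  by (induction xs rule: path_edges.induct) auto

lemma cycle_edges_append:
  "cycle_edges (x # xs @ y # ys) = path_edges (x # xs @ [y]) \<union> path_edges (y # ys @ [x])"
  using path_edges_append[of "x # xs" y "ys @ [x]"] by (simp add: cycle_edges_def)

lemma cycle_edges_rotate: "cycle_edges (xs @ ys) = cycle_edges (ys @ xs)"
proof (cases xs; cases ys)
  fix x xs' y ys'
  assume "xs = x # xs'" "ys = y # ys'"
  then show ?thesis
    using cycle_edges_append[of x xs' y ys'] cycle_edges_append[of y ys' x xs'] by auto
qed auto

lemma cycle_edges_rev: "cycle_edges (rev xs) = cycle_edges xs"
proof (cases xs)
  case (Cons x xs')
  have "cycle_edges (rev xs) = cycle_edges (x # rev xs')"
    using Cons cycle_edges_rotate[of "rev xs'" "[x]"] by simp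
  also have "\<dots> = path_edges (rev (x # xs' @ [x]))"
    by (simp add: cycle_edges_def)
  finally show ?thesis
    by (simp only: path_edges_rev) (simp add: Cons cycle_edges_def)
qed simp

lemma path_edges_split:
  assumes "e \<in> path_edges xs"
  obtains as a b bs where "xs = as @ a # b # bs" "e = {a, b}"
  using assms
proof (induction xs arbitrary: thesis rule: path_edges.induct)
  case (1 x y xs)
  from "1.prems"(2) consider "e = {x, y}" | "e \<in> path_edges (y # xs)" by auto
  then show ?case
  proof cases
    case 1
    then show ?thesis using "1.prems"(1)[of "[]" x y xs] by simp
  next
    case 2
    then obtain as a b bs where "y # xs = as @ a # b # bs" "e = {a, b}"
      using "1.IH" by blast
    then show ?thesis using "1.prems"(1)[of "x # as" a b bs] by simp
  qed
qed simp_all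

text \<open>Any edge can be rotated to the front of the cyclic list. Equality of multisets
  transports distinctness, vertex set and length at once.\<close>

lemma cycle_edges_split:
  assumes "e \<in> cycle_edges xs" "2 \<le> length xs"
  obtains a b ys where "e = {a, b}" "cycle_edges (a # b # ys) = cycle_edges xs"
    "mset (a # b # ys) = mset xs"
proof -
  from assms(2) obtain x xs' where xs: "xs = x # xs'" "xs' \<noteq> []"
    by (cases xs rule: path_edges.cases) auto
  from assms(1) obtain as a b bs where *: "xs @ [x] = as @ a # b # bs" "e = {a, b}"
    by (metis cycle_edges_def path_edges_split xs(1) list.sel(1))
  show thesis
  \<comment> \<open>If nothing follows \<open>b\<close>, the edge is the closing one, from the last
    vertex back to \<open>x\<close>. Otherwise the last entry of \<open>bs\<close> is the repeated
    \<open>x\<close> and the edge lies inside \<open>xs\<close>.\<close>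
  proof (cases bs rule: rev_cases)
    case Nil
    with * have "xs = as @ [a]" "b = x" by auto
    with xs obtain as' where "as = x # as'" by (cases as) auto
    with \<open>xs = as @ [a]\<close> \<open>b = x\<close> have "xs = (b # as') @ [a]" by simp
    then show thesis
      using that[of a b as'] * cycle_edges_rotate[of "[a]" "b # as'"] by simp
  next
    case (snoc bs' c)
    with * have "xs = as @ (a # b # bs')" by simp
    then show thesis
      using that[of a b "bs' @ as"] * cycle_edges_rotate[of as "a # b # bs'"] by simp
  qed
qed

lemma mset_eq_distinctD:
  assumes "mset xs = mset ys" "distinct ys"
  shows "distinct xs" "set xs = set ys" "length xs = length ys"
  using assms mset_eq_setD mset_eq_imp_distinct_iff mset_eq_length by blast+

text \<open>Rotation fixes the position of the edge and reversal its direction, so that the list can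
  be read from \<open>a\<close> to \<open>b\<close>.\<close>

lemma cycle_on_edge:
  assumes "cycle_on V C" "{a, b} \<in> C"
  obtains ys where "distinct (a # b # ys)" "ys \<noteq> []" "set (a # b # ys) = V"
    "C = cycle_edges (a # b # ys)"
proof -
  obtain xs where xs: "distinct xs" "3 \<le> length xs" "set xs = V" "cycle_edges xs = C"
    using assms(1) by (auto simp: cycle_on_def)
  obtain c d ys where ys: "{a, b} = {c, d}" "cycle_edges (c # d # ys) = C"
    "mset (c # d # ys) = mset xs"
    using cycle_edges_split[of "{a, b}" xs] assms(2) xs by auto
  note m = mset_eq_distinctD[OF ys(3) xs(1)]
  from ys(1) consider "c = a" "d = b" | "c = b" "d = a" by (auto simp: doubleton_eq_iff)
  then show thesis
  proof cases
    case 1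
    show thesis by (rule that[of ys]) (use 1 m ys xs in auto)
  next
    case 2
    have "cycle_edges (a # b # rev ys) = cycle_edges (rev ys @ [a, b])"
      using cycle_edges_rotate[of "[a, b]" "rev ys"] by simp
    also have "\<dots> = cycle_edges (rev (b # a # ys))" by simp
    finally have "cycle_edges (a # b # rev ys) = C"
      using 2 ys(2) by (simp only: cycle_edges_rev)
    then show thesis
      by (intro that[of "rev ys"]) (use 2 m ys xs in auto)
  qed
qed

text \<open>Once \<open>y\<close> is rotated to the front and \<open>p\<close> to the end,
  \<open>y\<close> occurs only in the first and in the closing edge. The term
  \<open>hd (zs @ xs @ [p])\<close> is the cyclic successor of \<open>y\<close>, which wraps around
  when \<open>zs\<close> is empty.\<close>

lemma cycle_edges_nbr:
  assumes "distinct (xs @ [p, y] @ zs)" "{y, w} \<in> cycle_edges (xs @ [p, y] @ zs)"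
  shows "w \<in> {p, hd (zs @ xs @ [p])}"
proof -
  have "cycle_edges (xs @ [p, y] @ zs) = cycle_edges (y # (zs @ xs) @ [p])"
    using cycle_edges_rotate[of "xs @ [p]" "y # zs"] by simp
  also have "\<dots> = path_edges (y # (zs @ xs) @ [p]) \<union> {{p, y}}"
    using cycle_edges_append[of y "zs @ xs" p "[]"] by simp
  also have "path_edges (y # (zs @ xs) @ [p])
      = insert {y, hd (zs @ xs @ [p])} (path_edges ((zs @ xs) @ [p]))"
    using path_edges_Cons[of "(zs @ xs) @ [p]" y] by simp
  finally have "{y, w} = {y, hd (zs @ xs @ [p])} \<or> {y, w} \<in> path_edges ((zs @ xs) @ [p]) \<or>
      {y, w} = {p, y}"
    using assms(2) by auto
  moreover have "{y, w} \<notin> path_edges ((zs @ xs) @ [p])"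
    using path_edges_subset[of "{y, w}" "(zs @ xs) @ [p]"] assms(1) by auto
  ultimately show ?thesis by (auto simp: doubleton_eq_iff)
qed

text \<open>The path grows at its end. With \<open>p\<close> already placed, the next vertex
  \<open>y\<close> is a cyclic neighbour of \<open>p\<close>; the predecessor of \<open>p\<close>
  and all vertices further back are excluded by distinctness, so \<open>y\<close> must open the
  remainder \<open>zs\<close>.\<close>

lemma cycle_on_path:
  assumes "cycle_on V C" "distinct (x # xs @ [y])" "path_edges (x # xs @ [y]) \<subseteq> C"
  obtains zs where "distinct (x # xs @ y # zs)" "set (x # xs @ y # zs) = V"
    "C = cycle_edges (x # xs @ y # zs)"
proof -
  have "\<exists>zs. distinct (x # xs @ y # zs) \<and> set (x # xs @ y # zs) = V \<and>
      C = cycle_edges (x # xs @ y # zs)"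
    using assms(2,3)
  proof (induction xs arbitrary: y rule: rev_induct)
    case Nil
    then have "{x, y} \<in> C" by simp
    from cycle_on_edge[OF assms(1) this] obtain ys where
      "distinct (x # y # ys)" "set (x # y # ys) = V" "C = cycle_edges (x # y # ys)" .
    then show ?case by (intro exI[of _ ys]) (simp only: append.simps simp_thms)
  next
    case (snoc p ps)
    have "path_edges (x # (ps @ [p]) @ [y]) = insert {p, y} (path_edges (x # ps @ [p]))"
      using path_edges_snoc2[of "x # ps" p y] by simp
    with snoc.prems have *: "path_edges (x # ps @ [p]) \<subseteq> C" "{p, y} \<in> C"
      by (simp_all only: insert_subset)
    have "distinct (x # ps @ [p])" using snoc.prems(1) by simp
    from snoc.IH[OF this *(1)] obtain zs where zs: "distinct (x # ps @ p # zs)"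
      "set (x # ps @ p # zs) = V" "C = cycle_edges (x # ps @ p # zs)"
      by (elim exE conjE)
    obtain qs q where q: "x # ps = qs @ [q]" by (cases "x # ps" rule: rev_cases) simp_all
    have eq: "x # ps @ p # zs = qs @ [q, p] @ zs" using q
      by (metis append_Cons append_Nil append_assoc)
    have "y \<in> {q, hd (zs @ qs @ [q])}"
      using cycle_edges_nbr[of qs q p zs y] zs(1,3) *(2) unfolding eq by simp
    moreover have "y \<notin> set (x # ps)" using snoc.prems(1) by auto
    then have "y \<noteq> q" "y \<notin> set qs" unfolding q by auto
    ultimately obtain zs' where "zs = y # zs'"
      by (cases zs; cases qs) auto
    then show ?case using zs by (intro exI[of _ zs']) simp
  qed
  then show thesis using that by blast
qed

text \<open>Path exchange: all surgery on Hamiltonian cycles reduces to this.\<close>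

lemma cycle_on_exchange:
  assumes C: "cycle_on V C" and old: "distinct (x # is @ [y])" "path_edges (x # is @ [y]) \<subseteq> C"
    and new: "distinct js" "set js \<inter> (V - set is) = {}"
    and V': "V' = (V - set is) \<union> set js" and "3 \<le> card V'"
  obtains C' where "cycle_on V' C'" "C' \<subseteq> (C - path_edges (x # is @ [y])) \<union> path_edges (x # js @ [y])"
    "path_edges (x # js @ [y]) \<subseteq> C'" "C - path_edges (x # is @ [y]) \<subseteq> C'"
    "\<And>e. e \<in> C' \<Longrightarrow> e \<subseteq> V'"
proof -
  obtain zs where zs: "distinct (x # is @ y # zs)" "set (x # is @ y # zs) = V"
    "C = cycle_edges (x # is @ y # zs)"
    using cycle_on_path[OF C old] by blast
  let ?C' = "cycle_edges (x # js @ y # zs)"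
  have set': "set (x # js @ y # zs) = V'" and dist': "distinct (x # js @ y # zs)"
    using zs new V' by auto
  have len: "3 \<le> length (x # js @ y # zs)"
    using distinct_card[OF dist'] set' \<open>3 \<le> card V'\<close> by simp
  \<comment> \<open>The upper bound on \<open>C'\<close> needs the two arcs of the cycle to have no
    common edge. A common edge could only join \<open>x\<close> and \<open>y\<close>, so both arcs
    would lack interior vertices and \<open>V\<close> would have two elements.\<close>
  have disj: "path_edges (x # is @ [y]) \<inter> path_edges (y # zs @ [x]) = {}"
  proof (rule ccontr)
    assume "\<not> ?thesis"
    then obtain e where e: "e \<in> path_edges (x # is @ [y])" "e \<in> path_edges (y # zs @ [x])" by auto
    have "e \<subseteq> {x, y}"
      using path_edges_subset[OF e(1)] path_edges_subset[OF e(2)] zs(1) by auto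
    moreover have "card e = 2" using path_edges_card[OF _ e(1)] old(1) by simp
    ultimately have exy: "e = {x, y}"
      by (metis card_2_iff doubleton_eq_iff insertE insert_subset singletonD)
    have "is = []"
    proof (rule ccontr)
      assume "is \<noteq> []"
      then obtain i is' where i: "is = i # is'" by (cases "is") auto
      then have "{x, y} \<in> insert {x, i} (path_edges (is @ [y]))" using e exy by auto
      then show False using path_edges_subset[of "{x, y}" "is @ [y]"] old(1) i
        by (auto simp: doubleton_eq_iff)
    qed
    moreover have "zs = []"
    proof (rule ccontr)
      assume "zs \<noteq> []"
      then obtain i is' where i: "zs = i # is'" by (cases "zs") auto
      then have "{x, y} \<in> insert {y, i} (path_edges (zs @ [x]))" using e exy by auto
      then show False using path_edges_subset[of "{x, y}" "zs @ [x]"] zs(1) i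
        by (auto simp: doubleton_eq_iff)
    qed
    ultimately have "V = {x, y}" using zs(2) by auto
    then have "card V \<le> 2" by (simp add: card_insert_if)
    moreover have "3 \<le> card V" using C distinct_card unfolding cycle_on_def by metis
    ultimately show False by simp
  qed
  have C_eq: "C = path_edges (x # is @ [y]) \<union> path_edges (y # zs @ [x])"
    using zs(3) by (simp add: cycle_edges_append)
  have C'_eq: "?C' = path_edges (x # js @ [y]) \<union> path_edges (y # zs @ [x])"
    by (simp add: cycle_edges_append)
  show thesis
  proof (rule that[of ?C'])
    show "cycle_on V' ?C'" using dist' set' len unfolding cycle_on_def by blast
    show "e \<subseteq> V'" if "e \<in> ?C'" for e
      using path_edges_subset[of e "(x # js @ y # zs) @ [x]"] that set'
      by (auto simp: cycle_edges_def)
  qed (use C_eq C'_eq disj in auto)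
qed

text \<open>With \<open>v\<close> rotated to the front, its neighbours are the second and the last
  entry. The equivalence decides non-membership as well, which is what counting the used edges at
  \<open>v\<close> requires.\<close>

lemma cycle_on_degree:
  assumes "cycle_on V C" "v \<in> V"
  obtains a b where "a \<noteq> b" "a \<noteq> v" "b \<noteq> v" "\<And>e. v \<in> e \<Longrightarrow> e \<in> C \<longleftrightarrow> e = {v, a} \<or> e = {v, b}"
proof -
  obtain xs where xs: "distinct xs" "3 \<le> length xs" "set xs = V" "cycle_edges xs = C"
    using assms(1) by (auto simp: cycle_on_def)
  from assms(2) xs(3) obtain ps qs where pq: "xs = ps @ v # qs" by (metis split_list)
  have C: "C = cycle_edges (v # qs @ ps)"
    using xs(4) pq cycle_edges_rotate[of ps "v # qs"] by simp
  from xs pq obtain a rs where a: "qs @ ps = a # rs" by (cases "qs @ ps") auto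
  from xs pq have "length (qs @ ps) \<ge> 2" by simp
  with a obtain ss b where b: "rs = ss @ [b]" by (cases rs rule: rev_cases) auto
  have dist: "distinct (v # a # ss @ [b])" using xs(1) pq a b
    by (metis append_Cons distinct_append inf_commute distinct.simps(2) Un_iff set_append disjoint_iff list.set_intros(1))
  have "C = insert {v, a} (insert {b, v} (path_edges (a # ss @ [b])))"
    using C a b path_edges_snoc2[of "a # ss" b v] by (simp add: cycle_edges_def)
  moreover have "e \<notin> path_edges (a # ss @ [b])" if "v \<in> e" for e
    using path_edges_subset[of e "a # ss @ [b]"] that dist by auto
  ultimately show thesis
    using that[of a b] dist by (auto simp: insert_commute)
qed

lemma path_edges_cut:
  assumes "x \<in> set xs" "x \<in> S" "y \<in> set xs" "y \<notin> S"
  shows "\<exists>e \<in> path_edges xs. e \<inter> S \<noteq> {} \<and> \<not> e \<subseteq> S"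
  using assms
proof (induction xs arbitrary: x y rule: path_edges.induct)
  case (1 a b xs)
  show ?case
  proof (cases "a \<in> S \<longleftrightarrow> b \<in> S")
    case True
    then obtain x' y' where "x' \<in> set (b # xs)" "x' \<in> S" "y' \<in> set (b # xs)" "y' \<notin> S"
      using "1.prems" by (metis list.set_intros(1) set_ConsD)
    then show ?thesis using "1.IH" by auto
  qed auto
qed auto

text \<open>This is the connectedness of a cycle. Together with the degree two at every vertex it is
  all that the refutations for the four concrete graphs use of a Hamiltonian cycle.\<close>

lemma cycle_on_cut:
  assumes "cycle_on V C" "x \<in> V" "x \<in> S" "y \<in> V" "y \<notin> S"
  shows "\<exists>e \<in> C. e \<inter> S \<noteq> {} \<and> \<not> e \<subseteq> S"
proof -
  obtain xs where xs: "set xs = V" "cycle_edges xs = C"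
    using assms(1) by (auto simp: cycle_on_def)
  then show ?thesis using path_edges_cut[of x "xs @ [hd xs]" S y] assms
    by (auto simp: cycle_edges_def)
qed

lemma cycle_on_edge_subset:
  assumes "cycle_on V C" "e \<in> C"
  shows "e \<subseteq> V"
proof -
  obtain xs where xs: "3 \<le> length xs" "set xs = V" "cycle_edges xs = C"
    using assms(1) by (auto simp: cycle_on_def)
  then have "hd xs \<in> set xs" by (intro hd_in_set) auto
  then show ?thesis
    using path_edges_subset[of e "xs @ [hd xs]"] assms(2) xs by (auto simp: cycle_edges_def)
qed

section \<open>Hamiltonian cycles of digraphs given by pairs\<close>

lemma path_edges_of_cas:
  fixes G :: "('a, 'a \<times> 'a) pre_digraph"
  assumes "tail G = fst" "head G = snd" "pre_digraph.cas G u p v"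
  shows "path_edges (map fst p @ [v]) = (\<lambda>(a, b). {a, b}) ` set p"
  using assms(3)
proof (induction p arbitrary: u)
  case (Cons a p)
  then show ?case
    by (cases a; cases p) (auto simp: assms(1,2) pre_digraph.cas.simps)
qed simp

lemma snd_last_of_cas:
  fixes G :: "('a, 'a \<times> 'a) pre_digraph"
  assumes "head G = snd" "pre_digraph.cas G u p v" "p \<noteq> []"
  shows "snd (last p) = v"
  using assms(2,3)
proof (induction p arbitrary: u)
  case (Cons a p)
  then show ?case by (cases p) (auto simp: assms(1) pre_digraph.cas.simps)
qed simp

lemma cycle_on_of_hamiltonian_cycle:
  assumes "hamiltonian_cycle G p" "tail G = fst" "head G = snd"
  shows "\<exists>C. cycle_on (verts G) C \<and> C \<subseteq> (\<lambda>(a, b). {a, b}) ` arcs G"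
proof -
  interpret pre_digraph G .
  obtain u where u: "awalk u p u" "distinct (tl (awalk_verts u p))" "p \<noteq> []"
    and p: "3 \<le> length p" "fst ` set p = verts G"
    using assms by (auto simp: hamiltonian_cycle_def cycle_def)
  then obtain a p' where ap: "p = a # p'" by (cases p) auto
  from u(1) have cas: "cas u p u" "set p \<subseteq> arcs G" by (auto simp: awalk_def)
  then have hd: "fst a = u" using ap assms by simp
  have "snd (last p) = u" using snd_last_of_cas[OF assms(3) cas(1) u(3)] .
  \<comment> \<open>The predicate \<open>cycle\<close> asks for distinct entries in the tail of the
    vertex list, that is, for distinct heads of the arcs. As the walk is closed, these are its tails
    rotated by one place.\<close>
  then have "tl (awalk_verts u p) = map fst p' @ [u]"
    using u(3) ap assms by (simp add: awalk_verts_conv)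
  then have "distinct (map fst p)" using u(2) hd ap by auto
  moreover have "cycle_edges (map fst p) = path_edges (map fst p @ [u])"
    using ap hd by (simp add: cycle_edges_def)
  ultimately have "cycle_on (verts G) (path_edges (map fst p @ [u]))"
    using p unfolding cycle_on_def by (intro exI[of _ "map fst p"]) simp
  then show ?thesis
    unfolding path_edges_of_cas[OF assms(2,3) cas(1)] using cas(2) by blast
qed

fun walk_arcs :: "'a list \<Rightarrow> ('a \<times> 'a) list" where
  "walk_arcs (x # y # xs) = (x, y) # walk_arcs (y # xs)"
| "walk_arcs _ = []"

lemma map_fst_walk_arcs: "map fst (walk_arcs (xs @ [y])) = xs"
proof (induction xs)
  case (Cons x xs)
  then show ?case by (cases xs) auto
qed simp

lemma walk_arcs_path_edges: "(a, b) \<in> set (walk_arcs xs) \<Longrightarrow> {a, b} \<in> path_edges xs"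
  by (induction xs rule: path_edges.induct) auto

lemma cas_walk_arcs:
  fixes G :: "('a, 'a \<times> 'a) pre_digraph"
  assumes "tail G = fst" "head G = snd" "xs \<noteq> []"
  shows "pre_digraph.cas G (hd xs) (walk_arcs xs) (last xs)"
  using assms(3)
  by (induction xs rule: path_edges.induct) (auto simp: assms(1,2) pre_digraph.cas.simps)

text \<open>The set \<open>C\<close> does not tell in which direction the list runs along an edge,
  so the hypothesis on arcs provides both.\<close>

lemma hamiltonian_cycle_of_cycle_on:
  assumes "cycle_on (verts G) C" "tail G = fst" "head G = snd"
    and arcs: "\<And>a b. {a, b} \<in> C \<Longrightarrow> (a, b) \<in> arcs G"
  shows "\<exists>p. hamiltonian_cycle G p"
proof -
  interpret pre_digraph G .
  obtain xs where xs: "distinct xs" "3 \<le> length xs" "set xs = verts G" "cycle_edges xs = C"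
    using assms(1) by (auto simp: cycle_on_def)
  then obtain x xs' where x: "xs = x # xs'" by (cases xs) auto
  define p where "p = walk_arcs (xs @ [x])"
  have fst: "map fst p = xs" by (simp add: p_def map_fst_walk_arcs)
  have len: "length p = length xs" using arg_cong[OF fst, of length] by simp
  have ne: "p \<noteq> []" using len xs(2) by auto
  have cas: "cas x p x" using cas_walk_arcs[OF assms(2,3), of "xs @ [x]"] x by (simp add: p_def)
  have sub: "set p \<subseteq> arcs G"
    using walk_arcs_path_edges[of _ _ "xs @ [x]"] arcs xs(4) x
    by (auto simp: p_def cycle_edges_def)
  have "awalk x p x" using cas sub xs(3) x by (auto simp: awalk_def)
  moreover have "snd (last p) = x"
    using snd_last_of_cas[OF assms(3) cas ne] .
  then have "distinct (tl (awalk_verts x p))"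
    using ne fst xs(1) x assms by (simp add: awalk_verts_conv)
  ultimately have "cycle p" using ne by (auto simp: cycle_def)
  moreover have "tail G ` set p = verts G"
    using fst xs(3) assms(2) by (metis list.set_map)
  ultimately show ?thesis using len xs(2) by (auto simp: hamiltonian_cycle_def)
qed

text \<open>Both arcs of an edge come from the same unordered pair, so symmetry holds by
  construction. A loop would come from a singleton in \<open>E\<close>, which
  \<open>simple_graph\<close> excludes through the cardinality.\<close>

definition graph_of :: "'a set \<Rightarrow> 'a set set \<Rightarrow> 'a pair_pre_digraph" where
  "graph_of V E = \<lparr>pverts = V, parcs = {(u, v). {u, v} \<in> E}\<rparr>"

definition simple_graph :: "'a set \<Rightarrow> 'a set set \<Rightarrow> bool" where
  "simple_graph V E \<longleftrightarrow> finite V \<and> (\<forall>e \<in> E. e \<subseteq> V \<and> card e = 2)"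

lemma pair_graph_graph_of:
  assumes "simple_graph V E"
  shows "pair_graph (graph_of V E)"
proof
  have "{(u, v). {u, v} \<in> E} \<subseteq> V \<times> V"
    using assms by (auto simp: simple_graph_def)
  then show "finite (parcs (graph_of V E))"
    using assms finite_subset by (fastforce simp: graph_of_def simple_graph_def)
  show "fst e \<noteq> snd e" if "e \<in> parcs (graph_of V E)" for e
    using that assms by (cases e) (auto simp: graph_of_def simple_graph_def)
  show "symmetric (with_proj (graph_of V E))"
    by (auto simp: symmetric_def sym_def graph_of_def arcs_ends_def arc_to_ends_def insert_commute)
qed (use assms in \<open>auto simp: graph_of_def simple_graph_def\<close>)

lemma hypohamiltonian_graph_of:
  assumes "simple_graph V E"
    and "\<And>C. cycle_on V C \<Longrightarrow> \<not> C \<subseteq> E"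
    and "\<And>w. w \<in> V \<Longrightarrow> \<exists>C. cycle_on (V - {w}) C \<and> C \<subseteq> E"
  shows "hypohamiltonian (with_proj (graph_of V E))"
  unfolding hypohamiltonian_def
proof (intro conjI notI ballI)
  assume "\<exists>p. hamiltonian_cycle (with_proj (graph_of V E)) p"
  then obtain C where "cycle_on V C" "C \<subseteq> (\<lambda>(a, b). {a, b}) ` {(u, v). {u, v} \<in> E}"
    using cycle_on_of_hamiltonian_cycle[of "with_proj (graph_of V E)"]
    by (auto simp: graph_of_def)
  then show False using assms(2) by fastforce
next
  fix w assume "w \<in> verts (with_proj (graph_of V E))"
  then have "w \<in> V" by (simp add: graph_of_def)
  then obtain C where C: "cycle_on (V - {w}) C" "C \<subseteq> E" using assms(3) by blast
  show "\<exists>p. hamiltonian_cycle (pre_digraph.del_vert (with_proj (graph_of V E)) w) p"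
  proof (rule hamiltonian_cycle_of_cycle_on)
    show "cycle_on (verts (pre_digraph.del_vert (with_proj (graph_of V E)) w)) C"
      using C(1) by (simp add: pre_digraph.del_vert_def graph_of_def)
    show "(a, b) \<in> arcs (pre_digraph.del_vert (with_proj (graph_of V E)) w)" if "{a, b} \<in> C" for a b
      using C cycle_on_edge_subset[OF C(1) that] that
      by (auto simp: pre_digraph.del_vert_def graph_of_def)
  qed (simp_all add: pre_digraph.del_vert_def graph_of_def)
qed

section \<open>Thomassen's extension of a square\<close>

text \<open>The three cases are spelled out as literals so that several such vertices can be
  combined by pure propositional reasoning. Only the edges of \<open>C\<close> at \<open>v\<close>
  are constrained, not all edges of the graph.\<close>

lemma cycle_on_cubic_vertex:
  assumes "cycle_on V C" "v \<in> V" "distinct [a, b, c]"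
    and "\<And>e. e \<in> C \<Longrightarrow> v \<in> e \<Longrightarrow> e = {v, a} \<or> e = {v, b} \<or> e = {v, c}"
  shows "({v, a} \<in> C \<and> {v, b} \<in> C \<and> {v, c} \<notin> C) \<or>
         ({v, a} \<in> C \<and> {v, b} \<notin> C \<and> {v, c} \<in> C) \<or>
         ({v, a} \<notin> C \<and> {v, b} \<in> C \<and> {v, c} \<in> C)"
proof -
  obtain p q where pq: "p \<noteq> q" "\<And>e. v \<in> e \<Longrightarrow> e \<in> C \<longleftrightarrow> e = {v, p} \<or> e = {v, q}"
    using cycle_on_degree[OF assms(1,2)] by metis
  have inC: "{v, x} \<in> C \<longleftrightarrow> x = p \<or> x = q" for x
    using pq(2)[of "{v, x}"] by (auto simp: doubleton_eq_iff)
  have "p \<in> {a, b, c}" "q \<in> {a, b, c}"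
    using assms(4)[of "{v, p}"] assms(4)[of "{v, q}"] inC by (auto simp: doubleton_eq_iff)
  with pq(1) assms(3) show ?thesis unfolding inC by auto
qed

text \<open>The good squares of the overview. For a deleted corner the cycle has to follow the
  square through the three remaining corners; this is the path \<open>x\<close>, \<open>t\<close>,
  \<open>y\<close> on which \<open>cycle_missing_new\<close> operates.\<close>

locale hypo_square =
  fixes V :: "'a set" and E :: "'a set set" and v1 v2 v3 v4 :: 'a
  assumes graph: "simple_graph V E"
    and square: "distinct [v1, v2, v3, v4]" "{v1, v2, v3, v4} \<subseteq> V"
      "{{v1, v2}, {v2, v3}, {v3, v4}, {v4, v1}} \<subseteq> E"
    and nonham: "cycle_on V C \<Longrightarrow> \<not> C \<subseteq> E"
    and del_off: "w \<in> V - {v1, v2, v3, v4} \<Longrightarrow> \<exists>C. cycle_on (V - {w}) C \<and> C \<subseteq> E \<and>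
      C \<inter> {{v1, v2}, {v2, v3}, {v3, v4}, {v4, v1}} \<noteq> {}"
    and del1: "\<exists>C. cycle_on (V - {v1}) C \<and> C \<subseteq> E \<and> {v2, v3} \<in> C \<and> {v3, v4} \<in> C"
    and del2: "\<exists>C. cycle_on (V - {v2}) C \<and> C \<subseteq> E \<and> {v3, v4} \<in> C \<and> {v4, v1} \<in> C"
    and del3: "\<exists>C. cycle_on (V - {v3}) C \<and> C \<subseteq> E \<and> {v4, v1} \<in> C \<and> {v1, v2} \<in> C"
    and del4: "\<exists>C. cycle_on (V - {v4}) C \<and> C \<subseteq> E \<and> {v1, v2} \<in> C \<and> {v2, v3} \<in> C"
begin

lemma hypohamiltonian: "hypohamiltonian (with_proj (graph_of V E))"
proof (rule hypohamiltonian_graph_of[OF graph nonham])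
  show "\<exists>C. cycle_on (V - {w}) C \<and> C \<subseteq> E" if "w \<in> V" for w
  proof (cases "w \<in> {v1, v2, v3, v4}")
    case True
    then show ?thesis using del1 del2 del3 del4 by (elim insertE) blast+
  next
    case False
    then show ?thesis using del_off[of w] that by blast
  qed
qed

end

section \<open>The extended graph and its non-Hamiltonicity\<close>

locale square_extension = hypo_square +
  fixes z1 z2 z3 z4 :: 'a
  assumes fresh: "distinct [z1, z2, z3, z4]" "{z1, z2, z3, z4} \<inter> V = {}"
begin

definition "V' = V \<union> {z1, z2, z3, z4}"

definition "new_edges =
  {{v1, z1}, {v2, z2}, {v3, z3}, {v4, z4}, {z1, z2}, {z2, z3}, {z3, z4}, {z4, z1}}"

definition "E' = (E - {{v1, v2}, {v3, v4}}) \<union> new_edges"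

lemma old_edge: "e \<in> E \<Longrightarrow> e \<subseteq> V"
  using graph by (auto simp: simple_graph_def)

lemma old_edge_in_E': "e \<in> E \<Longrightarrow> e \<noteq> {v1, v2} \<Longrightarrow> e \<noteq> {v3, v4} \<Longrightarrow> e \<in> E'"
  by (auto simp: E'_def)

lemma ne: "v1 \<noteq> v2" "v1 \<noteq> v3" "v1 \<noteq> v4" "v2 \<noteq> v3" "v2 \<noteq> v4" "v3 \<noteq> v4"
  "z1 \<noteq> z2" "z1 \<noteq> z3" "z1 \<noteq> z4" "z2 \<noteq> z3" "z2 \<noteq> z4" "z3 \<noteq> z4"
  "z1 \<notin> V" "z2 \<notin> V" "z3 \<notin> V" "z4 \<notin> V" "v1 \<in> V" "v2 \<in> V" "v3 \<in> V" "v4 \<in> V"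
  using square fresh by auto

lemma vz_ne: "v1 \<noteq> z1" "v1 \<noteq> z2" "v1 \<noteq> z3" "v1 \<noteq> z4" "v2 \<noteq> z1" "v2 \<noteq> z2" "v2 \<noteq> z3" "v2 \<noteq> z4"
  "v3 \<noteq> z1" "v3 \<noteq> z2" "v3 \<noteq> z3" "v3 \<noteq> z4" "v4 \<noteq> z1" "v4 \<noteq> z2" "v4 \<noteq> z3" "v4 \<noteq> z4"
  using ne(13-20) by auto

lemmas all_ne = ne vz_ne

lemma finite_V: "finite V" using graph by (simp add: simple_graph_def)

lemma card_V_ge: "W \<subseteq> V' \<Longrightarrow> {a, b, c} \<subseteq> W \<Longrightarrow> distinct [a, b, c] \<Longrightarrow> 3 \<le> card W"
proof -
  assume *: "W \<subseteq> V'" "{a, b, c} \<subseteq> W" "distinct [a, b, c]"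
  have "finite W" using *(1) finite_V by (auto simp: V'_def intro: finite_subset)
  then have "card {a, b, c} \<le> card W" using *(2) card_mono by blast
  then show ?thesis using *(3) by simp
qed

text \<open>Contraction can put \<open>{v1, v2}\<close> and \<open>{v3, v4}\<close> back, so
  intermediate cycles live in \<open>E \<union> E'\<close>. Once all new vertices are gone only old
  edges can remain, because every member of \<open>new_edges\<close> has an end outside
  \<open>V\<close>.\<close>

lemma nonham_old:
  assumes "cycle_on V C" "C \<subseteq> E \<union> E'"
  shows False
proof -
  have "C \<subseteq> E"
  proof
    fix e assume e: "e \<in> C"
    then have "e \<subseteq> V" using cycle_on_edge_subset[OF assms(1)] by blast
    moreover have "\<not> e \<subseteq> V" if "e \<in> new_edges"
      using that ne(13-16) unfolding new_edges_def by (elim insertE) simp_all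
    ultimately show "e \<in> E" using assms(2) e unfolding E'_def by blast
  qed
  then show False using nonham assms(1) by blast
qed

text \<open>The path exchange with an empty new interior. That the other edges of \<open>C\<close>
  survive is recorded because a second passage may have to be contracted afterwards.\<close>

lemma contract_path:
  assumes "cycle_on W C" "C \<subseteq> E \<union> E'" "distinct (x # is @ [y])" "path_edges (x # is @ [y]) \<subseteq> C"
    and "{x, y} \<in> E" "V \<subseteq> W - set is" "W \<subseteq> V'"
  obtains C' where "cycle_on (W - set is) C'" "C' \<subseteq> E \<union> E'"
    "C - path_edges (x # is @ [y]) \<subseteq> C'"
proof -
  have card: "3 \<le> card (W - set is)"
    using assms(6,7) all_ne by (intro card_V_ge[of _ v1 v2 v3]) auto
  obtain C' where "cycle_on (W - set is) C'"
    "C' \<subseteq> (C - path_edges (x # is @ [y])) \<union> path_edges (x # [] @ [y])"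
    "C - path_edges (x # is @ [y]) \<subseteq> C'"
    by (rule cycle_on_exchange[OF assms(1,3,4), of "[]" "W - set is"]) (use card in auto)
  then show thesis using that[of C'] assms(2,5) by auto
qed

lemma nonham_extension:
  assumes "cycle_on V' C"
  shows "\<not> C \<subseteq> E'"
proof
  assume CE: "C \<subseteq> E'"
  have new: "e \<in> {{v1, z1}, {v2, z2}, {v3, z3}, {v4, z4}, {z1, z2}, {z2, z3}, {z3, z4}, {z4, z1}}"
    if "e \<in> C" "z \<in> e" "z \<in> {z1, z2, z3, z4}" for e z
  proof -
    have "z \<notin> V" using that(3) ne by blast
    then have "e \<notin> E" using old_edge that(2) by blast
    then have "e \<in> new_edges" using CE that(1) unfolding E'_def by blast
    then show ?thesis by (simp only: new_edges_def)
  qed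
  have 1: "({z1, v1} \<in> C \<and> {z1, z2} \<in> C \<and> {z1, z4} \<notin> C) \<or>
    ({z1, v1} \<in> C \<and> {z1, z2} \<notin> C \<and> {z1, z4} \<in> C) \<or>
    ({z1, v1} \<notin> C \<and> {z1, z2} \<in> C \<and> {z1, z4} \<in> C)"
  proof (rule cycle_on_cubic_vertex[OF assms])
    fix e assume e: "e \<in> C" "z1 \<in> e"
    from new[OF e] have "e \<in> {{v1, z1}, {v2, z2}, {v3, z3}, {v4, z4}, {z1, z2}, {z2, z3}, {z3, z4}, {z4, z1}}"
      by simp
    then show "e = {z1, v1} \<or> e = {z1, z2} \<or> e = {z1, z4}"
      using e(2) all_ne by (elim insertE) (simp_all add: insert_commute)
  qed (use all_ne in \<open>auto simp: V'_def\<close>)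
  have 2: "({z2, v2} \<in> C \<and> {z2, z3} \<in> C \<and> {z2, z1} \<notin> C) \<or>
    ({z2, v2} \<in> C \<and> {z2, z3} \<notin> C \<and> {z2, z1} \<in> C) \<or>
    ({z2, v2} \<notin> C \<and> {z2, z3} \<in> C \<and> {z2, z1} \<in> C)"
  proof (rule cycle_on_cubic_vertex[OF assms])
    fix e assume e: "e \<in> C" "z2 \<in> e"
    from new[OF e] have "e \<in> {{v1, z1}, {v2, z2}, {v3, z3}, {v4, z4}, {z1, z2}, {z2, z3}, {z3, z4}, {z4, z1}}"
      by simp
    then show "e = {z2, v2} \<or> e = {z2, z3} \<or> e = {z2, z1}"
      using e(2) all_ne by (elim insertE) (simp_all add: insert_commute)
  qed (use all_ne in \<open>auto simp: V'_def\<close>)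
  have 3: "({z3, v3} \<in> C \<and> {z3, z4} \<in> C \<and> {z3, z2} \<notin> C) \<or>
    ({z3, v3} \<in> C \<and> {z3, z4} \<notin> C \<and> {z3, z2} \<in> C) \<or>
    ({z3, v3} \<notin> C \<and> {z3, z4} \<in> C \<and> {z3, z2} \<in> C)"
  proof (rule cycle_on_cubic_vertex[OF assms])
    fix e assume e: "e \<in> C" "z3 \<in> e"
    from new[OF e] have "e \<in> {{v1, z1}, {v2, z2}, {v3, z3}, {v4, z4}, {z1, z2}, {z2, z3}, {z3, z4}, {z4, z1}}"
      by simp
    then show "e = {z3, v3} \<or> e = {z3, z4} \<or> e = {z3, z2}"
      using e(2) all_ne by (elim insertE) (simp_all add: insert_commute)
  qed (use all_ne in \<open>auto simp: V'_def\<close>)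
  have 4: "({z4, v4} \<in> C \<and> {z4, z1} \<in> C \<and> {z4, z3} \<notin> C) \<or>
    ({z4, v4} \<in> C \<and> {z4, z1} \<notin> C \<and> {z4, z3} \<in> C) \<or>
    ({z4, v4} \<notin> C \<and> {z4, z1} \<in> C \<and> {z4, z3} \<in> C)"
  proof (rule cycle_on_cubic_vertex[OF assms])
    fix e assume e: "e \<in> C" "z4 \<in> e"
    from new[OF e] have "e \<in> {{v1, z1}, {v2, z2}, {v3, z3}, {v4, z4}, {z1, z2}, {z2, z3}, {z3, z4}, {z4, z1}}"
      by simp
    then show "e = {z4, v4} \<or> e = {z4, z1} \<or> e = {z4, z3}"
      using e(2) all_ne by (elim insertE) (simp_all add: insert_commute)
  qed (use all_ne in \<open>auto simp: V'_def\<close>)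
  \<comment> \<open>The cycle also visits \<open>v1\<close>, hence it leaves the new square, and
    only a spoke leads out. This rules out that \<open>C\<close> contains the new square as a closed
    cycle, a case that the degree conditions alone permit.\<close>
  have "\<exists>e \<in> C. e \<inter> {z1, z2, z3, z4} \<noteq> {} \<and> \<not> e \<subseteq> {z1, z2, z3, z4}"
    by (rule cycle_on_cut[OF assms, of z1 _ v1]) (use all_ne in \<open>auto simp: V'_def\<close>)
  then obtain e z where e: "e \<in> C" "z \<in> e" "z \<in> {z1, z2, z3, z4}" "\<not> e \<subseteq> {z1, z2, z3, z4}"
    by blast
  have 5: "{z1, v1} \<in> C \<or> {z2, v2} \<in> C \<or> {z3, v3} \<in> C \<or> {z4, v4} \<in> C"
    using new[OF e(1-3)] e(1,4) by (elim insertE) (simp_all add: insert_commute)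
  have sub: "C \<subseteq> E \<union> E'" using CE by blast
  \<comment> \<open>One passage collects all four new vertices; contracting it to the old edge
    between its ends gives a Hamiltonian cycle of the old graph.\<close>
  have single: False
    if "path_edges (x # is @ [y]) \<subseteq> C" "distinct (x # is @ [y])" "set is = {z1, z2, z3, z4}"
      "{x, y} \<in> E" for x "is" y
  proof -
    have eq: "V' - set is = V" using that(3) all_ne by (auto simp: V'_def)
    show False
      by (rule contract_path[OF assms sub that(2,1,4)]) (use nonham_old eq in auto)
  qed
  have double: False
    if p: "path_edges [x, a, b, y] \<subseteq> C" "distinct [x, a, b, y]" "{x, y} \<in> E"
      and q: "path_edges [x', a', b', y'] \<subseteq> C" "distinct [x', a', b', y']" "{x', y'} \<in> E"
      and all: "{a, b, a', b'} = {z1, z2, z3, z4}" and dis: "distinct [a, b, a', b']"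
      and V: "{x, y, x', y'} \<subseteq> V" for x y a b x' y' a' b'
  proof -
    have nV: "a \<notin> V" "b \<notin> V" "a' \<notin> V" "b' \<notin> V"
      using all ne(13-16) by (metis insertCI insertE emptyE)+
    have V'_eq: "V' = V \<union> {a, b, a', b'}" unfolding all V'_def ..
    obtain C' where C': "cycle_on (V' - {a, b}) C'" "C' \<subseteq> E \<union> E'"
      "C - path_edges (x # [a, b] @ [y]) \<subseteq> C'"
      by (rule contract_path[OF assms sub, of x "[a, b]" y]) (use p nV V'_eq in auto)
    \<comment> \<open>Each edge of the second passage contains \<open>a'\<close> or
      \<open>b'\<close>, and no edge of the first does. So the second passage survives the first
      contraction.\<close>
    have "path_edges [x', a', b', y'] \<inter> path_edges (x # [a, b] @ [y]) = {}"
      using nV dis V by (auto simp: doubleton_eq_iff)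
    then have sub': "path_edges (x' # [a', b'] @ [y']) \<subseteq> C'"
      using q(1) C'(3) unfolding append.simps by blast
    have V_eq: "V' - {a, b} - set [a', b'] = V" using V'_eq nV by auto
    obtain C'' where "cycle_on (V' - {a, b} - set [a', b']) C''" "C'' \<subseteq> E \<union> E'"
      by (rule contract_path[OF C'(1,2) _ sub' q(3)]) (use q(2) V_eq in auto)
    then show False using nonham_old unfolding V_eq by blast
  qed
  have sq: "{v1, v2} \<in> E" "{v2, v3} \<in> E" "{v3, v4} \<in> E" "{v4, v1} \<in> E" using square by auto
  \<comment> \<open>A corner whose spoke is used misses exactly one side, the other corners miss
    none. A missing side is missing at both its ends, so the corners with used spokes are paired
    along missing sides. This leaves four patterns with one passage and two patterns with
    two.\<close>
  have "\<not> ({v1, z1} \<in> C \<and> {z1, z4} \<in> C \<and> {z4, z3} \<in> C \<and> {z3, z2} \<in> C \<and> {z2, v2} \<in> C)"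
    using single[of v1 "[z1, z4, z3, z2]" v2] all_ne sq by auto
  moreover have "\<not> ({v2, z2} \<in> C \<and> {z2, z1} \<in> C \<and> {z1, z4} \<in> C \<and> {z4, z3} \<in> C \<and> {z3, v3} \<in> C)"
    using single[of v2 "[z2, z1, z4, z3]" v3] all_ne sq by auto
  moreover have "\<not> ({v3, z3} \<in> C \<and> {z3, z2} \<in> C \<and> {z2, z1} \<in> C \<and> {z1, z4} \<in> C \<and> {z4, v4} \<in> C)"
    using single[of v3 "[z3, z2, z1, z4]" v4] all_ne sq by auto
  moreover have "\<not> ({v4, z4} \<in> C \<and> {z4, z3} \<in> C \<and> {z3, z2} \<in> C \<and> {z2, z1} \<in> C \<and> {z1, v1} \<in> C)"
    using single[of v4 "[z4, z3, z2, z1]" v1] all_ne sq by auto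
  moreover have "\<not> ({v1, z1} \<in> C \<and> {z1, z2} \<in> C \<and> {z2, v2} \<in> C \<and>
      {v3, z3} \<in> C \<and> {z3, z4} \<in> C \<and> {z4, v4} \<in> C)"
    using double[of v1 z1 z2 v2 v3 z3 z4 v4] all_ne sq by auto
  moreover have "\<not> ({v2, z2} \<in> C \<and> {z2, z3} \<in> C \<and> {z3, v3} \<in> C \<and>
      {v4, z4} \<in> C \<and> {z4, z1} \<in> C \<and> {z1, v1} \<in> C)"
    using double[of v2 z2 z3 v3 v4 z4 z1 v1] all_ne sq by auto
  \<comment> \<open>Commuting the end points gives every edge a single written form, so that equal
    edges become the same propositional atom.\<close>
  ultimately show False
    using 1 2 3 4 5 by (simp only: insert_commute[of z2 z1] insert_commute[of z3 z2]
      insert_commute[of z4 z3] insert_commute[of z4 z1] insert_commute[of z1 v1]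
      insert_commute[of z2 v2] insert_commute[of z3 v3] insert_commute[of z4 v4]) sat
qed

end

section \<open>Hamiltonian cycles of the vertex-deleted extension\<close>

context square_extension
begin

text \<open>The path exchange in the opposite direction to \<open>contract_path\<close>. The result
  is only bounded by \<open>E \<union> E'\<close>, since a cycle that uses both deleted edges loses
  them in two separate steps.\<close>

lemma reroute:
  assumes "cycle_on W C" "C \<subseteq> E \<union> E'" "distinct (x # is @ [y])" "path_edges (x # is @ [y]) \<subseteq> C"
    and "distinct js" "set js \<inter> (W - set is) = {}" "path_edges (x # js @ [y]) \<subseteq> E'"
    and W': "W' = (W - set is) \<union> set js" "W' \<subseteq> V'" "{x, y} \<subseteq> W'" "js \<noteq> []" "{x, y} \<inter> set js = {}"
  obtains C' where "cycle_on W' C'" "C' \<subseteq> E \<union> E'" "path_edges (x # js @ [y]) \<subseteq> C'"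
    "C' \<subseteq> (C - path_edges (x # is @ [y])) \<union> path_edges (x # js @ [y])"
    "C - path_edges (x # is @ [y]) \<subseteq> C'"
proof -
  obtain j js' where j: "js = j # js'" using W'(4) by (cases js) auto
  have "3 \<le> card W'"
    by (rule card_V_ge[of _ x y j]) (use W' j assms(3) in auto)
  then obtain C' where C': "cycle_on W' C'"
    "C' \<subseteq> (C - path_edges (x # is @ [y])) \<union> path_edges (x # js @ [y])"
    "path_edges (x # js @ [y]) \<subseteq> C'" "C - path_edges (x # is @ [y]) \<subseteq> C'"
    by (rule cycle_on_exchange[OF assms(1,3,4,5,6) W'(1)])
  then show thesis using that[OF C'(1) _ C'(3,2,4)] assms(2,7) by blast
qed

lemma new_in_E': "{v1, z1} \<in> E'" "{v2, z2} \<in> E'" "{v3, z3} \<in> E'" "{v4, z4} \<in> E'"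
  "{z1, z2} \<in> E'" "{z2, z3} \<in> E'" "{z3, z4} \<in> E'" "{z4, z1} \<in> E'"
  "{z1, v1} \<in> E'" "{z2, v2} \<in> E'" "{z3, v3} \<in> E'" "{z4, v4} \<in> E'"
  "{z2, z1} \<in> E'" "{z3, z2} \<in> E'" "{z4, z3} \<in> E'" "{z1, z4} \<in> E'"
  by (simp_all add: E'_def new_edges_def insert_commute)

lemma side_in_E': "{v2, v3} \<in> E'" "{v3, v2} \<in> E'" "{v4, v1} \<in> E'" "{v1, v4} \<in> E'"
proof -
  have "{v2, v3} \<in> E'" "{v4, v1} \<in> E'"
    by (rule old_edge_in_E'; use square in \<open>simp add: doubleton_eq_iff; metis\<close>)+
  then show "{v2, v3} \<in> E'" "{v3, v2} \<in> E'" "{v4, v1} \<in> E'" "{v1, v4} \<in> E'"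
    by (simp_all add: insert_commute)
qed

text \<open>One old edge is replaced by a path through all four new vertices. The hypotheses
  \<open>keep\<close> make the replaced edge the only candidate for a deleted edge in
  \<open>C\<close>, so everything that is left lies in \<open>E'\<close>.\<close>

lemma detour:
  assumes C: "cycle_on W C" "C \<subseteq> E" "W \<subseteq> V" and "{x, y} \<in> C" "x \<noteq> y"
    and js: "distinct js" "set js = {z1, z2, z3, z4}" "path_edges (x # js @ [y]) \<subseteq> E'"
    and keep: "{v1, v2} \<in> C \<Longrightarrow> {v1, v2} = {x, y}" "{v3, v4} \<in> C \<Longrightarrow> {v3, v4} = {x, y}"
  shows "\<exists>C'. cycle_on (W \<union> {z1, z2, z3, z4}) C' \<and> C' \<subseteq> E' \<and> path_edges (x # js @ [y]) \<subseteq> C'"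
proof -
  have xy: "{x, y} \<subseteq> W" using cycle_on_edge_subset[OF C(1)] assms(4) by blast
  have fr: "{z1, z2, z3, z4} \<inter> W = {}" using C(3) fresh(2) by blast
  obtain C' where C': "cycle_on (W \<union> {z1, z2, z3, z4}) C'" "C' \<subseteq> E \<union> E'"
    "path_edges (x # js @ [y]) \<subseteq> C'"
    "C' \<subseteq> (C - path_edges (x # [] @ [y])) \<union> path_edges (x # js @ [y])"
  proof (rule reroute[OF C(1), of x "[]" y js "W \<union> {z1, z2, z3, z4}"])
    show "C \<subseteq> E \<union> E'" using C(2) by blast
    show "set js \<inter> (W - set []) = {}" using fr js(2) by simp
    show "{x, y} \<inter> set js = {}" using xy fr js(2) by blast
    show "W \<union> {z1, z2, z3, z4} \<subseteq> V'" using C(3) unfolding V'_def by blast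
    show "{x, y} \<subseteq> W \<union> {z1, z2, z3, z4}" using xy by blast
    show "js \<noteq> []" using js(2) by auto
  qed (use assms(4,5) js in simp_all)
  have "e \<in> E'" if "e \<in> C'" for e
  proof (cases "e \<in> path_edges (x # js @ [y])")
    case False
    with that C'(4) have "e \<in> C - path_edges (x # [] @ [y])" by blast
    then have "e \<in> C" "e \<noteq> {x, y}" by auto
    then show ?thesis using keep C(2) old_edge_in_E' by blast
  qed (use js in blast)
  then show ?thesis using C' by blast
qed

text \<open>Here a single path through all new vertices would leave the other deleted edge in the
  cycle. The new vertices are therefore shared out: \<open>z1\<close>, \<open>z2\<close> replace the
  first edge and \<open>z3\<close>, \<open>z4\<close> the second.\<close>

lemma double_detour:
  assumes C: "cycle_on W C" "C \<subseteq> E" "W \<subseteq> V" and in_C: "{v1, v2} \<in> C" "{v3, v4} \<in> C"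
  shows "\<exists>C'. cycle_on (W \<union> {z1, z2, z3, z4}) C' \<and> C' \<subseteq> E' \<and> {z1, z2} \<in> C'"
proof -
  have vW: "{v1, v2} \<subseteq> W" "{v3, v4} \<subseteq> W"
    using cycle_on_edge_subset[OF C(1)] in_C by blast+
  have fr: "{z1, z2, z3, z4} \<inter> W = {}" using C(3) fresh(2) by blast
  obtain C1 where C1: "cycle_on (W \<union> {z1, z2}) C1" "C1 \<subseteq> E \<union> E'"
    "path_edges (v1 # [z1, z2] @ [v2]) \<subseteq> C1"
    "C1 \<subseteq> (C - path_edges (v1 # [] @ [v2])) \<union> path_edges (v1 # [z1, z2] @ [v2])"
    "C - path_edges (v1 # [] @ [v2]) \<subseteq> C1"
  proof (rule reroute[OF C(1), of v1 "[]" v2 "[z1, z2]" "W \<union> {z1, z2}"])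
    show "C \<subseteq> E \<union> E'" using C(2) by blast
    show "set [z1, z2] \<inter> (W - set []) = {}" using fr by simp
    show "W \<union> {z1, z2} \<subseteq> V'" using C(3) unfolding V'_def by blast
    show "{v1, v2} \<subseteq> W \<union> {z1, z2}" using vW by blast
  qed (use in_C all_ne new_in_E' in simp_all)
  have ne34: "{v3, v4} \<noteq> {v1, v2}" using all_ne by (simp add: doubleton_eq_iff)
  then have in1: "{v3, v4} \<in> C1" using in_C C1(5) by auto
  obtain C2 where C2: "cycle_on (W \<union> {z1, z2, z3, z4}) C2" "C2 \<subseteq> E \<union> E'"
    "path_edges (v3 # [z3, z4] @ [v4]) \<subseteq> C2"
    "C2 \<subseteq> (C1 - path_edges (v3 # [] @ [v4])) \<union> path_edges (v3 # [z3, z4] @ [v4])"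
    "C1 - path_edges (v3 # [] @ [v4]) \<subseteq> C2"
  proof (rule reroute[OF C1(1,2), of v3 "[]" v4 "[z3, z4]" "W \<union> {z1, z2, z3, z4}"])
    show "set [z3, z4] \<inter> (W \<union> {z1, z2} - set []) = {}" using fr all_ne by simp
    show "W \<union> {z1, z2, z3, z4} \<subseteq> V'" using C(3) unfolding V'_def by blast
    show "{v3, v4} \<subseteq> W \<union> {z1, z2, z3, z4}" using vW by blast
  qed (use in1 all_ne new_in_E' in auto)
  have p1: "e \<in> E'" if "e \<in> path_edges (v1 # [z1, z2] @ [v2])" for e
    using that new_in_E' by auto
  have p2: "e \<in> E'" if "e \<in> path_edges (v3 # [z3, z4] @ [v4])" for e
    using that new_in_E' by auto
  have "e \<in> E'" if e2: "e \<in> C2" for e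
  proof -
    consider "e \<in> path_edges (v3 # [z3, z4] @ [v4])" | "e \<in> C1 - path_edges (v3 # [] @ [v4])"
      using C2(4) e2 by blast
    then show ?thesis
    proof cases
      case 2
      then have e: "e \<in> C1" "e \<noteq> {v3, v4}" by auto
      consider "e \<in> path_edges (v1 # [z1, z2] @ [v2])" | "e \<in> C - path_edges (v1 # [] @ [v2])"
        using C1(4) e(1) by blast
      then show ?thesis
      proof cases
        case 2
        then have "e \<in> C" "e \<noteq> {v1, v2}" by auto
        then show ?thesis using e(2) C(2) old_edge_in_E' by blast
      qed (rule p1)
    qed (rule p2)
  qed
  moreover have "{z1, z2} \<in> C1" using C1(3) by simp
  then have "{z1, z2} \<in> C2" using C2(5) all_ne by (auto simp: doubleton_eq_iff)
  ultimately show ?thesis using C2(1) by blast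
qed

lemma V'_minus: "w \<in> V \<Longrightarrow> V' - {w} = (V - {w}) \<union> {z1, z2, z3, z4}"
  using fresh(2) unfolding V'_def by blast

lemma square_detours:
  "path_edges (v1 # [z1, z4, z3, z2] @ [v2]) \<subseteq> E'" "path_edges (v3 # [z3, z2, z1, z4] @ [v4]) \<subseteq> E'"
  "path_edges (v2 # [z2, z1, z4, z3] @ [v3]) \<subseteq> E'" "path_edges (v4 # [z4, z3, z2, z1] @ [v1]) \<subseteq> E'"
  "distinct [z1, z4, z3, z2]" "distinct [z3, z2, z1, z4]" "distinct [z2, z1, z4, z3]"
  "distinct [z4, z3, z2, z1]"
  "set [z1, z4, z3, z2] = {z1, z2, z3, z4}" "set [z3, z2, z1, z4] = {z1, z2, z3, z4}"
  "set [z2, z1, z4, z3] = {z1, z2, z3, z4}" "set [z4, z3, z2, z1] = {z1, z2, z3, z4}"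
  using new_in_E' all_ne by (simp_all add: insert_commute)

text \<open>The cases record which of the deleted edges are used. If neither is, the hypothesis
  yields one of the surviving sides, and the detour starts there. Every detour goes the long way
  round the new square and so uses some of its edges, which is the goodness required of the new
  square.\<close>

lemma extend_cycle:
  assumes C: "cycle_on (V - {w}) C" "C \<subseteq> E" "w \<in> V"
    and "C \<inter> {{v1, v2}, {v2, v3}, {v3, v4}, {v4, v1}} \<noteq> {}"
  shows "\<exists>C. cycle_on (V' - {w}) C \<and> C \<subseteq> E' \<and> C \<inter> {{z1, z2}, {z2, z3}, {z3, z4}, {z4, z1}} \<noteq> {}"
proof -
  have sub: "V - {w} \<subseteq> V" by blast
  note D = detour[OF C(1,2) sub]
  consider "{v1, v2} \<in> C" "{v3, v4} \<in> C" | "{v1, v2} \<in> C" "{v3, v4} \<notin> C"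
    | "{v1, v2} \<notin> C" "{v3, v4} \<in> C" | "{v1, v2} \<notin> C" "{v3, v4} \<notin> C" "{v2, v3} \<in> C"
    | "{v1, v2} \<notin> C" "{v3, v4} \<notin> C" "{v4, v1} \<in> C"
    using assms(4) by blast
  then have "\<exists>C'. cycle_on ((V - {w}) \<union> {z1, z2, z3, z4}) C' \<and> C' \<subseteq> E' \<and>
      ({z1, z2} \<in> C' \<or> {z2, z3} \<in> C' \<or> {z3, z4} \<in> C')"
  proof cases
    case 1
    then show ?thesis using double_detour[OF C(1,2) sub] by blast
  next
    case 2
    from D[OF this(1) all_ne(1) square_detours(5,9,1)] 2(2)
    obtain C' where "cycle_on ((V - {w}) \<union> {z1, z2, z3, z4}) C'" "C' \<subseteq> E'"
      "path_edges (v1 # [z1, z4, z3, z2] @ [v2]) \<subseteq> C'" by blast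
    then show ?thesis by (intro exI[of _ C']) (simp add: insert_commute)
  next
    case 3
    from D[OF this(2) all_ne(6) square_detours(6,10,2)] 3(1)
    obtain C' where "cycle_on ((V - {w}) \<union> {z1, z2, z3, z4}) C'" "C' \<subseteq> E'"
      "path_edges (v3 # [z3, z2, z1, z4] @ [v4]) \<subseteq> C'" by blast
    then show ?thesis by (intro exI[of _ C']) (simp add: insert_commute)
  next
    case 4
    from D[OF this(3) all_ne(4) square_detours(7,11,3)] 4(1,2)
    obtain C' where "cycle_on ((V - {w}) \<union> {z1, z2, z3, z4}) C'" "C' \<subseteq> E'"
      "path_edges (v2 # [z2, z1, z4, z3] @ [v3]) \<subseteq> C'" by blast
    then show ?thesis by (intro exI[of _ C']) (simp add: insert_commute)
  next
    case 5
    from D[OF this(3) all_ne(3)[symmetric] square_detours(8,12,4)] 5(1,2)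
    obtain C' where "cycle_on ((V - {w}) \<union> {z1, z2, z3, z4}) C'" "C' \<subseteq> E'"
      "path_edges (v4 # [z4, z3, z2, z1] @ [v1]) \<subseteq> C'" by blast
    then show ?thesis by (intro exI[of _ C']) (simp add: insert_commute)
  qed
  then show ?thesis unfolding V'_minus[OF C(3)] by blast
qed

text \<open>To miss a new vertex, reinsert the deleted vertex \<open>u\<close> of the square and send the path through
  its opposite vertex \<open>t\<close> along the three other new vertices.\<close>

lemma cycle_missing_new:
  assumes C: "cycle_on (V - {u}) C" "C \<subseteq> E" "{x, t} \<in> C" "{t, y} \<in> C"
    and sq: "{x, t, y, u} = {v1, v2, v3, v4}" "distinct [x, t, y, u]"
    and z: "{a, b, c, w} = {z1, z2, z3, z4}" "distinct [a, b, c, w]"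
    and E': "{{x, u}, {u, a}, {a, b}, {b, c}, {c, t}, {t, y}} \<subseteq> E'"
    and del: "{v1, v2} = {u, y} \<or> {v1, v2} = {x, t}" "{v3, v4} = {u, y} \<or> {v3, v4} = {x, t}"
  shows "\<exists>C. cycle_on (V' - {w}) C \<and> C \<subseteq> E' \<and> {a, b} \<in> C \<and> {b, c} \<in> C"
proof -
  have inV: "{x, t, y, u} \<subseteq> V" using sq(1) square(2) by simp
  have notV: "{a, b, c, w} \<inter> V = {}" using z(1) fresh(2) by simp
  have V': "V' = V \<union> {a, b, c, w}" unfolding z(1) V'_def ..
  \<comment> \<open>The vertex \<open>t\<close> is removed as the interior of the old path and
    returns as the last interior vertex of the new one, so the exchange can act on the whole stretch
    from \<open>x\<close> to \<open>y\<close>.\<close>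
  have W: "V' - {w} = (V - {u} - set [t]) \<union> set [u, a, b, c, t]"
    unfolding V' using inV notV z(2) by auto
  obtain C' where C': "cycle_on (V' - {w}) C'" "C' \<subseteq> E \<union> E'"
    "path_edges (x # [u, a, b, c, t] @ [y]) \<subseteq> C'"
    "C' \<subseteq> (C - path_edges (x # [t] @ [y])) \<union> path_edges (x # [u, a, b, c, t] @ [y])"
  proof (rule reroute[OF C(1), of x "[t]" y "[u, a, b, c, t]" "V' - {w}"])
    show "C \<subseteq> E \<union> E'" using C(2) by blast
    show "set [u, a, b, c, t] \<inter> (V - {u} - set [t]) = {}" using notV by auto
    show "distinct [u, a, b, c, t]" using inV notV z(2) sq(2) by auto
    show "{x, y} \<inter> set [u, a, b, c, t] = {}" using inV notV sq(2) by auto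
    show "{x, y} \<subseteq> V' - {w}" unfolding V' using inV notV by auto
    show "V' - {w} \<subseteq> V'" by blast
  qed (use W C sq(2) E' in simp_all)
  have "e \<in> E'" if "e \<in> C'" for e
  proof (cases "e \<in> path_edges (x # [u, a, b, c, t] @ [y])")
    case True
    then show ?thesis using E' by auto
  next
    case False
    with that C'(4) have "e \<in> C - path_edges (x # [t] @ [y])" by blast
    then have e: "e \<in> C" "e \<noteq> {x, t}" by auto
    \<comment> \<open>Both deleted edges are avoided for different reasons: \<open>{x, t}\<close>
      leaves with the replaced path, while \<open>{u, y}\<close> contains \<open>u\<close>, which
      the cycle \<open>C\<close> does not visit.\<close>
    moreover have "e \<noteq> {u, y}" using cycle_on_edge_subset[OF C(1) e(1)] by blast
    ultimately show ?thesis using del C(2) by (intro old_edge_in_E') auto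
  qed
  then show ?thesis using C'(1,3) by auto
qed

lemma simple_graph_extension: "simple_graph V' E'"
  unfolding simple_graph_def
proof (intro conjI ballI)
  show "finite V'" using finite_V by (simp add: V'_def)
  fix e assume "e \<in> E'"
  then consider "e \<in> E" | "e \<in> new_edges" by (auto simp: E'_def)
  then have "e \<subseteq> V' \<and> card e = 2"
  proof cases
    case 1
    then show ?thesis using graph by (auto simp: simple_graph_def V'_def)
  next
    case 2
    then show ?thesis unfolding new_edges_def
      by (elim insertE) (use all_ne in \<open>simp_all add: V'_def\<close>)
  qed
  then show "e \<subseteq> V'" "card e = 2" by simp_all
qed

lemma extension: "hypo_square V' E' z1 z2 z3 z4"
proof
  show "simple_graph V' E'" by (rule simple_graph_extension)
  show "distinct [z1, z2, z3, z4]" by (rule fresh)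
  show "{z1, z2, z3, z4} \<subseteq> V'" by (simp add: V'_def)
  show "{{z1, z2}, {z2, z3}, {z3, z4}, {z4, z1}} \<subseteq> E'" using new_in_E' by simp
  show "\<not> C \<subseteq> E'" if "cycle_on V' C" for C using nonham_extension[OF that] .
  show "\<exists>C. cycle_on (V' - {w}) C \<and> C \<subseteq> E' \<and> C \<inter> {{z1, z2}, {z2, z3}, {z3, z4}, {z4, z1}} \<noteq> {}"
    if "w \<in> V' - {z1, z2, z3, z4}" for w
  proof -
    have w: "w \<in> V" using that unfolding V'_def by blast
    \<comment> \<open>The old corners are ordinary vertices of the new graph. Their cycles use two
      edges of the old square, hence at least one.\<close>
    have "\<exists>C. cycle_on (V - {w}) C \<and> C \<subseteq> E \<and> C \<inter> {{v1, v2}, {v2, v3}, {v3, v4}, {v4, v1}} \<noteq> {}"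
    proof (cases "w \<in> {v1, v2, v3, v4}")
      case True
      then show ?thesis using del1 del2 del3 del4 by (elim insertE) blast+
    next
      case False
      then show ?thesis using del_off[of w] w by blast
    qed
    then show ?thesis by (elim exE conjE) (rule extend_cycle[OF _ _ w])
  qed
  \<comment> \<open>The new vertices other than \<open>z1\<close> form a path from \<open>z2\<close>
    to \<open>z4\<close>, which attaches at \<open>v2\<close> and \<open>v4\<close>; so
    \<open>u\<close> is \<open>v2\<close> and \<open>t\<close> is \<open>v4\<close>. The direction
    is chosen such that \<open>{x, u}\<close> and \<open>{t, y}\<close> are the surviving sides
    \<open>{v2, v3}\<close> and \<open>{v4, v1}\<close>. The other three corners follow the same
    rule, two of them with the path read backwards.\<close>
  from del2 obtain C where "cycle_on (V - {v2}) C" "C \<subseteq> E" "{v3, v4} \<in> C" "{v4, v1} \<in> C" by blast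
  then show "\<exists>C. cycle_on (V' - {z1}) C \<and> C \<subseteq> E' \<and> {z2, z3} \<in> C \<and> {z3, z4} \<in> C"
    by (rule cycle_missing_new) (use all_ne new_in_E' side_in_E' in \<open>simp_all add: insert_commute\<close>)
  from del1 obtain C where "cycle_on (V - {v1}) C" "C \<subseteq> E" "{v4, v3} \<in> C" "{v3, v2} \<in> C"
    by (metis insert_commute)
  then have "\<exists>C. cycle_on (V' - {z2}) C \<and> C \<subseteq> E' \<and> {z1, z4} \<in> C \<and> {z4, z3} \<in> C"
    by (rule cycle_missing_new) (use all_ne new_in_E' side_in_E' in \<open>simp_all add: insert_commute\<close>)
  then show "\<exists>C. cycle_on (V' - {z2}) C \<and> C \<subseteq> E' \<and> {z3, z4} \<in> C \<and> {z4, z1} \<in> C"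
    by (metis insert_commute)
  from del4 obtain C where "cycle_on (V - {v4}) C" "C \<subseteq> E" "{v1, v2} \<in> C" "{v2, v3} \<in> C" by blast
  then show "\<exists>C. cycle_on (V' - {z3}) C \<and> C \<subseteq> E' \<and> {z4, z1} \<in> C \<and> {z1, z2} \<in> C"
    by (rule cycle_missing_new) (use all_ne new_in_E' side_in_E' in \<open>simp_all add: insert_commute\<close>)
  from del3 obtain C where "cycle_on (V - {v3}) C" "C \<subseteq> E" "{v2, v1} \<in> C" "{v1, v4} \<in> C"
    by (metis insert_commute)
  then have "\<exists>C. cycle_on (V' - {z4}) C \<and> C \<subseteq> E' \<and> {z3, z2} \<in> C \<and> {z2, z1} \<in> C"
    by (rule cycle_missing_new) (use all_ne new_in_E' side_in_E' in \<open>simp_all add: insert_commute\<close>)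
  then show "\<exists>C. cycle_on (V' - {z4}) C \<and> C \<subseteq> E' \<and> {z1, z2} \<in> C \<and> {z2, z3} \<in> C"
    by (metis insert_commute)
qed

end

section \<open>Straight-line drawings\<close>

text \<open>The hull of the two end points is the segment between them. It depends only on the set
  \<open>e\<close>, so no direction of the edge has to be chosen.\<close>

definition plane_straight :: "'a set \<Rightarrow> 'a set set \<Rightarrow> ('a \<Rightarrow> complex) \<Rightarrow> bool" where
  "plane_straight V E pt \<longleftrightarrow> inj_on pt V \<and>
     (\<forall>e \<in> E. convex hull (pt ` e) \<inter> pt ` V \<subseteq> pt ` e) \<and>
     (\<forall>e \<in> E. \<forall>f \<in> E. e \<noteq> f \<longrightarrow> convex hull (pt ` e) \<inter> convex hull (pt ` f) \<subseteq> pt ` (e \<inter> f))"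

lemma planar_graph_of:
  assumes "simple_graph V E" "plane_straight V E pt"
  shows "planar (graph_of V E)"
  unfolding planar_def plane_drawing_def
proof (intro exI[of _ pt] exI[of _ "\<lambda>e. convex hull (pt ` e)"] conjI ballI)
  show "inj_on pt (pverts (graph_of V E))"
    using assms(2) by (simp add: plane_straight_def graph_of_def)
next
  fix a assume "a \<in> parcs (graph_of V E)"
  then obtain u v where a: "a = (u, v)" and uv: "{u, v} \<in> E" by (auto simp: graph_of_def)
  then have V: "u \<in> V" "v \<in> V" "u \<noteq> v" using assms(1) by (auto simp: simple_graph_def)
  then have "pt u \<noteq> pt v" using assms(2) by (auto simp: plane_straight_def inj_on_def)
  then have "arc (linepath (pt u) (pt v))" by (rule arc_linepath)
  moreover have "path_image (linepath (pt u) (pt v)) = convex hull (pt ` {u, v})"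
    by (simp add: segment_convex_hull)
  moreover have "convex hull (pt ` {u, v}) \<inter> pt ` V = {pt u, pt v}"
  proof
    have "convex hull (pt ` {u, v}) \<inter> pt ` V \<subseteq> pt ` {u, v}"
      using assms(2) uv unfolding plane_straight_def by blast
    then show "convex hull (pt ` {u, v}) \<inter> pt ` V \<subseteq> {pt u, pt v}" by simp
    show "{pt u, pt v} \<subseteq> convex hull (pt ` {u, v}) \<inter> pt ` V"
      using V hull_subset[of "pt ` {u, v}" convex] by auto
  qed
  ultimately show "case a of (u, v) \<Rightarrow> (\<exists>g. arc g \<and> pathstart g = pt u \<and> pathfinish g = pt v \<and>
      path_image g = convex hull (pt ` {u, v})) \<and>
      convex hull (pt ` {u, v}) \<inter> pt ` pverts (graph_of V E) = {pt u, pt v}"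
    unfolding a by (auto simp: graph_of_def intro!: exI[of _ "linepath (pt u) (pt v)"])
next
  fix a assume "a \<in> parcs (graph_of V E)"
  then obtain u v where a: "a = (u, v)" and uv: "{u, v} \<in> E" by (auto simp: graph_of_def)
  have disj: "convex hull (pt ` e) \<inter> convex hull (pt ` f) \<subseteq> pt ` (e \<inter> f)"
    if "e \<in> E" "f \<in> E" "e \<noteq> f" for e f
    using assms(2) that unfolding plane_straight_def by blast
  show "case a of (u, v) \<Rightarrow> \<forall>(x, y) \<in> parcs (graph_of V E). {u, v} \<noteq> {x, y} \<longrightarrow>
      convex hull (pt ` {u, v}) \<inter> convex hull (pt ` {x, y}) \<subseteq> pt ` ({u, v} \<inter> {x, y})"
    unfolding a prod.case
  proof (rule ballI)
    fix b assume "b \<in> parcs (graph_of V E)"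
    then obtain x y where b: "b = (x, y)" and xy: "{x, y} \<in> E" by (auto simp: graph_of_def)
    show "case b of (x, y) \<Rightarrow> {u, v} \<noteq> {x, y} \<longrightarrow>
      convex hull (pt ` {u, v}) \<inter> convex hull (pt ` {x, y}) \<subseteq> pt ` ({u, v} \<inter> {x, y})"
      unfolding b prod.case by (intro impI disj uv xy)
  qed
qed

text \<open>Bounding box and line equation. For the horizontal, vertical and diagonal segments of
  the extension these become linear constraints; for integer end points they yield the sign tests
  below.\<close>

lemma segment_Re_Im:
  assumes "w \<in> closed_segment a b"
  shows "min (Re a) (Re b) \<le> Re w" "Re w \<le> max (Re a) (Re b)"
    "min (Im a) (Im b) \<le> Im w" "Im w \<le> max (Im a) (Im b)"
    "(Re w - Re a) * (Im b - Im a) = (Im w - Im a) * (Re b - Re a)"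
proof -
  obtain t where t: "0 \<le> t" "t \<le> 1" "w = (1 - t) *\<^sub>R a + t *\<^sub>R b"
    using assms by (auto simp: in_segment)
  have *: "min p q \<le> (1 - t) * p + t * q \<and> (1 - t) * p + t * q \<le> max p q" for p q :: real
  proof -
    have "(1 - t) * p \<le> (1 - t) * max p q" "t * q \<le> t * max p q"
      "(1 - t) * min p q \<le> (1 - t) * p" "t * min p q \<le> t * q"
      using t by (auto intro!: mult_left_mono)
    then show ?thesis by (simp add: algebra_simps)
  qed
  show "min (Re a) (Re b) \<le> Re w" "Re w \<le> max (Re a) (Re b)"
    "min (Im a) (Im b) \<le> Im w" "Im w \<le> max (Im a) (Im b)"
    using * t(3) by simp_all
  show "(Re w - Re a) * (Im b - Im a) = (Im w - Im a) * (Re b - Re a)"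
    unfolding t(3) by (simp add: algebra_simps)
qed

text \<open>The corners run counterclockwise from the upper right one. Since the box is centred at
  the origin, corresponding corners of the box and of its double lie on common diagonals.\<close>

definition framed :: "'a set \<Rightarrow> ('a \<Rightarrow> complex) \<Rightarrow> real \<Rightarrow> 'a \<Rightarrow> 'a \<Rightarrow> 'a \<Rightarrow> 'a \<Rightarrow> bool" where
  "framed V pt m v1 v2 v3 v4 \<longleftrightarrow> 0 < m \<and> (\<forall>v \<in> V. \<bar>Re (pt v)\<bar> \<le> m \<and> \<bar>Im (pt v)\<bar> \<le> m) \<and>
     pt v1 = Complex m m \<and> pt v2 = Complex (- m) m \<and>
     pt v3 = Complex (- m) (- m) \<and> pt v4 = Complex m (- m)"

lemma convex_Re_Im_box: "convex {w. \<bar>Re w\<bar> \<le> m \<and> \<bar>Im w\<bar> \<le> m}"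
proof -
  have "{w. \<bar>Re w\<bar> \<le> m \<and> \<bar>Im w\<bar> \<le> m} = cbox (Complex (- m) (- m)) (Complex m m)"
    by (auto simp: in_cbox_complex_iff abs_le_iff)
  then show ?thesis by (simp add: convex_box)
qed

section \<open>Drawing the extension around the old box\<close>

context square_extension
begin

definition "extend_pt pt m = pt(z1 := Complex (2 * m) (2 * m), z2 := Complex (- 2 * m) (2 * m),
  z3 := Complex (- 2 * m) (- 2 * m), z4 := Complex (2 * m) (- 2 * m))"

lemma extend_pt_simps:
  "extend_pt pt m z1 = Complex (2 * m) (2 * m)" "extend_pt pt m z2 = Complex (- 2 * m) (2 * m)"
  "extend_pt pt m z3 = Complex (- 2 * m) (- 2 * m)" "extend_pt pt m z4 = Complex (2 * m) (- 2 * m)"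
  "v \<in> V \<Longrightarrow> extend_pt pt m v = pt v"
  using all_ne by (auto simp: extend_pt_def)

lemma framed_extension:
  assumes "framed V pt m v1 v2 v3 v4"
  shows "framed V' (extend_pt pt m) (2 * m) z1 z2 z3 z4"
proof -
  have "\<bar>Re (extend_pt pt m v)\<bar> \<le> 2 * m \<and> \<bar>Im (extend_pt pt m v)\<bar> \<le> 2 * m" if "v \<in> V'" for v
  proof (cases "v \<in> V")
    case True
    then have "\<bar>Re (pt v)\<bar> \<le> m \<and> \<bar>Im (pt v)\<bar> \<le> m" "0 < m" using assms by (auto simp: framed_def)
    then show ?thesis using True by (simp add: extend_pt_simps)
  next
    case False
    then have "v = z1 \<or> v = z2 \<or> v = z3 \<or> v = z4" using that by (auto simp: V'_def)
    then show ?thesis using assms by (auto simp: framed_def extend_pt_simps)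
  qed
  then show ?thesis using assms by (simp add: framed_def extend_pt_simps)
qed

text \<open>The box is convex, so old edges stay inside it. The spokes run outwards along the
  diagonals and the new sides lie on the boundary of the doubled box, so new edges meet the old box
  only in its corners, and each other only in corners of the doubled box.\<close>

lemma plane_straight_extension:
  assumes fr: "framed V pt m v1 v2 v3 v4" and pl: "plane_straight V E pt"
  shows "plane_straight V' E' (extend_pt pt m)"
proof -
  let ?p = "extend_pt pt m"
  let ?h = "\<lambda>e. convex hull (?p ` e)"
  have m: "0 < m" using fr by (simp add: framed_def)
  have pv: "?p v1 = Complex m m" "?p v2 = Complex (- m) m"
    "?p v3 = Complex (- m) (- m)" "?p v4 = Complex m (- m)"
    using fr all_ne by (simp_all add: framed_def extend_pt_simps)
  note pz = extend_pt_simps(1-4)[of pt m]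
  have inV: "\<bar>Re (?p v)\<bar> \<le> m" "\<bar>Im (?p v)\<bar> \<le> m" if "v \<in> V" for v
    using fr that by (simp_all add: framed_def extend_pt_simps)
  have img: "?p ` e = pt ` e" if "e \<subseteq> V" for e
    using that by (intro image_cong) (auto simp: extend_pt_simps)
  have injV: "u = v" if "u \<in> V" "v \<in> V" "?p u = ?p v" for u v
    using pl that by (auto simp: plane_straight_def inj_on_def extend_pt_simps)
  have old_box: "\<bar>Re w\<bar> \<le> m \<and> \<bar>Im w\<bar> \<le> m" if "e \<in> E" "w \<in> ?h e" for e w
  proof -
    have "?p ` e \<subseteq> {w. \<bar>Re w\<bar> \<le> m \<and> \<bar>Im w\<bar> \<le> m}" using old_edge[OF that(1)] inV by blast
    then have "?h e \<subseteq> {w. \<bar>Re w\<bar> \<le> m \<and> \<bar>Im w\<bar> \<le> m}" by (intro hull_minimal convex_Re_Im_box)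
    then show ?thesis using that(2) by blast
  qed
  have old_vertex: "v \<in> e" if "e \<in> E" "?p v \<in> ?h e" "v \<in> V" for e v
  proof -
    have "pt v \<in> convex hull (pt ` e)"
      using that(2) by (simp only: img[OF old_edge[OF that(1)]] extend_pt_simps(5)[OF that(3)])
    then have "pt v \<in> pt ` e"
      using pl that(1,3) unfolding plane_straight_def by blast
    then obtain u where "u \<in> e" "pt u = pt v" by auto
    then show ?thesis using injV[of u v] that old_edge[OF that(1)] by (auto simp: extend_pt_simps)
  qed
  have seg: "?h {a, b} = closed_segment (?p a) (?p b)" for a b
    by (simp add: segment_convex_hull)
  \<comment> \<open>On a spoke with slope -1 the line equation carries the factor \<open>m\<close>,
    which has to be cancelled to obtain a linear condition.\<close>
  have cancel: "a = - b" if "m * b + m * a = 0" for a b :: real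
  proof -
    have "m * (b + a) = 0" using that by (simp only: distrib_left)
    then show ?thesis using m by simp
  qed
  have d1: "Re w = Im w \<and> m \<le> Re w \<and> Re w \<le> 2 * m" if "w \<in> ?h {v1, z1}" for w
    using segment_Re_Im[OF that[unfolded seg]] m by (simp add: pv pz)
  have d2: "Re w = - Im w \<and> m \<le> Im w \<and> Im w \<le> 2 * m" if "w \<in> ?h {v2, z2}" for w
    using segment_Re_Im[OF that[unfolded seg]] m cancel[of "Im w" "Re w"]
    by (simp add: pv pz) (simp add: algebra_simps)
  have d3: "Re w = Im w \<and> - 2 * m \<le> Re w \<and> Re w \<le> - m" if "w \<in> ?h {v3, z3}" for w
    using segment_Re_Im[OF that[unfolded seg]] m by (simp add: pv pz)
  have d4: "Re w = - Im w \<and> m \<le> Re w \<and> Re w \<le> 2 * m" if "w \<in> ?h {v4, z4}" for w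
    using segment_Re_Im[OF that[unfolded seg]] m cancel[of "Im w" "Re w"]
    by (simp add: pv pz) (simp add: algebra_simps)
  have s1: "Im w = 2 * m \<and> \<bar>Re w\<bar> \<le> 2 * m" if "w \<in> ?h {z1, z2}" for w
    using segment_Re_Im[OF that[unfolded seg]] m by (simp add: pz abs_le_iff)
  have s2: "Re w = - 2 * m \<and> \<bar>Im w\<bar> \<le> 2 * m" if "w \<in> ?h {z2, z3}" for w
    using segment_Re_Im[OF that[unfolded seg]] m by (simp add: pz abs_le_iff)
  have s3: "Im w = - 2 * m \<and> \<bar>Re w\<bar> \<le> 2 * m" if "w \<in> ?h {z3, z4}" for w
    using segment_Re_Im[OF that[unfolded seg]] m by (simp add: pz abs_le_iff)
  have s4: "Re w = 2 * m \<and> \<bar>Im w\<bar> \<le> 2 * m" if "w \<in> ?h {z4, z1}" for w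
    using segment_Re_Im[OF that[unfolded seg]] m by (simp add: pz abs_le_iff)
  \<comment> \<open>The only points of new edges inside the old box are the inner ends of the
    spokes; this settles all incidences between old and new.\<close>
  have far: "(\<exists>v \<in> e \<inter> {v1, v2, v3, v4}. w = ?p v)"
    if "e \<in> new_edges" "w \<in> ?h e" "\<bar>Re w\<bar> \<le> m" "\<bar>Im w\<bar> \<le> m" for e w
    using that(1) unfolding new_edges_def
  proof (elim insertE)
    assume e: "e = {v1, z1}"
    have "Re w = m" "Im w = m" using d1[OF that(2)[unfolded e]] that(3,4) by linarith+
    then have "w = ?p v1" unfolding pv by (simp add: complex_eq_iff)
    then show ?thesis unfolding e by blast
  next
    assume e: "e = {v2, z2}"
    have "Re w = - m" "Im w = m" using d2[OF that(2)[unfolded e]] that(3,4) by linarith+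
    then have "w = ?p v2" unfolding pv by (simp add: complex_eq_iff)
    then show ?thesis unfolding e by blast
  next
    assume e: "e = {v3, z3}"
    have "Re w = - m" "Im w = - m" using d3[OF that(2)[unfolded e]] that(3,4) by linarith+
    then have "w = ?p v3" unfolding pv by (simp add: complex_eq_iff)
    then show ?thesis unfolding e by blast
  next
    assume e: "e = {v4, z4}"
    have "Re w = m" "Im w = - m" using d4[OF that(2)[unfolded e]] that(3,4) by linarith+
    then have "w = ?p v4" unfolding pv by (simp add: complex_eq_iff)
    then show ?thesis unfolding e by blast
  next
    assume e: "e = {z1, z2}" show ?thesis using s1[OF that(2)[unfolded e]] that(3,4) m by simp
  next
    assume e: "e = {z2, z3}" show ?thesis using s2[OF that(2)[unfolded e]] that(3,4) m by simp
  next
    assume e: "e = {z3, z4}" show ?thesis using s3[OF that(2)[unfolded e]] that(3,4) m by simp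
  next
    assume e: "e = {z4, z1}" show ?thesis using s4[OF that(2)[unfolded e]] that(3,4) m by simp
  qed simp
  have old_new: "?h e \<inter> ?h f \<subseteq> ?p ` (e \<inter> f)" if ef: "e \<in> E" "f \<in> new_edges" for e f
  proof
    fix w assume w: "w \<in> ?h e \<inter> ?h f"
    obtain v where v: "v \<in> f \<inter> {v1, v2, v3, v4}" "w = ?p v"
      using far[OF ef(2), of w] w old_box[OF ef(1), of w] by blast
    then have "v \<in> V" using square(2) by blast
    then have "v \<in> e" using old_vertex[OF ef(1)] v w by blast
    then show "w \<in> ?p ` (e \<inter> f)" using v by blast
  qed
  have region: "(e = {v1, z1} \<and> Re w = Im w \<and> m \<le> Re w \<and> Re w \<le> 2 * m) \<or>
      (e = {v2, z2} \<and> Re w = - Im w \<and> m \<le> Im w \<and> Im w \<le> 2 * m) \<or>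
      (e = {v3, z3} \<and> Re w = Im w \<and> - 2 * m \<le> Re w \<and> Re w \<le> - m) \<or>
      (e = {v4, z4} \<and> Re w = - Im w \<and> m \<le> Re w \<and> Re w \<le> 2 * m) \<or>
      (e = {z1, z2} \<and> Im w = 2 * m \<and> \<bar>Re w\<bar> \<le> 2 * m) \<or>
      (e = {z2, z3} \<and> Re w = - 2 * m \<and> \<bar>Im w\<bar> \<le> 2 * m) \<or>
      (e = {z3, z4} \<and> Im w = - 2 * m \<and> \<bar>Re w\<bar> \<le> 2 * m) \<or>
      (e = {z4, z1} \<and> Re w = 2 * m \<and> \<bar>Im w\<bar> \<le> 2 * m)"
    if "e \<in> new_edges" "w \<in> ?h e" for e w
    using that(1) that(2) unfolding new_edges_def
    by (elim insertE emptyE; hypsubst)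
      ((drule d1 | drule d2 | drule d3 | drule d4 | drule s1 | drule s2 | drule s3 | drule s4),
        simp only: simp_thms)+
  have corner: "\<exists>z \<in> {z1, z2, z3, z4}. w = ?p z"
    if "Re w = 2 * m \<or> Re w = - 2 * m" "Im w = 2 * m \<or> Im w = - 2 * m" for w
    using that by (auto simp: pz complex_eq_iff)
  have new_corner: "z \<in> e"
    if "e \<in> new_edges" "?p z \<in> ?h e" "z \<in> {z1, z2, z3, z4}" for e z
    using that(3) region[OF that(1,2)] m by (elim insertE emptyE) (auto simp: pz)
  have new_new: "?h e \<inter> ?h f \<subseteq> ?p ` (e \<inter> f)"
    if "e \<in> new_edges" "f \<in> new_edges" "e \<noteq> f" for e f
  proof
    fix w assume w: "w \<in> ?h e \<inter> ?h f"
    \<comment> \<open>Spokes with the same end of \<open>Re w\<close> or on the same diagonal are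
      separated by the bounds on their coordinates, so a common point of two new edges has both
      coordinates extreme.\<close>
    have "(Re w = 2 * m \<or> Re w = - 2 * m) \<and> (Im w = 2 * m \<or> Im w = - 2 * m)"
      using region[OF that(1), of w] region[OF that(2), of w] w m that(3)
      by (elim disjE conjE IntE; (simp only: simp_thms)?) (smt (verit))+
    then obtain z where z: "z \<in> {z1, z2, z3, z4}" "w = ?p z" using corner by blast
    then have "z \<in> e \<inter> f" using new_corner[OF that(1)] new_corner[OF that(2)] w by blast
    then show "w \<in> ?p ` (e \<inter> f)" using z(2) by blast
  qed
  have E'_cases: "e \<in> E \<or> e \<in> new_edges" if "e \<in> E'" for e
    using that unfolding E'_def by blast
  have V'_cases: "v \<in> V \<or> v \<in> {z1, z2, z3, z4}" if "v \<in> V'" for v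
    using that unfolding V'_def by blast
  have far_corner: "\<not> (\<bar>Re (?p z)\<bar> \<le> m \<and> \<bar>Im (?p z)\<bar> \<le> m)" if "z \<in> {z1, z2, z3, z4}" for z
    using that m by (elim insertE emptyE) (simp_all add: pz)
  show ?thesis unfolding plane_straight_def
  proof (intro conjI ballI impI)
    have "u = v" if "?p u = ?p v" "u \<in> {z1, z2, z3, z4}" "v \<in> {z1, z2, z3, z4}" for u v
      using that m by (elim insertE emptyE) (simp_all add: pz)
    moreover have False if "?p u = ?p v" "u \<in> {z1, z2, z3, z4}" "v \<in> V" for u v
      using far_corner[OF that(2)] inV[OF that(3)] that(1) by simp
    ultimately show "inj_on ?p V'"
      by (intro inj_onI) (metis V'_cases injV)
  next
    fix e assume e: "e \<in> E'"
    show "?h e \<inter> ?p ` V' \<subseteq> ?p ` e"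
    proof
      fix w assume w: "w \<in> ?h e \<inter> ?p ` V'"
      then obtain u where u: "u \<in> V'" "w = ?p u" "?p u \<in> ?h e" by blast
      from E'_cases[OF e] V'_cases[OF u(1)]
      consider "e \<in> E" "u \<in> V" | "e \<in> E" "u \<in> {z1, z2, z3, z4}" | "e \<in> new_edges" "u \<in> V"
        | "e \<in> new_edges" "u \<in> {z1, z2, z3, z4}" by blast
      then show "w \<in> ?p ` e"
      proof cases
        case 1
        then show ?thesis using old_vertex[OF 1(1) u(3) 1(2)] u(2) by blast
      next
        case 2
        then show ?thesis using far_corner[OF 2(2)] old_box[OF 2(1) u(3)] by blast
      next
        case 3
        then show ?thesis using far[OF 3(1) u(3) inV[OF 3(2)]] u(2) by blast
      next
        case 4
        then show ?thesis using new_corner[OF 4(1) u(3) 4(2)] u(2) by blast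
      qed
    qed
  next
    fix e f assume ef: "e \<in> E'" "f \<in> E'" "e \<noteq> f"
    from E'_cases[OF ef(1)] E'_cases[OF ef(2)]
    consider "e \<in> E" "f \<in> E" | "e \<in> E" "f \<in> new_edges" | "e \<in> new_edges" "f \<in> E"
      | "e \<in> new_edges" "f \<in> new_edges" by blast
    then show "?h e \<inter> ?h f \<subseteq> ?p ` (e \<inter> f)"
    proof cases
      case 1
      have sub: "e \<subseteq> V" "f \<subseteq> V" "e \<inter> f \<subseteq> V" using old_edge 1 by blast+
      have "convex hull (pt ` e) \<inter> convex hull (pt ` f) \<subseteq> pt ` (e \<inter> f)"
        using pl 1 ef(3) unfolding plane_straight_def by blast
      then show ?thesis by (simp only: img[OF sub(1)] img[OF sub(2)] img[OF sub(3)])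
    next
      case 3
      then show ?thesis using old_new[OF 3(2,1)] by (simp only: Int_commute)
    qed (use old_new new_new ef(3) in blast)+
  qed
qed

end

section \<open>Checking concrete graphs\<close>

definition edge_set :: "(nat \<times> nat) list \<Rightarrow> nat set set" where
  "edge_set es = (\<lambda>(u, v). {u, v}) ` set es"

text \<open>The order \<open>u < v\<close> gives every edge just one admissible pair. Distinct pairs
  are then distinct edges, and counting list entries counts edges.\<close>

definition edges_ok :: "nat \<Rightarrow> (nat \<times> nat) list \<Rightarrow> bool" where
  "edges_ok n es \<longleftrightarrow> distinct es \<and> list_all (\<lambda>(u, v). u < v \<and> v < n) es"

lemma simple_graph_edge_set: "edges_ok n es \<Longrightarrow> simple_graph {..<n} (edge_set es)"
  by (fastforce simp: simple_graph_def edge_set_def edges_ok_def list_all_iff)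

section \<open>Degree and cut conditions as propositional clauses\<close>

definition exactly_two :: "bool list \<Rightarrow> bool" where
  "exactly_two bs \<longleftrightarrow> length (filter id bs) = 2"

text \<open>Conjunctive normal form for degree three; the next two lemmas treat degrees four and
  five. At least two are true if each choice of all but one contains a true one, and at most two are
  true if no three are.\<close>

lemma exactly_two_3:
  "exactly_two [a, b, c] \<longleftrightarrow> (a \<or> b) \<and> (a \<or> c) \<and> (b \<or> c) \<and> (\<not> a \<or> \<not> b \<or> \<not> c)"
  by (cases a; cases b; cases c) (simp_all add: exactly_two_def)

lemma exactly_two_4:
  "exactly_two [a, b, c, d] \<longleftrightarrow> (a \<or> b \<or> c) \<and> (a \<or> b \<or> d) \<and> (a \<or> c \<or> d) \<and> (b \<or> c \<or> d) \<and>
    (\<not> a \<or> \<not> b \<or> \<not> c) \<and> (\<not> a \<or> \<not> b \<or> \<not> d) \<and> (\<not> a \<or> \<not> c \<or> \<not> d) \<and> (\<not> b \<or> \<not> c \<or> \<not> d)"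
  by (cases a; cases b; cases c; cases d) (simp_all add: exactly_two_def)

lemma exactly_two_5:
  "exactly_two [a, b, c, d, e] \<longleftrightarrow> (a \<or> b \<or> c \<or> d) \<and> (a \<or> b \<or> c \<or> e) \<and> (a \<or> b \<or> d \<or> e) \<and>
    (a \<or> c \<or> d \<or> e) \<and> (b \<or> c \<or> d \<or> e) \<and>
    (\<not> a \<or> \<not> b \<or> \<not> c) \<and> (\<not> a \<or> \<not> b \<or> \<not> d) \<and> (\<not> a \<or> \<not> b \<or> \<not> e) \<and>
    (\<not> a \<or> \<not> c \<or> \<not> d) \<and> (\<not> a \<or> \<not> c \<or> \<not> e) \<and> (\<not> a \<or> \<not> d \<or> \<not> e) \<and>
    (\<not> b \<or> \<not> c \<or> \<not> d) \<and> (\<not> b \<or> \<not> c \<or> \<not> e) \<and> (\<not> b \<or> \<not> d \<or> \<not> e) \<and> (\<not> c \<or> \<not> d \<or> \<not> e)"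
  by (cases a; cases b; cases c; cases d; cases e) (simp_all add: exactly_two_def)

definition incident :: "(nat \<times> nat) list \<Rightarrow> nat \<Rightarrow> (nat \<times> nat) list" where
  "incident es v = filter (\<lambda>(x, y). x = v \<or> y = v) es"

definition crossing :: "(nat \<times> nat) list \<Rightarrow> nat list \<Rightarrow> (nat \<times> nat) list" where
  "crossing es S = filter (\<lambda>(x, y). x \<in> set S \<longleftrightarrow> y \<notin> set S) es"

definition used :: "nat set set \<Rightarrow> nat \<times> nat \<Rightarrow> bool" where
  "used C e \<longleftrightarrow> {fst e, snd e} \<in> C"

lemma exactly_two_incident:
  assumes C: "cycle_on {..<n} C" "C \<subseteq> edge_set es" and ok: "edges_ok n es" and "v < n"
  shows "exactly_two (map (used C) (incident es v))"
proof -
  obtain a b where ab: "a \<noteq> b" "a \<noteq> v" "b \<noteq> v"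
    "\<And>e. v \<in> e \<Longrightarrow> e \<in> C \<longleftrightarrow> e = {v, a} \<or> e = {v, b}"
    using cycle_on_degree[OF C(1), of v] \<open>v < n\<close> by blast
  \<comment> \<open>The one pair in which \<open>es\<close> can list the edge from \<open>v\<close>
    to \<open>c\<close>.\<close>
  let ?p = "\<lambda>c. (min v c, max v c)"
  have lt: "x < y" if "(x, y) \<in> set es" for x y
    using that ok by (auto simp: edges_ok_def list_all_iff)
  have p: "?p c \<in> set es \<and> used C (?p c)" if vc: "{v, c} \<in> C" for c
  proof -
    obtain x y where xy: "(x, y) \<in> set es" "{v, c} = {x, y}"
      using vc C(2) by (auto simp: edge_set_def)
    then have "?p c = (x, y)" using lt[of x y] by (auto simp: doubleton_eq_iff min_def max_def)
    then show ?thesis using xy vc by (simp add: used_def)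
  qed
  have "set (filter (used C) (incident es v)) = {?p a, ?p b}"
  proof
    show "set (filter (used C) (incident es v)) \<subseteq> {?p a, ?p b}"
    proof
      fix e assume e: "e \<in> set (filter (used C) (incident es v))"
      obtain x y where xy: "e = (x, y)" by (cases e)
      with e have "x < y" "x = v \<or> y = v" "{x, y} \<in> C" by (auto simp: incident_def used_def lt)
      moreover from this have "{x, y} = {v, a} \<or> {x, y} = {v, b}" using ab(4)[of "{x, y}"] by auto
      ultimately show "e \<in> {?p a, ?p b}"
        unfolding xy by (auto simp: doubleton_eq_iff min_def max_def)
    qed
    show "{?p a, ?p b} \<subseteq> set (filter (used C) (incident es v))"
      using p[of a] p[of b] ab(4)[of "{v, a}"] ab(4)[of "{v, b}"]
      by (auto simp: incident_def min_def max_def)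
  qed
  moreover have "?p a \<noteq> ?p b" using ab(1) by (auto simp: min_def max_def split: if_splits)
  moreover have "distinct (filter (used C) (incident es v))"
    using ok by (simp add: incident_def edges_ok_def)
  ultimately have "length (filter (used C) (incident es v)) = 2"
    by (metis card_2_iff distinct_card)
  then show ?thesis by (simp add: exactly_two_def filter_map comp_def)
qed

lemma used_crossing:
  assumes C: "cycle_on {..<n} C" "C \<subseteq> edge_set es" and S: "s \<in> set S" "s < n" "t \<notin> set S" "t < n"
  shows "list_ex (used C) (crossing es S)"
proof -
  obtain e where e: "e \<in> C" "e \<inter> set S \<noteq> {}" "\<not> e \<subseteq> set S"
    using cycle_on_cut[OF C(1), of s "set S" t] S by auto
  then have "e \<in> edge_set es" using C(2) by blast
  then obtain x y where "(x, y) \<in> set es" "e = {x, y}" by (auto simp: edge_set_def)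
  then show ?thesis using e by (auto simp: list_ex_iff crossing_def used_def)
qed

text \<open>A list shorter than \<open>n\<close> misses some vertex below \<open>n\<close>, so both
  sides of the cut are seen to be inhabited by two comparisons of numbers.\<close>

definition cut_ok :: "nat \<Rightarrow> nat list \<Rightarrow> bool" where
  "cut_ok n S \<longleftrightarrow> S \<noteq> [] \<and> hd S < n \<and> length S < n"

lemma used_crossing_cut_ok:
  assumes C: "cycle_on {..<n} C" "C \<subseteq> edge_set es" and S: "cut_ok n S"
  shows "list_ex (used C) (crossing es S)"
proof -
  have "card (set S) < n" using S card_length[of S] by (simp add: cut_ok_def)
  then have "\<not> {..<n} \<subseteq> set S" using card_mono[of "set S" "{..<n}"] by auto
  then obtain t where "t < n" "t \<notin> set S" by auto
  then show ?thesis using used_crossing[OF C, of "hd S" S t] S by (simp add: cut_ok_def)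
qed

definition degree_clauses :: "nat set set \<Rightarrow> nat \<Rightarrow> (nat \<times> nat) list \<Rightarrow> bool" where
  "degree_clauses C n es \<longleftrightarrow> list_all (\<lambda>bs. exactly_two (map (used C) bs)) (map (incident es) [0..<n])"

text \<open>Among the edge sets with two edges at every vertex, the clause of a cut excludes just
  those without an edge between the two sides, where the listed vertices are covered by cycles of
  their own.\<close>

definition cut_clauses :: "nat set set \<Rightarrow> (nat \<times> nat) list \<Rightarrow> nat list list \<Rightarrow> bool" where
  "cut_clauses C es cuts \<longleftrightarrow> list_all (list_ex (used C)) (map (crossing es) cuts)"

text \<open>For a concrete graph the set \<open>C\<close> occurs only in the atoms
  \<open>used C (x, y)\<close>. These become propositional variables, one for each listed
  edge.\<close>

lemma cycle_clauses:
  assumes "cycle_on {..<n} C" "C \<subseteq> edge_set es" "edges_ok n es" "list_all (cut_ok n) cuts"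
  shows "degree_clauses C n es" "cut_clauses C es cuts"
  using exactly_two_incident[OF assms(1-3)] used_crossing_cut_ok[OF assms(1,2)] assms(4)
  by (auto simp: degree_clauses_def cut_clauses_def list_all_iff)

section \<open>Explicit cycles through all vertices but one\<close>

definition cycle_missing :: "nat \<Rightarrow> nat set set \<Rightarrow> nat \<Rightarrow> nat list \<Rightarrow> bool" where
  "cycle_missing n E w xs \<longleftrightarrow> 3 \<le> length xs \<and> Suc (length xs) = n \<and> distinct xs \<and>
     list_all (\<lambda>x. x < n \<and> x \<noteq> w) xs \<and> cycle_edges xs \<subseteq> E"

text \<open>Counting replaces a comparison of sets: \<open>n - 1\<close> distinct numbers below
  \<open>n\<close> and different from \<open>w\<close> exhaust the remaining vertices.\<close>

lemma cycle_missingD: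
  assumes "cycle_missing n E w xs" "w < n"
  shows "cycle_on ({..<n} - {w}) (cycle_edges xs)" "cycle_edges xs \<subseteq> E"
proof -
  have xs: "3 \<le> length xs" "Suc (length xs) = n" "distinct xs"
    and sub: "set xs \<subseteq> {..<n} - {w}" and E: "cycle_edges xs \<subseteq> E"
    using assms(1) by (auto simp: cycle_missing_def list_all_iff)
  have "card (set xs) = card ({..<n} - {w})"
    using xs assms(2) by (simp add: distinct_card)
  then have "set xs = {..<n} - {w}" using sub by (intro card_subset_eq) auto
  then show "cycle_on ({..<n} - {w}) (cycle_edges xs)" using xs by (auto simp: cycle_on_def)
qed (use assms(1) in \<open>simp add: cycle_missing_def\<close>)

text \<open>The list \<open>xss\<close> holds the cycles that miss \<open>w\<close>, \<open>w + 1\<close>, and so on. Each of them starts with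
  an edge of the square.\<close>

fun cycles_missing_from :: "nat \<Rightarrow> nat set set \<Rightarrow> nat \<Rightarrow> nat list list \<Rightarrow> bool" where
  "cycles_missing_from n E w [] \<longleftrightarrow> w = n"
| "cycles_missing_from n E w (xs # xss) \<longleftrightarrow> cycle_missing n E w xs \<and>
     (hd xs, hd (tl xs)) \<in> set [(0, 1), (1, 2), (2, 3), (3, 0)] \<and> cycles_missing_from n E (Suc w) xss"

lemma first_edge_in_cycle_edges: "2 \<le> length xs \<Longrightarrow> {hd xs, hd (tl xs)} \<in> cycle_edges xs"
  by (cases xs rule: path_edges.cases) (auto simp: cycle_edges_def)

lemma cycles_missing_fromD:
  assumes "cycles_missing_from n E w xss" "w \<le> k" "k < n"
  shows "\<exists>C. cycle_on ({..<n} - {k}) C \<and> C \<subseteq> E \<and>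
    C \<inter> {{0, 1}, {1, 2}, {2, 3}, {3, 0}} \<noteq> {}"
  using assms
proof (induction n E w xss rule: cycles_missing_from.induct)
  case (2 n E w xs xss)
  show ?case
  proof (cases "w = k")
    case True
    have m: "cycle_missing n E k xs" using 2 True by simp
    then have "{hd xs, hd (tl xs)} \<in> cycle_edges xs"
      using first_edge_in_cycle_edges[of xs] by (simp add: cycle_missing_def)
    moreover have "{hd xs, hd (tl xs)} \<in> {{0, 1}, {1, 2}, {2, 3}, {3, 0}}"
      using "2.prems"(1) by simp (elim disjE conjE, simp_all)
    ultimately have "{hd xs, hd (tl xs)} \<in> cycle_edges xs \<inter> {{0, 1}, {1, 2}, {2, 3}, {3, 0}}"
      by (rule IntI)
    then have "cycle_edges xs \<inter> {{0, 1}, {1, 2}, {2, 3}, {3, 0}} \<noteq> {}" by (metis empty_iff)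
    then show ?thesis using cycle_missingD[OF m \<open>k < n\<close>] by (intro exI conjI)
  qed (use 2 in simp)
qed simp

text \<open>The lists for the corners start with the three other corners in cyclic order, so the two
  required edges can be read off at the front.\<close>

lemma cycle_missing_corner:
  assumes "cycle_missing n E w (a # b # c # xs)" "w < n"
  shows "\<exists>C. cycle_on ({..<n} - {w}) C \<and> C \<subseteq> E \<and> {a, b} \<in> C \<and> {b, c} \<in> C"
  using cycle_missingD[OF assms]
  by (intro exI[of _ "cycle_edges (a # b # c # xs)"]) (simp add: cycle_edges_def)

lemma hypo_square_certificate:
  assumes ok: "edges_ok n es" "4 < n"
    and sq: "{{0, 1}, {1, 2}, {2, 3}, {3, 0}} \<subseteq> edge_set es"
    and non: "\<And>C. cycle_on {..<n} C \<Longrightarrow> C \<subseteq> edge_set es \<Longrightarrow> False"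
    and corners: "cycle_missing n (edge_set es) 0 (1 # 2 # 3 # xs0)"
      "cycle_missing n (edge_set es) 1 (2 # 3 # 0 # xs1)"
      "cycle_missing n (edge_set es) 2 (3 # 0 # 1 # xs2)"
      "cycle_missing n (edge_set es) 3 (0 # 1 # 2 # xs3)"
    and rest: "cycles_missing_from n (edge_set es) 4 xss"
  shows "hypo_square {..<n} (edge_set es) 0 1 2 3"
proof
  show "simple_graph {..<n} (edge_set es)" by (rule simple_graph_edge_set[OF ok(1)])
  show "\<exists>C. cycle_on ({..<n} - {w}) C \<and> C \<subseteq> edge_set es \<and>
      C \<inter> {{0, 1}, {1, 2}, {2, 3}, {3, 0}} \<noteq> {}" if "w \<in> {..<n} - {0, 1, 2, 3}" for w
    using cycles_missing_fromD[OF rest, of w] that by force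
qed (use ok(2) sq non corners[THEN cycle_missing_corner] in auto)

subsection \<open>Integer coordinates\<close>

definition point :: "int \<times> int \<Rightarrow> complex" where
  "point p = Complex (of_int (fst p)) (of_int (snd p))"

text \<open>Twice the signed area of the triangle, positive for a counterclockwise one.\<close>

fun orient :: "int \<times> int \<Rightarrow> int \<times> int \<Rightarrow> int \<times> int \<Rightarrow> int" where
  "orient (ax, ay) (bx, by') (cx, cy) = (bx - ax) * (cy - ay) - (by' - ay) * (cx - ax)"

definition same_side :: "int \<Rightarrow> int \<Rightarrow> bool" where
  "same_side a b \<longleftrightarrow> 0 < a \<and> 0 < b \<or> a < 0 \<and> b < 0"

text \<open>A sufficient test. The bounding boxes are disjoint, or one segment lies strictly on one
  side of the line through the other. The comparisons of coordinates come first since they need no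
  multiplication.\<close>

fun disjoint_segments :: "int \<times> int \<Rightarrow> int \<times> int \<Rightarrow> int \<times> int \<Rightarrow> int \<times> int \<Rightarrow> bool" where
  "disjoint_segments (ax, ay) (bx, by') (cx, cy) (dx, dy) \<longleftrightarrow>
     (ax < cx \<and> ax < dx \<and> bx < cx \<and> bx < dx) \<or> (cx < ax \<and> cx < bx \<and> dx < ax \<and> dx < bx) \<or>
     (ay < cy \<and> ay < dy \<and> by' < cy \<and> by' < dy) \<or> (cy < ay \<and> cy < by' \<and> dy < ay \<and> dy < by') \<or>
     same_side (orient (ax, ay) (bx, by') (cx, cy)) (orient (ax, ay) (bx, by') (dx, dy)) \<or>
     same_side (orient (cx, cy) (dx, dy) (ax, ay)) (orient (cx, cy) (dx, dy) (bx, by'))"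

text \<open>The determinant \<open>orient\<close> continued to arbitrary points of the plane. It is
  affine in the third point and vanishes on the line through the first two.\<close>

definition orient_at :: "int \<times> int \<Rightarrow> int \<times> int \<Rightarrow> complex \<Rightarrow> real" where
  "orient_at a b w = (of_int (fst b) - of_int (fst a)) * (Im w - of_int (snd a)) -
     (of_int (snd b) - of_int (snd a)) * (Re w - of_int (fst a))"

lemma orient_at_segment: "w \<in> closed_segment (point a) (point b) \<Longrightarrow> orient_at a b w = 0"
  using segment_Re_Im(5)[of w "point a" "point b"]
  by (simp add: orient_at_def point_def algebra_simps)

lemma orient_at_affine:
  "orient_at a b ((1 - t) *\<^sub>R point c + t *\<^sub>R point d) =
     (1 - t) * of_int (orient a b c) + t * of_int (orient a b d)"
  by (cases a; cases b; cases c; cases d) (simp add: orient_at_def point_def algebra_simps)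

text \<open>An affine function with the same strict sign at \<open>c\<close> and \<open>d\<close>
  has no zero between them, while it vanishes on the whole segment from \<open>a\<close> to
  \<open>b\<close>.\<close>

lemma same_side_disjoint:
  assumes "same_side (orient a b c) (orient a b d)"
  shows "closed_segment (point a) (point b) \<inter> closed_segment (point c) (point d) = {}"
proof (rule ccontr)
  assume "\<not> ?thesis"
  then obtain w where "w \<in> closed_segment (point a) (point b)"
    and wcd: "w \<in> closed_segment (point c) (point d)" by blast
  then have w: "orient_at a b w = 0" by (intro orient_at_segment)
  obtain t where t: "0 \<le> t" "t \<le> 1" "w = (1 - t) *\<^sub>R point c + t *\<^sub>R point d"
    using wcd by (auto simp: in_segment)
  have pos: "0 < (1 - t) * x + t * y" if "0 < x" "0 < y" for x y :: real
    using t that by (cases "t = 0") (auto intro: add_nonneg_pos)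
  show False
    using assms pos[of "of_int (orient a b c)" "of_int (orient a b d)"]
      pos[of "- of_int (orient a b c)" "- of_int (orient a b d)"] w
    unfolding t(3) orient_at_affine same_side_def by auto
qed

lemma disjoint_segmentsD:
  assumes "disjoint_segments a b c d"
  shows "closed_segment (point a) (point b) \<inter> closed_segment (point c) (point d) = {}"
proof -
  obtain ax ay bx by' cx cy dx dy where
    eq: "a = (ax, ay)" "b = (bx, by')" "c = (cx, cy)" "d = (dx, dy)" by (metis prod.exhaust)
  consider "same_side (orient a b c) (orient a b d)" | "same_side (orient c d a) (orient c d b)"
    | "ax < cx \<and> ax < dx \<and> bx < cx \<and> bx < dx" | "cx < ax \<and> cx < bx \<and> dx < ax \<and> dx < bx"
    | "ay < cy \<and> ay < dy \<and> by' < cy \<and> by' < dy" | "cy < ay \<and> cy < by' \<and> dy < ay \<and> dy < by'"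
    using assms unfolding eq by auto
  then show ?thesis
  proof cases
    case 1
    then show ?thesis by (rule same_side_disjoint)
  next
    case 2
    then show ?thesis using same_side_disjoint by blast
  next
    case 3
    have "max (real_of_int ax) bx < min (real_of_int cx) dx" using 3 by simp
    then show ?thesis unfolding eq using segment_Re_Im(1,2) by (fastforce simp: point_def)
  next
    case 4
    have "max (real_of_int cx) dx < min (real_of_int ax) bx" using 4 by simp
    then show ?thesis unfolding eq using segment_Re_Im(1,2) by (fastforce simp: point_def)
  next
    case 5
    have "max (real_of_int ay) by' < min (real_of_int cy) dy" using 5 by simp
    then show ?thesis unfolding eq using segment_Re_Im(3,4) by (fastforce simp: point_def)
  next
    case 6
    have "max (real_of_int cy) dy < min (real_of_int ay) by'" using 6 by simp
    then show ?thesis unfolding eq using segment_Re_Im(3,4) by (fastforce simp: point_def)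
  qed
qed

text \<open>Along the segment from \<open>a\<close> to \<open>c\<close> the determinant is
  \<open>t\<close> times its value at \<open>c\<close>, so it vanishes at \<open>a\<close>
  only.\<close>

lemma orient_common_endpoint:
  assumes "orient a b c \<noteq> 0"
  shows "closed_segment (point a) (point b) \<inter> closed_segment (point a) (point c) \<subseteq> {point a}"
proof
  fix w assume w: "w \<in> closed_segment (point a) (point b) \<inter> closed_segment (point a) (point c)"
  then obtain t where t: "w = (1 - t) *\<^sub>R point a + t *\<^sub>R point c" by (auto simp: in_segment)
  have "orient_at a b w = 0" using w orient_at_segment by blast
  moreover have "orient a b a = 0" by (cases a; cases b) simp
  ultimately have "t * of_int (orient a b c) = 0" unfolding t orient_at_affine by simp
  then have "t = 0" using assms by simp
  then show "w \<in> {point a}" using t by simp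
qed

section \<open>Certifying a drawing pair by pair\<close>

fun compatible_edges :: "(nat \<Rightarrow> int \<times> int) \<Rightarrow> nat \<times> nat \<Rightarrow> nat \<times> nat \<Rightarrow> bool" where
  "compatible_edges p (u, v) (x, y) \<longleftrightarrow>
     (if u = x then orient (p u) (p v) (p y) \<noteq> 0
      else if u = y then orient (p u) (p v) (p x) \<noteq> 0
      else if v = x then orient (p v) (p u) (p y) \<noteq> 0
      else if v = y then orient (p v) (p u) (p x) \<noteq> 0
      else disjoint_segments (p u) (p v) (p x) (p y))"

fun pairwise_list :: "('a \<Rightarrow> 'a \<Rightarrow> bool) \<Rightarrow> 'a list \<Rightarrow> bool" where
  "pairwise_list P [] \<longleftrightarrow> True"
| "pairwise_list P (x # xs) \<longleftrightarrow> list_all (P x) xs \<and> pairwise_list P xs"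

lemma pairwise_listD:
  "pairwise_list P xs \<Longrightarrow> x \<in> set xs \<Longrightarrow> y \<in> set xs \<Longrightarrow> x \<noteq> y \<Longrightarrow> P x y \<or> P y x"
  by (induction xs) (auto simp: list_all_iff)

lemma compatible_edgesD:
  assumes "compatible_edges p (u, v) (x, y)"
  shows "closed_segment (point (p u)) (point (p v)) \<inter> closed_segment (point (p x)) (point (p y))
    \<subseteq> (\<lambda>x. point (p x)) ` ({u, v} \<inter> {x, y})"
proof -
  consider "u = x" "orient (p u) (p v) (p y) \<noteq> 0" | "u = y" "orient (p u) (p v) (p x) \<noteq> 0"
    | "v = x" "orient (p v) (p u) (p y) \<noteq> 0" | "v = y" "orient (p v) (p u) (p x) \<noteq> 0"
    | "disjoint_segments (p u) (p v) (p x) (p y)"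
    using assms by (auto split: if_splits)
  then show ?thesis
  proof cases
    case 1
    then show ?thesis using orient_common_endpoint[OF 1(2)] by auto
  next
    case 2
    then show ?thesis using orient_common_endpoint[OF 2(2)] by (auto simp: closed_segment_commute)
  next
    case 3
    then show ?thesis using orient_common_endpoint[OF 3(2)] by (auto simp: closed_segment_commute)
  next
    case 4
    then show ?thesis using orient_common_endpoint[OF 4(2)] by (auto simp: closed_segment_commute)
  next
    case 5
    then show ?thesis using disjoint_segmentsD by blast
  qed
qed

text \<open>Only pairs of edges are tested. That an edge avoids foreign vertices follows: by
  \<open>cover\<close> such a vertex is an end of another edge, and two different edges meet only in
  common ends.\<close>

lemma plane_straight_certificate:
  assumes inj: "inj_on p {..<n}" and ok: "edges_ok n es"
    and pairs: "pairwise_list (compatible_edges p) es"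
    and cover: "\<And>v. v < n \<Longrightarrow> \<exists>e \<in> edge_set es. v \<in> e"
  shows "plane_straight {..<n} (edge_set es) (point \<circ> p)"
proof -
  have inj': "inj_on (point \<circ> p) {..<n}"
    using inj by (auto simp: inj_on_def point_def prod_eq_iff)
  have disj: "convex hull ((point \<circ> p) ` e) \<inter> convex hull ((point \<circ> p) ` f) \<subseteq> (point \<circ> p) ` (e \<inter> f)"
    if ef: "e \<in> edge_set es" "f \<in> edge_set es" "e \<noteq> f" for e f
  proof -
    obtain u v x y where e: "e = {u, v}" "(u, v) \<in> set es" and f: "f = {x, y}" "(x, y) \<in> set es"
      using ef by (auto simp: edge_set_def)
    then have "(u, v) \<noteq> (x, y)" using ef(3) by auto
    then consider "compatible_edges p (u, v) (x, y)" | "compatible_edges p (x, y) (u, v)"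
      using pairwise_listD[OF pairs e(2) f(2)] by blast
    then show ?thesis
    proof cases
      case 1
      then show ?thesis using compatible_edgesD[OF 1]
        unfolding e(1) f(1) by (simp add: segment_convex_hull)
    next
      case 2
      then show ?thesis using compatible_edgesD[OF 2]
        unfolding e(1) f(1) by (simp add: segment_convex_hull Int_commute)
    qed
  qed
  have "convex hull ((point \<circ> p) ` e) \<inter> (point \<circ> p) ` {..<n} \<subseteq> (point \<circ> p) ` e"
    if "e \<in> edge_set es" for e
  proof
    fix w assume "w \<in> convex hull ((point \<circ> p) ` e) \<inter> (point \<circ> p) ` {..<n}"
    then obtain v where v: "v < n" "w = (point \<circ> p) v" "w \<in> convex hull ((point \<circ> p) ` e)" by blast
    obtain f where f: "f \<in> edge_set es" "v \<in> f" using cover[OF v(1)] by blast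
    show "w \<in> (point \<circ> p) ` e"
    proof (cases "e = f")
      case True
      then show ?thesis unfolding v(2) using f(2) by (intro imageI) simp
    next
      case False
      have "w \<in> convex hull ((point \<circ> p) ` f)" unfolding v(2) using f(2) by (intro hull_inc imageI)
      with v(3) have "w \<in> (point \<circ> p) ` (e \<inter> f)"
        by (rule subsetD[OF disj[OF that f(1) False] IntI])
      then show ?thesis by (rule subsetD[OF image_mono[OF Int_lower1]])
    qed
  qed
  then show ?thesis unfolding plane_straight_def by (intro conjI ballI impI inj' disj)
qed

text \<open>The invariant of the induction on the order. The square and its frame are kept because
  the next extension starts from them, and a finite set of natural numbers always leaves fresh
  vertices.\<close>

definition realizes :: "nat \<Rightarrow> bool" where
  "realizes n \<longleftrightarrow> (\<exists>(V :: nat set) E v1 v2 v3 v4 pt m. card V = n \<and> hypo_square V E v1 v2 v3 v4 \<and>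
     plane_straight V E pt \<and> framed V pt m v1 v2 v3 v4)"

text \<open>Applied to a defining equation, this yields one membership fact per edge and direction.
  Checking a long cycle is then a lookup per edge. The next lemma does the same for
  coordinates.\<close>

lemma edge_table: "es = xs \<Longrightarrow> list_all (\<lambda>(u, v). {u, v} \<in> edge_set es \<and> {v, u} \<in> edge_set es) xs"
  by (auto simp: list_all_iff edge_set_def insert_commute)

lemma nth_table: "ps = qs \<Longrightarrow> list_all (\<lambda>(i, q). ps ! i = q) (List.enumerate 0 qs)"
  by (auto simp: list_all_iff enumerate_eq_zip in_set_zip)

lemma realizes_certificate:
  assumes ok: "edges_ok n es" "4 < n"
    and sq: "{{0, 1}, {1, 2}, {2, 3}, {3, 0}} \<subseteq> edge_set es"
    and non: "\<And>C. cycle_on {..<n} C \<Longrightarrow> C \<subseteq> edge_set es \<Longrightarrow> False"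
    and corners: "cycle_missing n (edge_set es) 0 (1 # 2 # 3 # xs0)"
      "cycle_missing n (edge_set es) 1 (2 # 3 # 0 # xs1)"
      "cycle_missing n (edge_set es) 2 (3 # 0 # 1 # xs2)"
      "cycle_missing n (edge_set es) 3 (0 # 1 # 2 # xs3)"
    and rest: "cycles_missing_from n (edge_set es) 4 xss"
    and ps: "distinct ps" "length ps = n" "list_all (\<lambda>(x, y). - m \<le> x \<and> x \<le> m \<and> - m \<le> y \<and> y \<le> m) ps"
      "ps ! 0 = (m, m)" "ps ! 1 = (- m, m)" "ps ! 2 = (- m, - m)" "ps ! 3 = (m, - m)" "0 < m"
    and pairs: "pairwise_list (compatible_edges ((!) ps)) es"
  shows "realizes n"
proof -
  let ?pt = "point \<circ> (!) ps"
  have hypo: "hypo_square {..<n} (edge_set es) 0 1 2 3"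
    by (rule hypo_square_certificate[OF ok sq non corners rest])
  have cover: "\<exists>e \<in> edge_set es. v \<in> e" if "v < n" for v
  proof -
    \<comment> \<open>For each \<open>v\<close> one of the vertices 0 and 1 differs from
      \<open>v\<close>, and the cycle that misses it passes through \<open>v\<close>. So every
      vertex lies on an edge.\<close>
    have "\<exists>C. cycle_on ({..<n} - {w}) C \<and> C \<subseteq> edge_set es" if "w = 0 \<or> w = 1" for w
      using that cycle_missingD[OF corners(1)] cycle_missingD[OF corners(2)] ok(2) by auto
    from this[of "if v = 0 then 1 else 0"] obtain C w
      where C: "cycle_on ({..<n} - {w}) C" "C \<subseteq> edge_set es" "w \<noteq> v"
      by (metis zero_neq_one)
    have "v \<in> {..<n} - {w}" using \<open>v < n\<close> C(3) by simp
    from cycle_on_degree[OF C(1) this] obtain a where "{v, a} \<in> C" by (metis insertI1)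
    then show ?thesis using C(2) by blast
  qed
  have "inj_on ((!) ps) {..<n}" using ps(1,2) by (simp add: inj_on_nth)
  then have "plane_straight {..<n} (edge_set es) ?pt"
    by (rule plane_straight_certificate[OF _ ok(1) pairs cover])
  moreover have "framed {..<n} ?pt (of_int m) 0 1 2 3"
  proof -
    have "\<bar>Re (?pt v)\<bar> \<le> of_int m \<and> \<bar>Im (?pt v)\<bar> \<le> of_int m" if "v < n" for v
    proof -
      obtain x y where xy: "ps ! v = (x, y)" by (cases "ps ! v")
      then have "- m \<le> x" "x \<le> m" "- m \<le> y" "y \<le> m"
        using ps(2,3) that by (auto simp: list_all_length)
      then have "\<bar>x\<bar> \<le> m" "\<bar>y\<bar> \<le> m" by auto
      then show ?thesis using xy by (simp add: point_def flip: of_int_abs)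
    qed
    then show ?thesis using ps(4-8) by (simp add: framed_def point_def)
  qed
  ultimately show ?thesis unfolding realizes_def using hypo by (metis card_lessThan)
qed

section \<open>The four smallest graphs\<close>

text \<open>
  The graphs on 36, 37, 38 and 39 vertices were found by simulated annealing over planar maps,
  minimising the number of Hamiltonian cycles plus the number of vertices whose deletion leaves a
  non-Hamiltonian graph. In each of them the vertices 0, 1, 2, 3 span the square. The lists \<open>cuts\<close>
  were collected by a backtracking search for 2-factors: together with the degree conditions they are
  propositionally unsatisfiable.
\<close>

lemmas eval_num = simp_thms if_True if_False prod.case prod.inject rel_simps arith_simps
  Suc_numeral Suc_1 One_nat_def[symmetric] add_0 add_0_right one_add_one

lemmas eval_list = list.map filter.simps list.pred_inject list_ex_Nil_iff list_ex_Cons_iff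
  append.simps list.set list.sel list.size(3) length_Cons distinct.simps insert_iff empty_iff

section \<open>The graph on 36 vertices, drawn in a frame of half side 15\<close>

definition es36 :: "(nat \<times> nat) list" where
  "es36 =
    [(0, 1), (0, 3), (0, 29), (0, 32), (1, 2), (1, 28), (1, 30), (1, 31), (2, 3), (2, 24), (3, 22),
    (4, 7), (4, 14), (4, 21), (5, 23), (5, 27), (5, 34), (6, 11), (6, 13), (6, 21), (6, 29), (7, 8),
    (7, 35), (8, 10), (8, 15), (9, 10), (9, 19), (9, 23), (10, 14), (10, 34), (11, 14), (11, 17),
    (12, 13), (12, 17), (12, 27), (13, 32), (15, 16), (15, 19), (16, 28), (16, 35), (17, 34), (18,
    19), (18, 28), (18, 31), (19, 24), (19, 25), (20, 28), (20, 29), (20, 33), (21, 33), (22, 23),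
    (22, 24), (22, 26), (24, 30), (25, 30), (25, 31), (26, 27), (26, 32), (33, 35)]"

text \<open>The first four points are the corners of the frame in the order that
  \<open>framed\<close> prescribes; all others lie within the box.\<close>

definition ps36 :: "(int \<times> int) list" where
  "ps36 =
    [(15, 15), (-15, 15), (-15, -15), (15, -15), (1, 7), (3, 2), (5, 9), (-1, 7), (-2, 6), (-1, 2),
    (0, 4), (4, 7), (6, 5), (7, 8), (2, 6), (-4, 6), (-5, 9), (4, 5), (-8, 8), (-6, 3), (0, 11), (2,
    9), (5, -6), (2, -1), (-7, -4), (-9, 6), (7, 1), (5, 3), (-7, 12), (7, 12), (-11, 6), (-11, 10),
    (10, 9), (0, 10), (2, 4), (-2, 9)]"

definition cuts36 :: "nat list list" where
  "cuts36 = [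
    [7, 8, 15, 16, 20, 28, 33, 35],
    [5, 9, 10, 12, 17, 23, 27, 34],
    [5, 9, 10, 11, 14, 17, 23, 34],
    [4, 6, 11, 14, 21],
    [1, 2, 3, 18, 22, 24, 25, 28, 30, 31],
    [0, 1, 2, 3, 9, 15, 16, 18, 19, 22, 23, 24, 25, 28, 30, 31],
    [4, 5, 6, 9, 10, 11, 12, 13, 14, 17, 20, 21, 23, 27, 29, 33, 34],
    [5, 10, 11, 12, 14, 17, 27, 34],
    [4, 6, 11, 12, 13, 14, 17, 21],
    [1, 2, 3, 7, 8, 15, 16, 18, 19, 22, 24, 25, 28, 30, 31, 35],
    [5, 10, 11, 12, 13, 14, 17, 26, 27, 32, 34],
    [4, 5, 6, 9, 10, 11, 14, 17, 21, 23, 34],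
    [4, 5, 6, 10, 11, 12, 13, 14, 17, 21, 26, 27, 32, 34],
    [4, 6, 7, 11, 12, 13, 14, 17, 21, 26, 27, 32, 33, 35],
    [0, 4, 6, 7, 8, 12, 13, 15, 16, 20, 21, 26, 27, 29, 32, 33, 35],
    [5, 9, 10, 23, 34],
    [5, 12, 13, 17, 26, 27, 32, 34],
    [0, 6, 12, 13, 26, 27, 29, 32],
    [1, 2, 3, 9, 18, 19, 22, 23, 24, 25, 28, 30, 31],
    [4, 5, 6, 7, 8, 9, 10, 11, 14, 15, 16, 17, 21, 23, 33, 34, 35],
    [0, 1, 2, 3, 18, 24, 25, 28, 30, 31],
    [4, 5, 7, 8, 9, 10, 11, 12, 13, 14, 17, 22, 23, 26, 27, 32, 34],
    [4, 6, 7, 8, 11, 12, 13, 14, 15, 16, 17, 21, 33, 35],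
    [5, 6, 8, 9, 10, 11, 12, 13, 14, 15, 17, 19, 23, 26, 27, 32, 34],
    [0, 1, 2, 3, 5, 9, 10, 18, 19, 22, 23, 24, 25, 30, 31, 34],
    [4, 7, 8, 10, 11, 14, 17, 34],
    [0, 4, 6, 11, 13, 14, 20, 21, 29, 32, 33],
    [4, 6, 7, 8, 11, 12, 13, 14, 15, 16, 17, 21, 26, 27, 32, 33, 35],
    [6, 20, 21, 29, 33],
    [1, 2, 3, 15, 16, 18, 19, 22, 24, 25, 28, 30, 31],
    [4, 6, 7, 8, 10, 11, 14, 15, 16, 20, 21, 29, 33, 35],
    [4, 5, 6, 9, 10, 11, 12, 13, 14, 17, 21, 22, 23, 26, 27, 32, 34],
    [0, 1, 2, 3, 18, 22, 24, 25, 26, 28, 30, 31, 32],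
    [4, 6, 11, 12, 13, 14, 17, 21, 26, 27, 32],
    [5, 9, 10, 11, 12, 13, 14, 17, 22, 23, 26, 27, 32, 34],
    [5, 8, 9, 10, 15, 19, 23, 34],
    [4, 7, 8, 10, 11, 14, 15, 16, 17, 34, 35],
    [4, 5, 7, 8, 9, 10, 11, 14, 15, 16, 17, 23, 34, 35],
    [4, 6, 7, 8, 11, 14, 15, 16, 21, 33, 35],
    [4, 5, 6, 7, 8, 9, 10, 11, 14, 17, 20, 21, 23, 29, 33, 34, 35],
    [0, 1, 2, 3, 16, 18, 20, 22, 24, 25, 28, 29, 30, 31, 33, 35],
    [0, 1, 2, 3, 15, 16, 18, 19, 24, 25, 28, 30, 31],
    [0, 1, 2, 3, 9, 18, 19, 22, 23, 24, 25, 26, 28, 30, 31, 32],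
    [0, 1, 2, 3, 12, 13, 18, 19, 22, 24, 25, 26, 27, 30, 31, 32],
    [5, 9, 10, 12, 13, 17, 23, 26, 27, 32, 34],
    [5, 7, 8, 9, 10, 12, 13, 15, 16, 17, 19, 23, 26, 27, 32, 34, 35],
    [4, 5, 7, 8, 10, 11, 12, 13, 14, 17, 26, 27, 32, 34],
    [0, 4, 6, 7, 12, 13, 20, 21, 26, 27, 29, 32, 33, 35],
    [4, 6, 7, 8, 15, 16, 20, 21, 29, 33, 35],
    [12, 13, 26, 27, 32],
    [5, 12, 13, 22, 23, 26, 27, 32],
    [7, 8, 9, 10, 15, 16, 19, 35],
    [1, 2, 3, 18, 19, 22, 24, 25, 30, 31],
    [4, 5, 6, 10, 11, 12, 13, 14, 17, 20, 21, 26, 27, 29, 32, 33, 34],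
    [6, 16, 20, 21, 28, 29, 33, 35],
    [5, 8, 9, 10, 11, 14, 15, 17, 19, 23, 34],
    [0, 1, 2, 3, 18, 19, 20, 22, 24, 25, 26, 28, 29, 30, 31, 32],
    [0, 1, 2, 3, 9, 18, 19, 22, 23, 24, 25, 30, 31],
    [4, 5, 7, 8, 9, 10, 11, 14, 15, 16, 17, 19, 21, 23, 33, 34, 35],
    [4, 6, 7, 8, 10, 11, 14, 15, 16, 17, 20, 21, 28, 29, 33, 34, 35],
    [4, 5, 6, 9, 10, 11, 14, 17, 20, 21, 23, 29, 33, 34],
    [4, 6, 10, 11, 14, 17, 20, 21, 29, 33, 34],
    [0, 4, 6, 7, 8, 13, 15, 16, 20, 21, 29, 32, 33, 35],
    [1, 2, 3, 5, 9, 18, 19, 22, 23, 24, 25, 26, 27, 28, 30, 31],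
    [4, 6, 7, 8, 10, 11, 14, 15, 16, 17, 21, 33, 34, 35],
    [4, 6, 7, 8, 10, 11, 14, 17, 20, 21, 29, 33, 34, 35],
    [0, 1, 2, 3, 15, 16, 18, 19, 20, 22, 24, 25, 28, 29, 30, 31],
    [4, 7, 8, 15, 16, 21, 33, 35],
    [0, 1, 2, 3, 18, 19, 20, 24, 25, 28, 29, 30, 31],
    [5, 12, 17, 27, 34],
    [4, 5, 7, 8, 10, 11, 12, 14, 15, 16, 17, 27, 34, 35],
    [0, 1, 2, 3, 18, 19, 24, 25, 30, 31],
    [7, 8, 15, 16, 35],
    [4, 6, 7, 8, 11, 12, 13, 14, 15, 16, 17, 20, 21, 28, 29, 33, 35],
    [4, 5, 6, 11, 12, 13, 14, 17, 20, 21, 27, 29, 33, 34],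
    [0, 1, 2, 3, 6, 18, 19, 20, 21, 24, 25, 28, 29, 30, 31, 33],
    [0, 4, 6, 7, 8, 10, 11, 13, 14, 15, 16, 20, 21, 29, 32, 33, 35],
    [5, 8, 9, 10, 12, 13, 15, 17, 19, 23, 26, 27, 32, 34],
    [5, 9, 10, 22, 23, 26, 27, 34],
    [5, 7, 8, 9, 10, 15, 16, 19, 23, 34, 35],
    [5, 6, 9, 10, 11, 12, 13, 14, 17, 23, 26, 27, 32, 34],
    [0, 4, 5, 6, 11, 12, 13, 14, 17, 20, 21, 26, 27, 29, 32, 33, 34],
    [0, 6, 13, 20, 21, 29, 32, 33],
    [4, 5, 7, 8, 10, 11, 12, 13, 14, 15, 16, 17, 26, 27, 32, 34, 35],
    [6, 11, 12, 13, 17, 26, 27, 32],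
    [4, 6, 11, 14, 20, 21, 29, 33],
    [0, 1, 2, 3, 18, 19, 22, 24, 25, 26, 30, 31, 32],
    [0, 1, 2, 3, 9, 18, 19, 20, 22, 23, 24, 25, 28, 29, 30, 31],
    [4, 7, 8, 10, 14, 15, 16, 35],
    [4, 6, 11, 12, 13, 14, 17, 20, 21, 29, 33],
    [4, 6, 11, 12, 13, 14, 17, 20, 21, 26, 27, 29, 32, 33],
    [4, 6, 7, 20, 21, 29, 33, 35],
    [4, 7, 21, 33, 35],
    [4, 6, 7, 8, 11, 14, 15, 16, 20, 21, 28, 29, 33, 35],
    [4, 6, 7, 11, 14, 21, 33, 35],
    [10, 11, 14, 17, 34],
    [4, 5, 6, 9, 10, 11, 12, 13, 14, 17, 21, 23, 27, 34],
    [4, 6, 10, 11, 14, 17, 21, 34],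
    [4, 5, 7, 8, 9, 10, 11, 14, 17, 23, 34],
    [0, 1, 2, 3, 7, 8, 15, 16, 18, 19, 24, 25, 28, 30, 31, 35],
    [5, 7, 8, 9, 10, 12, 15, 16, 17, 19, 23, 27, 34, 35],
    [4, 5, 7, 8, 9, 10, 11, 14, 17, 21, 23, 33, 34, 35],
    [0, 1, 2, 3, 12, 13, 18, 22, 24, 25, 26, 27, 28, 30, 31, 32],
    [0, 1, 2, 3, 18, 20, 22, 24, 25, 28, 29, 30, 31],
    [0, 6, 12, 13, 20, 21, 26, 27, 29, 32, 33]]"

text \<open>The entry at position \<open>i\<close>, counted from 0, avoids the vertex
  \<open>i + 4\<close>. The cycles that avoid a corner are in \<open>corners36_ok\<close>, since
  they have to begin with two edges of the square.\<close>

definition cycles36 :: "nat list list" where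
  "cycles36 = [
    [0, 1, 2, 3, 22, 24, 30, 25, 31, 18, 19, 9, 23, 5, 34, 10, 14, 11, 17, 12, 27, 26, 32, 13, 6,
    21, 33, 35, 7, 8, 15, 16, 28, 20, 29],
    [0, 1, 30, 25, 31, 18, 28, 16, 35, 7, 8, 15, 19, 24, 2, 3, 22, 23, 9, 10, 34, 17, 11, 14, 4, 21,
    33, 20, 29, 6, 13, 12, 27, 26, 32],
    [0, 1, 30, 25, 31, 18, 28, 16, 35, 7, 8, 15, 19, 24, 2, 3, 22, 26, 32, 13, 12, 27, 5, 23, 9, 10,
    34, 17, 11, 14, 4, 21, 33, 20, 29],
    [0, 1, 2, 3, 22, 24, 30, 25, 31, 18, 19, 15, 8, 10, 9, 23, 5, 34, 17, 11, 14, 4, 21, 33, 35, 16,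
    28, 20, 29, 6, 13, 12, 27, 26, 32],
    [0, 1, 2, 3, 22, 24, 30, 25, 31, 18, 28, 16, 15, 19, 9, 23, 5, 34, 10, 14, 11, 17, 12, 27, 26,
    32, 13, 6, 21, 4, 7, 35, 33, 20, 29],
    [0, 1, 2, 3, 22, 23, 5, 34, 17, 11, 14, 10, 8, 7, 4, 21, 33, 35, 16, 15, 19, 24, 30, 25, 31, 18,
    28, 20, 29, 6, 13, 12, 27, 26, 32],
    [0, 1, 2, 3, 22, 24, 30, 25, 31, 18, 19, 9, 23, 5, 34, 17, 11, 14, 4, 21, 33, 35, 7, 8, 15, 16,
    28, 20, 29, 6, 13, 12, 27, 26, 32],
    [0, 1, 2, 3, 22, 24, 30, 25, 31, 18, 19, 9, 23, 5, 34, 17, 12, 27, 26, 32, 13, 6, 21, 33, 35, 7,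
    4, 14, 10, 8, 15, 16, 28, 20, 29],
    [0, 1, 2, 3, 22, 24, 30, 25, 31, 18, 19, 9, 23, 5, 27, 26, 32, 13, 6, 21, 33, 35, 7, 4, 14, 11,
    17, 34, 10, 8, 15, 16, 28, 20, 29],
    [0, 1, 2, 3, 22, 24, 30, 25, 31, 18, 19, 9, 23, 5, 34, 10, 8, 15, 16, 28, 20, 29, 6, 21, 33, 35,
    7, 4, 14, 11, 17, 12, 27, 26, 32],
    [0, 1, 2, 3, 22, 26, 32, 13, 12, 27, 5, 23, 9, 10, 34, 17, 11, 6, 21, 4, 7, 8, 15, 19, 24, 30,
    25, 31, 18, 28, 16, 35, 33, 20, 29],
    [0, 1, 2, 3, 22, 24, 30, 25, 31, 18, 19, 9, 23, 5, 34, 17, 11, 14, 10, 8, 7, 4, 21, 33, 35, 16,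
    28, 20, 29, 6, 13, 12, 27, 26, 32],
    [0, 1, 2, 24, 30, 25, 31, 18, 28, 20, 29, 6, 13, 32, 26, 27, 12, 17, 11, 14, 4, 21, 33, 35, 7,
    8, 15, 19, 9, 10, 34, 5, 23, 22, 3],
    [1, 2, 3, 0, 29, 20, 33, 35, 16, 15, 8, 7, 4, 21, 6, 11, 14, 10, 34, 5, 27, 12, 13, 32, 26, 22,
    23, 9, 19, 24, 30, 25, 31, 18, 28],
    [0, 1, 31, 25, 30, 24, 2, 3, 22, 26, 32, 13, 12, 27, 5, 23, 9, 19, 15, 8, 10, 34, 17, 11, 14, 4,
    7, 35, 16, 28, 20, 33, 21, 6, 29],
    [0, 1, 2, 24, 30, 25, 31, 18, 28, 16, 15, 8, 7, 35, 33, 20, 29, 6, 21, 4, 14, 11, 17, 34, 10, 9,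
    23, 5, 27, 12, 13, 32, 26, 22, 3],
    [0, 1, 2, 3, 22, 24, 30, 25, 31, 18, 28, 16, 35, 33, 21, 4, 7, 8, 15, 19, 9, 23, 5, 34, 10, 14,
    11, 17, 12, 27, 26, 32, 13, 6, 29],
    [0, 1, 2, 3, 22, 24, 30, 25, 31, 18, 19, 9, 23, 5, 34, 10, 8, 15, 16, 28, 20, 33, 35, 7, 4, 14,
    11, 17, 12, 27, 26, 32, 13, 6, 29],
    [1, 2, 3, 0, 32, 26, 27, 12, 13, 6, 29, 20, 33, 21, 4, 14, 11, 17, 34, 5, 23, 9, 10, 8, 7, 35,
    16, 15, 19, 24, 30, 25, 31, 18, 28],
    [0, 1, 2, 3, 22, 26, 32, 13, 12, 27, 5, 34, 17, 11, 6, 21, 33, 35, 16, 15, 8, 7, 4, 14, 10, 9,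
    19, 24, 30, 25, 31, 18, 28, 20, 29],
    [1, 2, 3, 0, 32, 26, 22, 23, 9, 10, 8, 7, 35, 33, 21, 4, 14, 11, 17, 34, 5, 27, 12, 13, 6, 29,
    20, 28, 16, 15, 19, 18, 31, 25, 30],
    [2, 3, 0, 32, 26, 22, 23, 9, 10, 8, 7, 35, 33, 21, 4, 14, 11, 17, 34, 5, 27, 12, 13, 6, 29, 20,
    28, 16, 15, 19, 18, 31, 1, 30, 24],
    [0, 1, 30, 25, 31, 18, 28, 16, 35, 33, 20, 29, 6, 21, 4, 7, 8, 15, 19, 24, 2, 3, 22, 23, 9, 10,
    14, 11, 17, 34, 5, 27, 12, 13, 32],
    [0, 1, 2, 3, 22, 26, 32, 13, 12, 17, 34, 5, 23, 9, 10, 8, 7, 35, 16, 15, 19, 24, 30, 25, 31, 18,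
    28, 20, 33, 21, 4, 14, 11, 6, 29],
    [0, 1, 2, 3, 22, 24, 30, 25, 31, 18, 19, 9, 23, 5, 34, 17, 11, 14, 10, 8, 15, 16, 35, 7, 4, 21,
    33, 20, 29, 6, 13, 12, 27, 26, 32],
    [0, 1, 2, 3, 22, 24, 30, 25, 31, 18, 19, 9, 23, 5, 34, 17, 11, 14, 10, 8, 15, 16, 28, 20, 33,
    35, 7, 4, 21, 6, 13, 12, 27, 26, 32],
    [0, 1, 2, 24, 19, 25, 31, 18, 28, 16, 15, 8, 7, 35, 33, 20, 29, 6, 21, 4, 14, 11, 17, 34, 10, 9,
    23, 5, 27, 12, 13, 32, 26, 22, 3],
    [0, 1, 2, 24, 30, 25, 19, 18, 28, 16, 15, 8, 7, 35, 33, 20, 29, 6, 21, 4, 14, 11, 17, 34, 10, 9,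
    23, 5, 27, 12, 13, 32, 26, 22, 3],
    [0, 1, 30, 25, 31, 18, 28, 16, 35, 7, 8, 15, 19, 24, 2, 3, 22, 26, 27, 12, 13, 6, 11, 17, 34, 5,
    23, 9, 10, 14, 4, 21, 33, 20, 29],
    [0, 1, 2, 24, 30, 25, 31, 18, 19, 15, 8, 7, 35, 16, 28, 20, 29, 6, 21, 4, 14, 11, 17, 34, 10, 9,
    23, 5, 27, 12, 13, 32, 26, 22, 3],
    [0, 1, 2, 3, 22, 24, 30, 25, 31, 18, 19, 9, 23, 5, 27, 26, 32, 13, 12, 17, 11, 6, 21, 33, 35, 7,
    4, 14, 10, 8, 15, 16, 28, 20, 29],
    [0, 1, 2, 3, 22, 24, 30, 25, 31, 18, 28, 16, 15, 19, 9, 23, 5, 34, 17, 11, 14, 10, 8, 7, 4, 21,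
    33, 20, 29, 6, 13, 12, 27, 26, 32]]"
lemmas edges36 = edge_table[OF es36_def, simplified list.pred_inject prod.case simp_thms]

lemmas nth36 = nth_table[OF ps36_def, simplified list.pred_inject prod.case simp_thms enumerate_simps
  eval_num]

lemma edges_ok36: "edges_ok 36 es36"
  by (simp only: edges_ok_def es36_def eval_list eval_num)

lemma nonham36:
  assumes "cycle_on {..<36} C" "C \<subseteq> edge_set es36"
  shows False
proof -
  have "list_all (cut_ok 36) cuts36"
    by (simp only: cut_ok_def cuts36_def eval_list eval_num) simp
  from cycle_clauses[OF assms edges_ok36 this] show False
    \<comment> \<open>Evaluation turns the two conditions into clauses over one atom per edge, which
      are refuted propositionally.\<close>
    by (simp only: degree_clauses_def cut_clauses_def es36_def cuts36_def incident_def
        crossing_def upt_rec_numeral upt_conv_Cons zero_less_numeral exactly_two_3 exactly_two_4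
        exactly_two_5 eval_list eval_num cong: if_weak_cong) sat
qed

lemma corners36_ok:
  "cycle_missing 36 (edge_set es36) 0
      [1, 2, 3, 22, 26, 32, 13, 12, 27, 5, 23, 9, 10, 34, 17, 11, 14, 4, 21, 6, 29, 20, 33, 35, 7,
      8, 15, 16, 28, 18, 31, 25, 19, 24, 30]"
  "cycle_missing 36 (edge_set es36) 1
      [2, 3, 0, 32, 26, 22, 23, 9, 10, 8, 7, 35, 33, 21, 4, 14, 11, 17, 34, 5, 27, 12, 13, 6, 29,
      20, 28, 16, 15, 19, 18, 31, 25, 30, 24]"
  "cycle_missing 36 (edge_set es36) 2
      [3, 0, 1, 30, 24, 19, 25, 31, 18, 28, 16, 15, 8, 7, 35, 33, 20, 29, 6, 21, 4, 14, 11, 17, 34,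
      10, 9, 23, 5, 27, 12, 13, 32, 26, 22]"
  "cycle_missing 36 (edge_set es36) 3
      [0, 1, 2, 24, 30, 25, 31, 18, 19, 9, 23, 22, 26, 32, 13, 12, 27, 5, 34, 17, 11, 6, 21, 33, 35,
      7, 4, 14, 10, 8, 15, 16, 28, 20, 29]"
  by (simp_all only: cycle_missing_def cycle_edges_def path_edges.simps insert_subset
      empty_subsetI edges36 eval_list eval_num)

lemma cycles36_ok: "cycles_missing_from 36 (edge_set es36) 4 cycles36"
  by (simp only: cycles36_def cycles_missing_from.simps cycle_missing_def cycle_edges_def
      path_edges.simps insert_subset empty_subsetI edges36 eval_list eval_num)

lemma drawing36: "pairwise_list (compatible_edges ((!) ps36)) es36"
  by (simp only: es36_def pairwise_list.simps compatible_edges.simps nth36 orient.simps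
      disjoint_segments.simps same_side_def eval_list eval_num cong: if_weak_cong) simp

lemma realizes36: "realizes 36"
proof -
  have sq: "{{0, 1}, {1, 2}, {2, 3}, {3, 0}} \<subseteq> edge_set es36"
    by (simp only: insert_subset empty_subsetI edges36 simp_thms)
  have dist: "distinct ps36"
    by (simp only: ps36_def eval_list eval_num)
  have len: "length ps36 = 36"
    by (simp add: ps36_def)
  have box: "list_all (\<lambda>(x, y). - 15 \<le> x \<and> x \<le> 15 \<and> - 15 \<le> y \<and> y \<le> 15) ps36"
    by (simp add: ps36_def)
  have nth: "ps36 ! 0 = (15, 15)" "ps36 ! 1 = (- 15, 15)" "ps36 ! 2 = (- 15, - 15)"
    "ps36 ! 3 = (15, - 15)"
    by (simp_all only: nth36)
  show ?thesis
    by (rule realizes_certificate[OF edges_ok36 _ sq nonham36 corners36_ok cycles36_ok dist len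
          box nth _ drawing36]) simp_all
qed

section \<open>The graph on 37 vertices, drawn in a frame of half side 17\<close>

definition es37 :: "(nat \<times> nat) list" where
  "es37 =
    [(0, 1), (0, 3), (0, 21), (1, 2), (1, 7), (1, 24), (2, 3), (2, 13), (2, 18), (3, 33), (4, 12),
    (4, 17), (4, 19), (5, 18), (5, 23), (5, 27), (6, 10), (6, 17), (6, 31), (7, 11), (7, 26), (7,
    35), (8, 15), (8, 20), (8, 31), (8, 32), (9, 10), (9, 11), (9, 34), (10, 12), (11, 16), (11,
    31), (12, 28), (13, 23), (13, 26), (14, 16), (14, 26), (14, 29), (15, 16), (15, 22), (17, 20),
    (18, 30), (19, 25), (19, 36), (20, 25), (21, 24), (21, 33), (21, 34), (22, 27), (22, 29), (23,
    29), (24, 35), (25, 30), (27, 32), (28, 34), (28, 36), (30, 32), (30, 33), (33, 36), (34, 35)]"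

definition ps37 :: "(int \<times> int) list" where
  "ps37 =
    [(17, 17), (-17, 17), (-17, -17), (17, -17), (-1, -1), (-9, -8), (-4, 0), (-12, 8), (-5, -2),
    (-4, 4), (-3, 2), (-8, 3), (-1, 1), (-14, -9), (-10, -2), (-7, -2), (-9, 0), (-3, -1), (-10,
    -12), (0, -3), (-3, -3), (6, 8), (-8, -4), (-11, -7), (-6, 12), (-2, -4), (-12, -1), (-8, -6),
    (1, 1), (-10, -4), (-2, -7), (-6, 1), (-5, -5), (7, -6), (-1, 6), (-6, 8), (3, -3)]"

definition cuts37 :: "nat list list" where
  "cuts37 = [
    [4, 6, 8, 9, 10, 11, 12, 17, 19, 20, 25, 28, 31, 36],
    [0, 1, 2, 3, 7, 13, 14, 21, 23, 24, 26, 29, 33, 35],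
    [4, 9, 10, 12, 19, 28, 34, 36],
    [5, 6, 8, 14, 15, 16, 17, 18, 20, 22, 23, 25, 27, 29, 30, 31, 32],
    [6, 8, 15, 17, 20, 22, 25, 27, 30, 31, 32],
    [6, 8, 17, 20, 25, 30, 31, 32],
    [0, 1, 2, 3, 5, 7, 18, 21, 24, 27, 28, 30, 32, 33, 34, 35, 36],
    [0, 1, 2, 3, 7, 18, 21, 24, 28, 30, 33, 34, 35, 36],
    [5, 18, 22, 23, 27, 29, 30, 32],
    [0, 1, 2, 3, 7, 18, 21, 24, 30, 33, 35],
    [4, 17, 19, 20, 25],
    [0, 1, 3, 7, 21, 24, 28, 33, 34, 35, 36],
    [4, 6, 8, 9, 10, 11, 12, 15, 16, 17, 19, 20, 25, 28, 31, 34, 36],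
    [4, 6, 9, 10, 12, 17, 28, 34],
    [6, 8, 9, 10, 11, 17, 20, 31],
    [4, 5, 6, 8, 9, 10, 11, 12, 17, 18, 19, 20, 25, 27, 30, 31, 32],
    [4, 6, 8, 11, 15, 16, 17, 19, 20, 25, 31],
    [0, 1, 3, 4, 7, 12, 17, 19, 20, 21, 24, 25, 28, 33, 34, 35, 36],
    [0, 1, 3, 4, 7, 12, 19, 21, 24, 28, 33, 34, 35, 36],
    [8, 11, 14, 15, 16, 22, 29, 31],
    [0, 1, 2, 3, 7, 9, 10, 12, 13, 21, 24, 26, 28, 33, 34, 35, 36],
    [0, 1, 2, 3, 4, 7, 12, 13, 19, 21, 24, 26, 28, 33, 34, 35, 36],
    [4, 8, 14, 15, 16, 17, 19, 20, 22, 25, 27, 29, 30, 32],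
    [5, 6, 8, 9, 10, 11, 15, 16, 18, 22, 27, 30, 31, 32],
    [13, 14, 15, 16, 22, 23, 26, 29],
    [4, 6, 8, 10, 12, 15, 17, 19, 20, 22, 25, 27, 28, 30, 31, 32, 36],
    [4, 6, 8, 11, 15, 16, 17, 19, 20, 22, 25, 27, 31, 32],
    [8, 11, 15, 16, 31],
    [0, 1, 2, 3, 6, 7, 9, 10, 11, 13, 21, 24, 26, 31, 33, 34, 35],
    [0, 1, 2, 3, 7, 13, 14, 21, 23, 24, 26, 28, 29, 33, 34, 35, 36],
    [6, 8, 9, 10, 11, 14, 15, 16, 17, 20, 22, 25, 27, 29, 30, 31, 32],
    [5, 18, 27, 30, 32],
    [0, 1, 3, 6, 7, 9, 10, 11, 21, 24, 31, 33, 34, 35],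
    [6, 8, 11, 15, 16, 17, 20, 31],
    [5, 8, 15, 18, 22, 27, 30, 32],
    [5, 8, 13, 14, 15, 16, 18, 22, 23, 26, 27, 29, 30, 32],
    [0, 1, 2, 3, 7, 13, 14, 15, 16, 21, 22, 23, 24, 26, 29, 33, 35],
    [4, 6, 8, 11, 13, 14, 15, 16, 17, 19, 20, 22, 23, 25, 26, 29, 31],
    [6, 9, 10, 11, 31],
    [4, 8, 12, 17, 19, 20, 25, 28, 30, 32, 36],
    [0, 1, 3, 7, 21, 24, 33, 35],
    [4, 12, 19, 28, 36],
    [6, 8, 9, 10, 11, 17, 20, 25, 30, 31, 32],
    [13, 14, 23, 26, 29],
    [4, 6, 8, 9, 10, 11, 12, 15, 16, 17, 19, 20, 25, 31],
    [2, 5, 13, 14, 18, 23, 26, 29],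
    [0, 1, 2, 3, 5, 7, 13, 18, 21, 23, 24, 26, 28, 33, 34, 35, 36],
    [4, 8, 12, 14, 15, 16, 17, 19, 20, 22, 25, 27, 28, 29, 30, 32, 36],
    [0, 1, 2, 3, 5, 7, 18, 19, 21, 24, 25, 27, 30, 32, 33, 35, 36],
    [2, 5, 6, 8, 13, 17, 18, 20, 23, 25, 27, 30, 31, 32],
    [4, 5, 6, 8, 11, 15, 16, 17, 18, 19, 20, 22, 25, 27, 30, 31, 32],
    [0, 1, 2, 3, 7, 13, 14, 15, 16, 21, 22, 23, 24, 26, 29, 34, 35],
    [8, 20, 25, 30, 32],
    [4, 6, 9, 10, 11, 12, 17, 19, 28, 31, 36],
    [0, 1, 3, 6, 7, 9, 10, 11, 12, 21, 24, 28, 31, 33, 34, 35, 36],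
    [4, 6, 9, 10, 11, 12, 17, 19, 20, 25, 28, 31, 34, 36],
    [0, 1, 3, 7, 9, 11, 14, 15, 16, 21, 22, 24, 26, 29, 33, 34, 35],
    [2, 5, 8, 13, 14, 15, 16, 18, 22, 23, 26, 27, 29, 32],
    [5, 6, 8, 11, 13, 14, 15, 16, 17, 20, 22, 23, 26, 27, 29, 31, 32],
    [6, 8, 11, 13, 14, 15, 16, 17, 20, 22, 23, 26, 29, 31],
    [5, 6, 8, 9, 10, 11, 13, 14, 15, 16, 22, 23, 26, 27, 29, 31, 32],
    [6, 8, 9, 10, 11, 13, 14, 15, 16, 22, 23, 26, 29, 31],
    [2, 5, 8, 13, 18, 20, 23, 25, 27, 30, 32],
    [4, 6, 8, 9, 10, 11, 12, 15, 16, 17, 19, 20, 22, 25, 27, 31, 32],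
    [4, 5, 8, 17, 18, 19, 20, 25, 27, 30, 32],
    [9, 10, 12, 28, 34],
    [4, 12, 17, 19, 20, 25, 28, 36],
    [5, 6, 8, 9, 10, 11, 14, 15, 16, 18, 22, 23, 27, 29, 30, 31, 32],
    [5, 8, 11, 14, 15, 16, 18, 22, 23, 27, 29, 30, 31, 32],
    [0, 1, 2, 3, 7, 9, 11, 13, 21, 24, 26, 33, 34, 35],
    [8, 14, 15, 16, 22, 27, 29, 32],
    [4, 8, 12, 15, 17, 19, 20, 22, 25, 27, 28, 30, 32, 36],
    [0, 1, 2, 3, 21, 24, 28, 33, 34, 35, 36],
    [0, 1, 2, 3, 7, 13, 21, 24, 26, 28, 33, 34, 35, 36],
    [5, 8, 11, 13, 14, 15, 16, 22, 23, 26, 27, 29, 31, 32],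
    [4, 6, 8, 10, 12, 17, 19, 20, 25, 28, 30, 31, 32, 36],
    [2, 5, 8, 11, 13, 14, 15, 16, 18, 22, 23, 26, 27, 29, 30, 31, 32],
    [6, 8, 9, 10, 11, 12, 13, 14, 15, 16, 22, 23, 26, 28, 29, 31, 34],
    [2, 5, 13, 18, 23, 27, 30, 32],
    [0, 1, 2, 3, 5, 7, 13, 18, 21, 23, 24, 26, 33, 35],
    [5, 8, 14, 15, 16, 18, 20, 22, 23, 25, 27, 29, 30, 32],
    [0, 1, 2, 3, 7, 13, 21, 24, 26, 34, 35],
    [4, 5, 6, 8, 10, 12, 17, 18, 19, 20, 25, 27, 28, 30, 31, 32, 36],
    [5, 14, 15, 16, 22, 23, 27, 29],
    [0, 1, 2, 3, 5, 7, 13, 14, 18, 21, 23, 24, 26, 29, 30, 33, 35],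
    [4, 6, 8, 9, 10, 11, 12, 17, 19, 20, 25, 28, 30, 31, 32, 34, 36],
    [2, 5, 13, 14, 15, 16, 18, 22, 23, 26, 27, 29, 30, 32],
    [0, 1, 2, 3, 7, 9, 10, 12, 18, 21, 24, 28, 30, 33, 34, 35, 36],
    [4, 6, 8, 9, 10, 11, 12, 15, 16, 17, 20, 22, 27, 28, 31, 32, 34],
    [0, 1, 2, 3, 5, 7, 13, 18, 21, 23, 24, 26, 27, 30, 32, 33, 35],
    [5, 8, 11, 15, 16, 18, 22, 27, 30, 31, 32],
    [4, 5, 8, 12, 17, 18, 19, 20, 25, 27, 28, 30, 32, 36],
    [6, 9, 10, 11, 12, 28, 31, 34],
    [8, 11, 13, 14, 15, 16, 22, 23, 26, 29, 31],
    [0, 1, 2, 3, 7, 13, 21, 24, 26, 33, 35],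
    [8, 14, 15, 16, 20, 22, 25, 27, 29, 30, 32],
    [4, 6, 8, 9, 10, 11, 12, 14, 15, 16, 17, 19, 20, 22, 25, 29, 31],
    [4, 8, 17, 19, 20, 25, 30, 32],
    [0, 1, 3, 21, 24, 33, 34, 35],
    [0, 1, 3, 7, 9, 11, 21, 24, 33, 34, 35],
    [5, 13, 14, 22, 23, 26, 27, 29],
    [5, 6, 8, 9, 10, 11, 17, 18, 20, 25, 27, 30, 31, 32],
    [2, 5, 6, 8, 13, 15, 17, 18, 20, 22, 23, 25, 27, 29, 30, 31, 32],
    [4, 6, 10, 12, 17, 19, 28, 36],
    [5, 14, 15, 16, 18, 22, 23, 27, 29, 30, 32],
    [5, 8, 18, 20, 25, 27, 30, 32],
    [4, 6, 8, 9, 10, 11, 12, 15, 16, 17, 20, 28, 31, 34],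
    [0, 1, 2, 3, 5, 7, 9, 11, 13, 18, 21, 23, 24, 26, 33, 34, 35],
    [6, 8, 9, 10, 11, 14, 15, 16, 22, 29, 31],
    [4, 6, 8, 9, 10, 11, 12, 17, 19, 20, 25, 30, 31, 32],
    [0, 1, 2, 3, 4, 12, 17, 19, 20, 21, 24, 25, 28, 33, 34, 35, 36],
    [2, 5, 8, 13, 14, 15, 16, 18, 20, 22, 23, 25, 26, 27, 29, 30, 32],
    [0, 1, 3, 4, 7, 9, 10, 11, 12, 19, 21, 24, 28, 33, 34, 35, 36],
    [6, 8, 14, 15, 16, 17, 20, 22, 25, 27, 29, 30, 31, 32],
    [6, 8, 9, 10, 11, 12, 15, 16, 28, 31, 34],
    [8, 15, 20, 22, 25, 27, 30, 32],
    [6, 8, 9, 10, 11, 15, 16, 22, 27, 31, 32],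
    [0, 1, 3, 7, 9, 11, 14, 16, 21, 24, 26, 33, 34, 35],
    [6, 8, 9, 10, 11, 15, 16, 31],
    [8, 11, 15, 16, 22, 27, 31, 32],
    [2, 4, 5, 8, 12, 13, 17, 18, 19, 20, 23, 25, 27, 28, 30, 32, 36],
    [0, 1, 2, 3, 4, 7, 17, 18, 19, 20, 21, 24, 25, 30, 33, 35, 36],
    [4, 6, 9, 10, 11, 12, 17, 31],
    [4, 6, 9, 10, 11, 12, 17, 19, 20, 25, 31],
    [6, 8, 11, 15, 16, 17, 20, 22, 27, 31, 32],
    [2, 5, 13, 18, 22, 23, 27, 29],
    [2, 5, 8, 13, 15, 18, 20, 22, 23, 25, 27, 29, 30, 32],
    [4, 6, 8, 9, 10, 12, 17, 19, 20, 25, 28, 31, 34, 36],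
    [14, 15, 16, 22, 29],
    [0, 1, 2, 3, 5, 7, 18, 21, 24, 27, 30, 32, 33, 35],
    [5, 6, 8, 17, 18, 20, 25, 27, 30, 31, 32],
    [0, 1, 3, 6, 7, 9, 10, 11, 14, 16, 21, 24, 26, 31, 33, 34, 35],
    [5, 7, 8, 11, 13, 14, 15, 16, 18, 22, 23, 26, 27, 29, 30, 31, 32],
    [0, 1, 2, 3, 5, 7, 13, 18, 21, 23, 24, 26, 34, 35],
    [2, 5, 13, 18, 23],
    [4, 5, 8, 14, 15, 16, 17, 18, 19, 20, 22, 23, 25, 27, 29, 30, 32],
    [5, 13, 14, 18, 22, 23, 26, 27, 29, 30, 32],
    [4, 6, 8, 9, 10, 11, 12, 17, 19, 20, 25, 28, 30, 31, 32, 33, 36],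
    [4, 6, 8, 17, 19, 20, 25, 31],
    [0, 1, 3, 7, 9, 10, 12, 21, 24, 28, 33, 34, 35, 36],
    [0, 1, 2, 3, 7, 21, 24, 35],
    [6, 8, 9, 10, 11, 12, 15, 16, 22, 27, 28, 31, 32, 34],
    [0, 1, 2, 3, 7, 18, 19, 21, 24, 25, 30, 33, 35, 36],
    [0, 1, 2, 3, 9, 10, 12, 21, 24, 28, 33, 34, 35, 36],
    [4, 6, 8, 11, 14, 15, 16, 17, 19, 20, 22, 25, 29, 31],
    [4, 6, 10, 12, 17, 19, 20, 25]]"

definition cycles37 :: "nat list list" where
  "cycles37 = [
    [0, 1, 24, 35, 7, 26, 13, 2, 3, 33, 36, 19, 25, 20, 17, 6, 31, 8, 15, 22, 27, 32, 30, 18, 5, 23,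
    29, 14, 16, 11, 9, 10, 12, 28, 34, 21],
    [0, 1, 24, 35, 7, 26, 13, 23, 29, 14, 16, 11, 9, 10, 12, 4, 19, 25, 20, 17, 6, 31, 8, 15, 22,
    27, 32, 30, 18, 2, 3, 33, 36, 28, 34, 21],
    [0, 1, 24, 35, 7, 26, 13, 2, 3, 33, 36, 19, 4, 17, 20, 25, 30, 18, 5, 23, 29, 14, 16, 15, 22,
    27, 32, 8, 31, 11, 9, 10, 12, 28, 34, 21],
    [0, 1, 24, 35, 34, 9, 10, 12, 28, 36, 19, 4, 17, 6, 31, 11, 16, 14, 26, 13, 23, 29, 22, 15, 8,
    20, 25, 30, 32, 27, 5, 18, 2, 3, 33, 21],
    [0, 1, 24, 35, 7, 26, 13, 2, 18, 5, 23, 29, 14, 16, 15, 22, 27, 32, 30, 25, 20, 17, 4, 19, 36,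
    28, 12, 10, 6, 31, 11, 9, 34, 21, 33, 3],
    [0, 1, 24, 35, 34, 28, 36, 19, 25, 20, 17, 4, 12, 10, 6, 31, 8, 32, 30, 18, 5, 27, 22, 15, 16,
    11, 7, 26, 14, 29, 23, 13, 2, 3, 33, 21],
    [0, 1, 24, 35, 7, 26, 13, 2, 3, 33, 36, 28, 12, 4, 19, 25, 20, 17, 6, 31, 8, 15, 22, 27, 32, 30,
    18, 5, 23, 29, 14, 16, 11, 9, 34, 21],
    [0, 1, 24, 35, 7, 26, 13, 2, 18, 5, 23, 29, 14, 16, 15, 22, 27, 32, 30, 25, 19, 36, 28, 12, 4,
    17, 20, 8, 31, 6, 10, 9, 34, 21, 33, 3],
    [0, 1, 24, 35, 7, 26, 13, 2, 18, 5, 23, 29, 14, 16, 11, 9, 10, 6, 31, 8, 15, 22, 27, 32, 30, 25,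
    20, 17, 4, 19, 36, 28, 34, 21, 33, 3],
    [0, 1, 24, 35, 7, 26, 14, 16, 11, 9, 10, 12, 4, 19, 25, 20, 17, 6, 31, 8, 15, 22, 29, 23, 5, 27,
    32, 30, 18, 2, 3, 33, 36, 28, 34, 21],
    [0, 1, 24, 35, 7, 26, 13, 2, 18, 5, 23, 29, 22, 27, 32, 30, 25, 19, 36, 28, 12, 4, 17, 20, 8,
    15, 16, 11, 31, 6, 10, 9, 34, 21, 33, 3],
    [0, 1, 24, 35, 7, 26, 13, 23, 5, 18, 2, 3, 33, 36, 19, 25, 30, 32, 27, 22, 29, 14, 16, 11, 9,
    10, 6, 31, 8, 20, 17, 4, 12, 28, 34, 21],
    [0, 1, 24, 35, 7, 26, 14, 29, 22, 15, 8, 32, 27, 5, 23, 13, 2, 18, 30, 25, 20, 17, 4, 19, 36,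
    28, 12, 10, 6, 31, 11, 9, 34, 21, 33, 3],
    [0, 1, 24, 35, 7, 26, 13, 2, 3, 33, 36, 28, 12, 4, 19, 25, 20, 8, 15, 22, 27, 32, 30, 18, 5, 23,
    29, 14, 16, 11, 31, 6, 10, 9, 34, 21],
    [0, 1, 24, 35, 7, 26, 14, 29, 22, 15, 16, 11, 9, 10, 12, 4, 17, 6, 31, 8, 20, 25, 19, 36, 28,
    34, 21, 33, 30, 32, 27, 5, 23, 13, 2, 3],
    [0, 1, 24, 35, 7, 26, 13, 23, 5, 27, 32, 8, 15, 22, 29, 14, 16, 11, 31, 6, 10, 9, 34, 21, 33,
    36, 28, 12, 4, 17, 20, 25, 30, 18, 2, 3],
    [0, 1, 24, 35, 7, 26, 13, 2, 3, 33, 36, 19, 25, 30, 18, 5, 23, 29, 14, 16, 15, 22, 27, 32, 8,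
    31, 11, 9, 10, 6, 17, 4, 12, 28, 34, 21],
    [0, 1, 24, 35, 34, 9, 10, 12, 28, 36, 33, 30, 32, 27, 22, 29, 14, 16, 15, 8, 20, 25, 19, 4, 17,
    6, 31, 11, 7, 26, 13, 23, 5, 18, 2, 3],
    [0, 1, 24, 35, 7, 26, 13, 23, 29, 14, 16, 15, 8, 32, 27, 5, 18, 2, 3, 33, 30, 25, 20, 17, 4, 19,
    36, 28, 12, 10, 6, 31, 11, 9, 34, 21],
    [0, 1, 24, 35, 7, 26, 13, 2, 18, 5, 27, 32, 30, 25, 19, 36, 28, 12, 4, 17, 20, 8, 15, 22, 29,
    14, 16, 11, 31, 6, 10, 9, 34, 21, 33, 3],
    [0, 1, 2, 3, 33, 36, 28, 12, 10, 9, 11, 31, 6, 17, 4, 19, 25, 20, 8, 32, 30, 18, 5, 27, 22, 15,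
    16, 14, 29, 23, 13, 26, 7, 35, 34, 21],
    [0, 1, 24, 35, 7, 26, 13, 2, 3, 33, 30, 18, 5, 23, 29, 14, 16, 15, 22, 27, 32, 8, 20, 17, 4, 19,
    36, 28, 12, 10, 6, 31, 11, 9, 34, 21],
    [0, 1, 24, 35, 7, 11, 9, 10, 12, 4, 19, 25, 20, 17, 6, 31, 8, 32, 30, 18, 5, 27, 22, 15, 16, 14,
    29, 23, 13, 2, 3, 33, 36, 28, 34, 21],
    [0, 1, 24, 35, 7, 26, 14, 29, 22, 15, 16, 11, 9, 10, 12, 4, 19, 25, 20, 17, 6, 31, 8, 32, 30,
    18, 5, 23, 13, 2, 3, 33, 36, 28, 34, 21],
    [0, 1, 24, 35, 7, 26, 13, 2, 3, 33, 36, 19, 25, 20, 17, 4, 12, 10, 6, 31, 8, 15, 22, 27, 32, 30,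
    18, 5, 23, 29, 14, 16, 11, 9, 34, 21],
    [0, 1, 24, 35, 7, 26, 14, 16, 11, 9, 10, 12, 4, 19, 25, 20, 17, 6, 31, 8, 15, 22, 27, 32, 30,
    18, 5, 23, 13, 2, 3, 33, 36, 28, 34, 21],
    [0, 1, 24, 21, 34, 35, 7, 26, 13, 2, 18, 5, 23, 29, 14, 16, 15, 22, 27, 32, 8, 20, 25, 19, 4,
    17, 6, 31, 11, 9, 10, 12, 28, 36, 33, 3],
    [0, 1, 24, 35, 7, 26, 13, 2, 3, 33, 36, 19, 25, 20, 8, 15, 22, 27, 32, 30, 18, 5, 23, 29, 14,
    16, 11, 9, 10, 6, 17, 4, 12, 28, 34, 21],
    [0, 1, 24, 35, 7, 26, 13, 2, 18, 30, 25, 19, 36, 28, 12, 4, 17, 20, 8, 15, 22, 27, 5, 23, 29,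
    14, 16, 11, 31, 6, 10, 9, 34, 21, 33, 3],
    [0, 1, 7, 35, 24, 21, 34, 9, 10, 12, 28, 36, 19, 4, 17, 6, 31, 11, 16, 14, 26, 13, 23, 29, 22,
    15, 8, 20, 25, 30, 32, 27, 5, 18, 2, 3],
    [0, 1, 2, 3, 33, 36, 28, 12, 10, 9, 11, 31, 6, 17, 4, 19, 25, 20, 8, 32, 30, 18, 5, 27, 22, 15,
    16, 14, 29, 23, 13, 26, 7, 35, 24, 21],
    [0, 1, 24, 21, 34, 9, 10, 12, 28, 36, 33, 30, 32, 27, 22, 29, 14, 16, 15, 8, 20, 25, 19, 4, 17,
    6, 31, 11, 7, 26, 13, 23, 5, 18, 2, 3],
    [0, 1, 24, 35, 7, 26, 13, 2, 3, 33, 30, 18, 5, 23, 29, 14, 16, 15, 22, 27, 32, 8, 20, 25, 19, 4,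
    17, 6, 31, 11, 9, 10, 12, 28, 34, 21]]"
lemmas edges37 = edge_table[OF es37_def, simplified list.pred_inject prod.case simp_thms]

lemmas nth37 = nth_table[OF ps37_def, simplified list.pred_inject prod.case simp_thms enumerate_simps
  eval_num]

lemma edges_ok37: "edges_ok 37 es37"
  by (simp only: edges_ok_def es37_def eval_list eval_num)

lemma nonham37:
  assumes "cycle_on {..<37} C" "C \<subseteq> edge_set es37"
  shows False
proof -
  have "list_all (cut_ok 37) cuts37"
    by (simp only: cut_ok_def cuts37_def eval_list eval_num) simp
  from cycle_clauses[OF assms edges_ok37 this] show False
    by (simp only: degree_clauses_def cut_clauses_def es37_def cuts37_def incident_def
        crossing_def upt_rec_numeral upt_conv_Cons zero_less_numeral exactly_two_3 exactly_two_4
        exactly_two_5 eval_list eval_num cong: if_weak_cong) sat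
qed

lemma corners37_ok:
  "cycle_missing 37 (edge_set es37) 0
      [1, 2, 3, 33, 36, 28, 12, 10, 9, 11, 31, 6, 17, 4, 19, 25, 20, 8, 32, 30, 18, 5, 27, 22, 15,
      16, 14, 29, 23, 13, 26, 7, 35, 34, 21, 24]"
  "cycle_missing 37 (edge_set es37) 1
      [2, 3, 0, 21, 24, 35, 34, 9, 10, 12, 28, 36, 33, 30, 18, 5, 27, 32, 8, 20, 25, 19, 4, 17, 6,
      31, 11, 7, 26, 14, 16, 15, 22, 29, 23, 13]"
  "cycle_missing 37 (edge_set es37) 2
      [3, 0, 1, 24, 21, 34, 35, 7, 26, 13, 23, 5, 18, 30, 32, 27, 22, 29, 14, 16, 15, 8, 20, 25, 19,
      4, 17, 6, 31, 11, 9, 10, 12, 28, 36, 33]"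
  "cycle_missing 37 (edge_set es37) 3
      [0, 1, 2, 18, 5, 27, 32, 30, 33, 36, 19, 25, 20, 17, 4, 12, 28, 34, 9, 10, 6, 31, 8, 15, 22,
      29, 23, 13, 26, 14, 16, 11, 7, 35, 24, 21]"
  by (simp_all only: cycle_missing_def cycle_edges_def path_edges.simps insert_subset
      empty_subsetI edges37 eval_list eval_num)

lemma cycles37_ok: "cycles_missing_from 37 (edge_set es37) 4 cycles37"
  by (simp only: cycles37_def cycles_missing_from.simps cycle_missing_def cycle_edges_def
      path_edges.simps insert_subset empty_subsetI edges37 eval_list eval_num)

lemma drawing37: "pairwise_list (compatible_edges ((!) ps37)) es37"
  by (simp only: es37_def pairwise_list.simps compatible_edges.simps nth37 orient.simps
      disjoint_segments.simps same_side_def eval_list eval_num cong: if_weak_cong) simp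

lemma realizes37: "realizes 37"
proof -
  have sq: "{{0, 1}, {1, 2}, {2, 3}, {3, 0}} \<subseteq> edge_set es37"
    by (simp only: insert_subset empty_subsetI edges37 simp_thms)
  have dist: "distinct ps37"
    by (simp only: ps37_def eval_list eval_num)
  have len: "length ps37 = 37"
    by (simp add: ps37_def)
  have box: "list_all (\<lambda>(x, y). - 17 \<le> x \<and> x \<le> 17 \<and> - 17 \<le> y \<and> y \<le> 17) ps37"
    by (simp add: ps37_def)
  have nth: "ps37 ! 0 = (17, 17)" "ps37 ! 1 = (- 17, 17)" "ps37 ! 2 = (- 17, - 17)"
    "ps37 ! 3 = (17, - 17)"
    by (simp_all only: nth37)
  show ?thesis
    by (rule realizes_certificate[OF edges_ok37 _ sq nonham37 corners37_ok cycles37_ok dist len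
          box nth _ drawing37]) simp_all
qed

section \<open>The graph on 38 vertices, drawn in a frame of half side 15\<close>

definition es38 :: "(nat \<times> nat) list" where
  "es38 =
    [(0, 1), (0, 3), (0, 14), (0, 26), (1, 2), (1, 8), (1, 12), (2, 3), (2, 13), (3, 29), (3, 35),
    (4, 6), (4, 16), (4, 17), (4, 31), (5, 24), (5, 28), (5, 31), (6, 13), (6, 19), (7, 12), (7,
    26), (7, 32), (8, 15), (8, 25), (9, 11), (9, 26), (9, 36), (10, 27), (10, 31), (10, 32), (11,
    21), (11, 34), (12, 23), (13, 15), (13, 35), (14, 29), (14, 33), (15, 16), (16, 28), (17, 22),
    (17, 27), (18, 21), (18, 27), (18, 36), (19, 22), (19, 34), (20, 29), (20, 33), (20, 35), (21,
    22), (23, 24), (23, 25), (24, 32), (25, 28), (26, 37), (30, 33), (30, 35), (30, 37), (32, 36),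
    (34, 35), (34, 37)]"

definition ps38 :: "(int \<times> int) list" where
  "ps38 =
    [(15, 15), (-15, 15), (-15, -15), (15, -15), (-3, 2), (-4, 5), (-2, 0), (-1, 8), (-9, 8), (3,
    5), (-2, 5), (2, 3), (-7, 10), (-4, -4), (12, 3), (-6, 2), (-5, 3), (-1, 3), (0, 4), (0, 1), (9,
    -3), (1, 3), (0, 2), (-6, 8), (-4, 6), (-7, 7), (5, 8), (-1, 4), (-5, 5), (12, -5), (7, -1),
    (-3, 4), (-2, 6), (9, 0), (4, 0), (6, -5), (0, 5), (5, 2)]"

definition cuts38 :: "nat list list" where
  "cuts38 = [
    [0, 1, 2, 3, 8, 13, 14, 15, 16, 20, 25, 26, 28, 29, 30, 33, 35, 37],
    [4, 6, 10, 17, 19, 22, 27, 31],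
    [5, 7, 8, 12, 15, 16, 23, 24, 25, 28, 32],
    [4, 6, 8, 9, 11, 13, 15, 16, 17, 18, 19, 21, 22, 25, 27, 28, 36],
    [7, 9, 11, 12, 18, 21, 23, 24, 26, 32, 36],
    [4, 5, 8, 10, 15, 16, 17, 23, 24, 25, 27, 28, 31, 32],
    [4, 6, 13, 15, 16, 17, 19, 22],
    [0, 1, 2, 3, 6, 9, 11, 13, 14, 19, 20, 26, 29, 30, 33, 34, 35, 37],
    [7, 9, 12, 23, 24, 26, 32, 36],
    [0, 1, 2, 3, 6, 8, 13, 14, 15, 19, 20, 26, 29, 30, 33, 34, 35, 37],
    [5, 9, 10, 11, 18, 21, 23, 24, 25, 27, 28, 31, 32, 36],
    [0, 1, 2, 3, 8, 13, 14, 15, 20, 29, 30, 33, 34, 35, 37],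
    [0, 2, 3, 13, 14, 20, 29, 30, 33, 34, 35, 37],
    [0, 1, 2, 3, 8, 13, 14, 15, 20, 26, 29, 30, 33, 35, 37],
    [4, 9, 10, 11, 17, 18, 21, 22, 27, 31, 36],
    [4, 5, 7, 10, 12, 16, 17, 23, 24, 25, 27, 28, 31, 32],
    [4, 5, 7, 8, 10, 12, 15, 16, 23, 24, 25, 28, 31, 32],
    [5, 10, 23, 24, 25, 28, 31, 32],
    [4, 6, 9, 10, 11, 17, 18, 19, 21, 22, 27, 31, 34, 36],
    [4, 5, 6, 8, 10, 15, 16, 17, 19, 22, 25, 27, 28, 31],
    [17, 18, 21, 22, 27],
    [9, 11, 17, 18, 21, 22, 27, 36],
    [0, 1, 2, 3, 14, 20, 29, 30, 33, 34, 35, 37],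
    [4, 6, 9, 11, 17, 18, 19, 21, 22, 27, 36],
    [0, 1, 2, 3, 7, 9, 11, 12, 13, 14, 20, 26, 29, 30, 33, 34, 35, 37],
    [0, 1, 2, 3, 14, 20, 26, 29, 30, 33, 35, 37],
    [5, 8, 15, 16, 23, 24, 25, 28],
    [4, 5, 6, 7, 10, 12, 16, 17, 19, 22, 23, 24, 25, 27, 28, 31, 32],
    [0, 1, 2, 3, 9, 11, 14, 18, 20, 21, 26, 29, 30, 33, 34, 35, 36, 37],
    [5, 7, 8, 9, 11, 12, 15, 16, 18, 21, 23, 24, 25, 26, 28, 32, 36],
    [4, 5, 6, 7, 10, 12, 17, 19, 22, 23, 24, 27, 31, 32],
    [0, 1, 2, 3, 7, 8, 12, 14, 20, 23, 25, 26, 29, 30, 33, 34, 35, 37],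
    [0, 1, 2, 3, 6, 11, 13, 14, 19, 20, 21, 22, 29, 30, 33, 34, 35, 37],
    [0, 2, 3, 9, 11, 13, 14, 20, 26, 29, 30, 33, 34, 35, 37],
    [4, 6, 8, 13, 15, 16, 17, 19, 22, 25, 28],
    [4, 5, 7, 9, 10, 11, 12, 17, 18, 21, 22, 23, 24, 27, 31, 32, 36],
    [5, 7, 12, 23, 24, 25, 28, 32],
    [5, 23, 24, 25, 28],
    [4, 5, 8, 10, 15, 16, 17, 25, 27, 28, 31],
    [0, 2, 3, 6, 13, 14, 19, 20, 26, 29, 30, 33, 34, 35, 37],
    [4, 6, 10, 13, 15, 16, 17, 19, 22, 27, 31],
    [4, 5, 7, 10, 12, 17, 23, 24, 27, 31, 32],
    [0, 1, 2, 3, 7, 12, 14, 20, 26, 29, 30, 33, 34, 35, 37],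
    [4, 5, 8, 9, 10, 11, 15, 16, 17, 18, 21, 22, 25, 27, 28, 31, 36],
    [5, 7, 10, 12, 17, 18, 21, 22, 23, 24, 27, 31, 32, 36],
    [4, 5, 10, 16, 17, 27, 28, 31],
    [4, 6, 8, 13, 15, 16, 17, 18, 19, 21, 22, 25, 27, 28],
    [4, 5, 10, 17, 24, 27, 31, 32],
    [5, 8, 10, 15, 16, 23, 24, 25, 28, 31, 32],
    [5, 7, 10, 12, 18, 23, 24, 27, 31, 32, 36],
    [5, 7, 9, 10, 11, 12, 18, 21, 23, 24, 27, 31, 32, 36],
    [4, 5, 6, 8, 10, 13, 15, 16, 17, 19, 22, 23, 24, 25, 27, 28, 31],
    [9, 11, 18, 19, 21, 22, 34, 36],
    [1, 5, 7, 8, 10, 12, 15, 16, 18, 23, 24, 25, 27, 28, 31, 32, 36],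
    [0, 1, 2, 3, 7, 12, 13, 14, 20, 26, 29, 30, 33, 35, 37],
    [4, 6, 9, 11, 13, 15, 16, 17, 18, 19, 21, 22, 27, 36],
    [5, 10, 24, 31, 32],
    [0, 2, 3, 9, 11, 13, 14, 18, 20, 21, 26, 29, 30, 33, 34, 35, 36, 37],
    [4, 5, 6, 10, 17, 19, 22, 24, 27, 31, 32],
    [5, 7, 9, 10, 11, 12, 17, 18, 21, 22, 23, 24, 26, 27, 31, 32, 36],
    [0, 1, 2, 3, 7, 12, 13, 14, 20, 23, 24, 26, 29, 30, 32, 33, 35, 37],
    [5, 7, 10, 12, 23, 24, 31, 32],
    [4, 6, 9, 10, 11, 17, 18, 19, 21, 22, 27, 31, 32, 36],
    [4, 5, 6, 8, 10, 15, 16, 17, 19, 22, 23, 24, 25, 27, 28, 31, 32],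
    [4, 5, 6, 10, 16, 17, 19, 22, 23, 24, 25, 27, 28, 31],
    [5, 8, 10, 15, 16, 18, 23, 24, 25, 27, 28, 31, 32, 36],
    [4, 5, 7, 8, 9, 10, 12, 15, 16, 23, 24, 25, 26, 28, 31, 32, 36],
    [4, 10, 17, 27, 31],
    [4, 5, 8, 15, 16, 25, 28, 31],
    [0, 2, 3, 4, 6, 13, 14, 17, 19, 20, 22, 26, 29, 30, 33, 34, 35, 37],
    [4, 6, 9, 10, 11, 13, 15, 16, 17, 18, 19, 21, 22, 27, 31, 32, 36],
    [1, 5, 7, 8, 10, 12, 15, 16, 23, 24, 25, 28, 31, 32],
    [5, 9, 10, 11, 18, 21, 24, 27, 31, 32, 36],
    [0, 1, 2, 3, 6, 7, 12, 13, 14, 19, 20, 26, 29, 30, 33, 34, 35, 37],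
    [4, 6, 17, 18, 19, 21, 22, 27],
    [9, 11, 18, 21, 36],
    [5, 8, 9, 10, 11, 15, 16, 18, 21, 23, 24, 25, 27, 28, 31, 32, 36],
    [7, 9, 11, 18, 21, 26, 32, 36],
    [8, 15, 16, 25, 28],
    [0, 1, 2, 3, 7, 8, 12, 13, 14, 15, 20, 26, 29, 30, 33, 34, 35, 37],
    [1, 4, 5, 7, 8, 10, 12, 15, 16, 17, 23, 24, 25, 27, 28, 31, 32],
    [9, 10, 11, 18, 21, 27, 32, 36],
    [1, 7, 8, 12, 23, 24, 25, 32],
    [7, 12, 23, 24, 32],
    [4, 5, 6, 7, 10, 12, 17, 18, 19, 21, 22, 23, 24, 27, 31, 32, 36],
    [0, 1, 2, 3, 9, 11, 14, 20, 26, 29, 30, 33, 34, 35, 37],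
    [4, 5, 8, 10, 15, 16, 17, 18, 21, 22, 25, 27, 28, 31],
    [4, 5, 6, 10, 17, 18, 19, 21, 22, 24, 27, 31, 32, 36],
    [5, 7, 9, 11, 12, 18, 21, 23, 24, 25, 26, 28, 32, 36],
    [5, 7, 9, 10, 12, 23, 24, 26, 31, 32, 36],
    [4, 5, 6, 9, 10, 11, 16, 17, 18, 19, 21, 22, 27, 28, 31, 34, 36],
    [0, 2, 3, 13, 14, 20, 26, 29, 30, 33, 35, 37],
    [5, 10, 18, 24, 27, 31, 32, 36],
    [4, 5, 6, 9, 10, 11, 17, 18, 19, 21, 22, 24, 27, 31, 32, 34, 36],
    [4, 5, 6, 10, 16, 17, 19, 22, 27, 28, 31],
    [4, 6, 11, 17, 19, 21, 22, 34],
    [4, 10, 17, 18, 21, 22, 27, 31],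
    [5, 7, 8, 9, 12, 15, 16, 23, 24, 25, 26, 28, 32, 36],
    [4, 5, 9, 10, 11, 16, 17, 18, 21, 22, 27, 28, 31, 36],
    [4, 6, 8, 13, 15, 16, 25, 28],
    [4, 6, 17, 19, 22],
    [1, 8, 12, 15, 16, 23, 25, 28],
    [0, 1, 2, 3, 6, 13, 14, 19, 20, 29, 30, 33, 34, 35, 37],
    [4, 5, 9, 10, 11, 17, 18, 21, 22, 24, 27, 31, 32, 36],
    [0, 1, 2, 3, 8, 13, 14, 15, 16, 20, 25, 28, 29, 30, 33, 34, 35, 37]]"

definition cycles38 :: "nat list list" where
  "cycles38 = [
    [0, 1, 8, 15, 16, 28, 25, 23, 12, 7, 26, 9, 11, 21, 18, 36, 32, 24, 5, 31, 10, 27, 17, 22, 19,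
    6, 13, 2, 3, 29, 20, 35, 34, 37, 30, 33, 14],
    [1, 2, 3, 0, 14, 29, 20, 33, 30, 35, 34, 37, 26, 7, 12, 23, 24, 32, 10, 31, 4, 17, 27, 18, 36,
    9, 11, 21, 22, 19, 6, 13, 15, 16, 28, 25, 8],
    [0, 1, 8, 25, 28, 5, 24, 23, 12, 7, 32, 36, 18, 21, 11, 9, 26, 37, 34, 19, 22, 17, 27, 10, 31,
    4, 16, 15, 13, 2, 3, 35, 30, 33, 20, 29, 14],
    [0, 1, 12, 23, 24, 32, 10, 31, 5, 28, 25, 8, 15, 16, 4, 17, 27, 18, 36, 9, 26, 37, 30, 33, 14,
    29, 20, 35, 34, 11, 21, 22, 19, 6, 13, 2, 3],
    [0, 1, 12, 7, 26, 9, 11, 21, 18, 36, 32, 24, 23, 25, 28, 5, 31, 10, 27, 17, 22, 19, 6, 4, 16,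
    15, 13, 2, 3, 29, 20, 35, 34, 37, 30, 33, 14],
    [0, 1, 8, 25, 28, 16, 15, 13, 2, 3, 29, 14, 33, 20, 35, 30, 37, 34, 11, 21, 18, 36, 32, 10, 27,
    17, 22, 19, 6, 4, 31, 5, 24, 23, 12, 7, 26],
    [0, 1, 8, 25, 28, 16, 15, 13, 2, 3, 29, 14, 33, 20, 35, 30, 37, 34, 11, 21, 18, 27, 17, 22, 19,
    6, 4, 31, 5, 24, 23, 12, 7, 32, 36, 9, 26],
    [0, 1, 8, 25, 28, 16, 15, 13, 2, 3, 29, 14, 33, 20, 35, 30, 37, 34, 19, 6, 4, 17, 22, 21, 18,
    27, 10, 31, 5, 24, 23, 12, 7, 32, 36, 9, 26],
    [0, 1, 8, 25, 23, 24, 32, 7, 26, 37, 30, 33, 14, 29, 20, 35, 34, 11, 9, 36, 18, 21, 22, 19, 6,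
    4, 17, 27, 10, 31, 5, 28, 16, 15, 13, 2, 3],
    [1, 2, 3, 0, 26, 37, 30, 33, 14, 29, 20, 35, 34, 11, 9, 36, 18, 21, 22, 19, 6, 4, 17, 27, 10,
    31, 5, 24, 32, 7, 12, 23, 25, 28, 16, 15, 8],
    [0, 1, 8, 15, 16, 28, 25, 23, 12, 7, 32, 24, 5, 31, 10, 27, 17, 4, 6, 19, 22, 21, 18, 36, 9, 11,
    34, 35, 13, 2, 3, 29, 20, 33, 30, 37, 26],
    [0, 1, 8, 25, 28, 16, 4, 17, 27, 10, 31, 5, 24, 23, 12, 7, 32, 36, 18, 21, 22, 19, 6, 13, 2, 3,
    29, 14, 33, 20, 35, 30, 37, 34, 11, 9, 26],
    [0, 1, 2, 3, 29, 14, 33, 20, 35, 30, 37, 34, 11, 9, 36, 18, 21, 22, 19, 6, 13, 15, 8, 25, 28, 5,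
    31, 4, 17, 27, 10, 32, 24, 23, 12, 7, 26],
    [0, 1, 8, 25, 28, 16, 15, 13, 2, 3, 29, 14, 33, 20, 35, 30, 37, 34, 11, 9, 36, 32, 10, 27, 18,
    21, 22, 19, 6, 4, 31, 5, 24, 23, 12, 7, 26],
    [0, 1, 8, 25, 28, 16, 15, 13, 2, 3, 29, 14, 33, 20, 35, 30, 37, 34, 11, 21, 22, 19, 6, 4, 17,
    27, 10, 31, 5, 24, 23, 12, 7, 32, 36, 9, 26],
    [0, 1, 8, 15, 16, 28, 25, 23, 12, 7, 26, 37, 34, 11, 9, 36, 32, 24, 5, 31, 10, 27, 18, 21, 22,
    17, 4, 6, 13, 2, 3, 35, 30, 33, 20, 29, 14],
    [0, 1, 8, 15, 16, 28, 25, 23, 12, 7, 32, 24, 5, 31, 10, 27, 17, 4, 6, 19, 22, 21, 18, 36, 9, 11,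
    34, 35, 13, 2, 3, 29, 14, 33, 30, 37, 26],
    [0, 1, 8, 25, 28, 5, 31, 10, 32, 24, 23, 12, 7, 26, 37, 30, 33, 14, 29, 20, 35, 34, 11, 9, 36,
    18, 27, 17, 22, 19, 6, 4, 16, 15, 13, 2, 3],
    [0, 1, 8, 25, 28, 16, 15, 13, 2, 3, 29, 14, 33, 20, 35, 30, 37, 34, 19, 6, 4, 17, 27, 10, 31, 5,
    24, 23, 12, 7, 32, 36, 18, 21, 11, 9, 26],
    [0, 1, 12, 7, 26, 9, 11, 21, 18, 36, 32, 24, 5, 28, 25, 8, 15, 16, 4, 31, 10, 27, 17, 22, 19, 6,
    13, 2, 3, 29, 20, 35, 34, 37, 30, 33, 14],
    [0, 1, 8, 25, 23, 12, 7, 32, 10, 27, 17, 22, 19, 6, 4, 31, 5, 28, 16, 15, 13, 2, 3, 29, 14, 33,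
    20, 35, 30, 37, 34, 11, 21, 18, 36, 9, 26],
    [0, 1, 8, 15, 16, 28, 5, 24, 23, 12, 7, 32, 10, 31, 4, 17, 27, 18, 36, 9, 26, 37, 30, 33, 14,
    29, 20, 35, 34, 11, 21, 22, 19, 6, 13, 2, 3],
    [0, 1, 8, 15, 16, 28, 25, 23, 12, 7, 32, 24, 5, 31, 10, 27, 17, 4, 6, 19, 22, 21, 18, 36, 9, 11,
    34, 37, 30, 33, 14, 29, 20, 35, 13, 2, 3],
    [0, 1, 2, 3, 29, 20, 35, 13, 6, 19, 34, 11, 9, 36, 18, 21, 22, 17, 4, 16, 15, 8, 25, 28, 5, 31,
    10, 32, 24, 23, 12, 7, 26, 37, 30, 33, 14],
    [0, 1, 8, 25, 23, 12, 7, 26, 9, 11, 21, 18, 36, 32, 24, 5, 31, 10, 27, 17, 22, 19, 6, 4, 16, 15,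
    13, 2, 3, 29, 20, 35, 34, 37, 30, 33, 14],
    [1, 2, 3, 0, 14, 33, 20, 35, 30, 37, 26, 9, 11, 34, 19, 6, 13, 15, 8, 25, 23, 24, 5, 28, 16, 4,
    31, 10, 27, 17, 22, 21, 18, 36, 32, 7, 12],
    [0, 1, 2, 13, 6, 19, 22, 17, 27, 10, 31, 4, 16, 15, 8, 25, 28, 5, 24, 23, 12, 7, 32, 36, 18, 21,
    11, 9, 26, 37, 34, 35, 3, 29, 20, 33, 14],
    [0, 1, 8, 25, 28, 5, 24, 23, 12, 7, 32, 10, 27, 17, 22, 19, 6, 4, 16, 15, 13, 2, 3, 29, 14, 33,
    20, 35, 30, 37, 34, 11, 21, 18, 36, 9, 26],
    [0, 1, 8, 25, 28, 16, 15, 13, 2, 3, 29, 14, 33, 20, 35, 30, 37, 34, 11, 9, 36, 18, 21, 22, 19,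
    6, 4, 17, 27, 10, 31, 5, 24, 23, 12, 7, 26],
    [1, 2, 3, 0, 14, 29, 20, 35, 30, 37, 26, 9, 11, 34, 19, 6, 13, 15, 8, 25, 23, 24, 5, 28, 16, 4,
    31, 10, 27, 17, 22, 21, 18, 36, 32, 7, 12],
    [0, 1, 2, 3, 29, 20, 35, 13, 6, 19, 22, 17, 27, 10, 31, 4, 16, 15, 8, 25, 28, 5, 24, 23, 12, 7,
    32, 36, 18, 21, 11, 9, 26, 37, 30, 33, 14],
    [1, 2, 3, 0, 14, 29, 20, 33, 30, 37, 26, 9, 11, 34, 19, 6, 13, 15, 8, 25, 23, 24, 5, 28, 16, 4,
    31, 10, 27, 17, 22, 21, 18, 36, 32, 7, 12],
    [0, 1, 8, 25, 28, 5, 31, 10, 32, 24, 23, 12, 7, 26, 9, 11, 21, 18, 27, 17, 22, 19, 6, 4, 16, 15,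
    13, 2, 3, 29, 20, 35, 34, 37, 30, 33, 14],
    [0, 1, 8, 25, 28, 5, 31, 10, 27, 17, 22, 21, 18, 36, 32, 24, 23, 12, 7, 26, 9, 11, 34, 19, 6, 4,
    16, 15, 13, 2, 3, 35, 30, 33, 20, 29, 14]]"
lemmas edges38 = edge_table[OF es38_def, simplified list.pred_inject prod.case simp_thms]

lemmas nth38 = nth_table[OF ps38_def, simplified list.pred_inject prod.case simp_thms enumerate_simps
  eval_num]

lemma edges_ok38: "edges_ok 38 es38"
  by (simp only: edges_ok_def es38_def eval_list eval_num)

lemma nonham38:
  assumes "cycle_on {..<38} C" "C \<subseteq> edge_set es38"
  shows False
proof -
  have "list_all (cut_ok 38) cuts38"
    by (simp only: cut_ok_def cuts38_def eval_list eval_num) simp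
  from cycle_clauses[OF assms edges_ok38 this] show False
    by (simp only: degree_clauses_def cut_clauses_def es38_def cuts38_def incident_def
        crossing_def upt_rec_numeral upt_conv_Cons zero_less_numeral exactly_two_3 exactly_two_4
        exactly_two_5 eval_list eval_num cong: if_weak_cong) sat
qed

lemma corners38_ok:
  "cycle_missing 38 (edge_set es38) 0
      [1, 2, 3, 29, 14, 33, 20, 35, 30, 37, 26, 9, 11, 34, 19, 6, 13, 15, 8, 25, 23, 24, 5, 28, 16,
      4, 31, 10, 27, 17, 22, 21, 18, 36, 32, 7, 12]"
  "cycle_missing 38 (edge_set es38) 1
      [2, 3, 0, 14, 29, 20, 33, 30, 35, 34, 37, 26, 9, 11, 21, 18, 36, 32, 7, 12, 23, 24, 5, 28, 25,
      8, 15, 16, 4, 31, 10, 27, 17, 22, 19, 6, 13]"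
  "cycle_missing 38 (edge_set es38) 2
      [3, 0, 1, 8, 25, 28, 16, 15, 13, 6, 19, 22, 17, 4, 31, 5, 24, 23, 12, 7, 26, 9, 36, 32, 10,
      27, 18, 21, 11, 34, 37, 30, 35, 20, 33, 14, 29]"
  "cycle_missing 38 (edge_set es38) 3
      [0, 1, 2, 13, 6, 19, 22, 17, 27, 10, 31, 4, 16, 15, 8, 25, 28, 5, 24, 23, 12, 7, 32, 36, 18,
      21, 11, 9, 26, 37, 34, 35, 30, 33, 20, 29, 14]"
  by (simp_all only: cycle_missing_def cycle_edges_def path_edges.simps insert_subset
      empty_subsetI edges38 eval_list eval_num)

lemma cycles38_ok: "cycles_missing_from 38 (edge_set es38) 4 cycles38"
  by (simp only: cycles38_def cycles_missing_from.simps cycle_missing_def cycle_edges_def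
      path_edges.simps insert_subset empty_subsetI edges38 eval_list eval_num)

lemma drawing38: "pairwise_list (compatible_edges ((!) ps38)) es38"
  by (simp only: es38_def pairwise_list.simps compatible_edges.simps nth38 orient.simps
      disjoint_segments.simps same_side_def eval_list eval_num cong: if_weak_cong) simp

lemma realizes38: "realizes 38"
proof -
  have sq: "{{0, 1}, {1, 2}, {2, 3}, {3, 0}} \<subseteq> edge_set es38"
    by (simp only: insert_subset empty_subsetI edges38 simp_thms)
  have dist: "distinct ps38"
    by (simp only: ps38_def eval_list eval_num)
  have len: "length ps38 = 38"
    by (simp add: ps38_def)
  have box: "list_all (\<lambda>(x, y). - 15 \<le> x \<and> x \<le> 15 \<and> - 15 \<le> y \<and> y \<le> 15) ps38"
    by (simp add: ps38_def)
  have nth: "ps38 ! 0 = (15, 15)" "ps38 ! 1 = (- 15, 15)" "ps38 ! 2 = (- 15, - 15)"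
    "ps38 ! 3 = (15, - 15)"
    by (simp_all only: nth38)
  show ?thesis
    by (rule realizes_certificate[OF edges_ok38 _ sq nonham38 corners38_ok cycles38_ok dist len
          box nth _ drawing38]) simp_all
qed

section \<open>The graph on 39 vertices, drawn in a frame of half side 20\<close>

definition es39 :: "(nat \<times> nat) list" where
  "es39 =
    [(0, 1), (0, 3), (0, 27), (0, 35), (1, 2), (1, 5), (1, 28), (2, 3), (2, 22), (3, 17), (4, 8),
    (4, 12), (4, 17), (5, 22), (5, 31), (6, 19), (6, 24), (6, 28), (7, 14), (7, 28), (7, 35), (8,
    10), (8, 33), (9, 17), (9, 26), (9, 27), (10, 18), (10, 19), (10, 30), (10, 31), (11, 21), (11,
    24), (11, 38), (12, 15), (12, 26), (13, 18), (13, 32), (13, 38), (14, 24), (14, 34), (15, 25),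
    (15, 33), (16, 23), (16, 25), (16, 32), (17, 22), (17, 30), (18, 23), (19, 38), (20, 27), (20,
    32), (20, 36), (20, 37), (21, 32), (21, 34), (22, 29), (23, 33), (25, 36), (26, 36), (28, 31),
    (29, 30), (29, 31), (34, 37), (35, 37)]"

definition ps39 :: "(int \<times> int) list" where
  "ps39 =
    [(20, 20), (-20, 20), (-20, -20), (20, -20), (5, -2), (-13, 7), (-4, 11), (1, 15), (2, 1), (10,
    2), (-2, 3), (1, 10), (6, 1), (2, 7), (2, 13), (5, 3), (5, 6), (6, -8), (1, 5), (-2, 8), (9,
    10), (4, 10), (-9, -7), (3, 5), (-1, 11), (6, 5), (8, 3), (14, 11), (-9, 14), (-6, -1), (0, -2),
    (-7, 6), (5, 8), (3, 3), (5, 12), (10, 16), (8, 6), (8, 13), (0, 8)]"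

definition cuts39 :: "nat list list" where
  "cuts39 = [
    [13, 16, 18, 20, 21, 23, 25, 32, 34, 36, 37],
    [0, 1, 2, 3, 5, 17, 22, 29, 30, 31],
    [4, 8, 12, 15, 33],
    [9, 12, 13, 15, 16, 18, 20, 23, 25, 26, 27, 32, 33, 36],
    [4, 8, 12, 15, 25, 26, 33, 36],
    [0, 1, 2, 3, 4, 5, 8, 9, 12, 15, 17, 22, 26, 27, 28, 29, 30, 31, 33],
    [0, 1, 2, 3, 5, 6, 7, 10, 13, 17, 18, 19, 22, 28, 29, 30, 31, 35, 38],
    [1, 2, 3, 5, 6, 10, 13, 17, 18, 19, 22, 28, 29, 30, 31, 38],
    [6, 7, 11, 13, 14, 16, 18, 19, 21, 23, 24, 28, 32, 34, 35, 37, 38],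
    [0, 1, 2, 3, 5, 6, 7, 14, 17, 22, 24, 28, 29, 30, 31, 35],
    [4, 6, 8, 10, 11, 12, 13, 14, 15, 18, 19, 21, 23, 24, 33, 34, 38],
    [6, 8, 10, 11, 13, 16, 18, 19, 21, 23, 24, 32, 33, 38],
    [6, 7, 10, 11, 13, 14, 16, 18, 19, 21, 23, 24, 32, 34, 35, 37, 38],
    [4, 8, 9, 10, 12, 13, 15, 16, 18, 20, 23, 25, 26, 27, 32, 33, 36],
    [4, 8, 9, 12, 15, 20, 25, 26, 27, 33, 36],
    [0, 1, 2, 3, 4, 5, 8, 9, 10, 12, 15, 17, 22, 26, 27, 29, 30, 31, 33],
    [6, 7, 11, 14, 19, 21, 24, 34, 35, 37, 38],
    [0, 7, 14, 20, 27, 34, 35, 37],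
    [1, 2, 3, 5, 6, 10, 17, 19, 22, 28, 29, 30, 31],
    [10, 13, 18, 19, 38],
    [0, 1, 2, 3, 5, 9, 16, 17, 20, 22, 25, 26, 27, 28, 29, 30, 31, 32, 36],
    [6, 11, 19, 24, 38],
    [9, 12, 15, 16, 20, 23, 25, 26, 27, 33, 36],
    [0, 1, 2, 3, 5, 7, 10, 22, 28, 29, 30, 31, 35],
    [6, 10, 11, 13, 18, 19, 24, 38],
    [7, 12, 14, 15, 16, 20, 21, 25, 26, 32, 34, 35, 36, 37],
    [6, 10, 11, 13, 14, 18, 19, 21, 24, 34, 38],
    [7, 11, 13, 14, 15, 16, 18, 21, 23, 24, 25, 32, 33, 34, 35, 37, 38],
    [6, 11, 13, 16, 18, 19, 20, 21, 23, 24, 25, 32, 36, 38],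
    [7, 11, 13, 14, 21, 24, 32, 34, 35, 37, 38],
    [6, 8, 10, 11, 13, 18, 19, 23, 24, 33, 38],
    [4, 8, 11, 12, 13, 15, 16, 18, 20, 21, 23, 25, 26, 32, 33, 36, 38],
    [9, 16, 20, 25, 26, 27, 32, 36],
    [13, 15, 16, 18, 23, 25, 32, 33],
    [12, 13, 15, 16, 18, 23, 25, 26, 32, 33, 36],
    [11, 14, 21, 24, 34],
    [6, 10, 11, 13, 14, 16, 18, 19, 21, 23, 24, 32, 34, 38],
    [7, 13, 14, 16, 18, 20, 21, 23, 25, 32, 34, 35, 36, 37],
    [0, 1, 2, 3, 5, 6, 9, 10, 17, 19, 20, 22, 26, 27, 28, 29, 30, 31, 36],
    [7, 11, 14, 21, 24, 34, 35, 37],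
    [6, 7, 8, 10, 11, 13, 14, 18, 19, 21, 23, 24, 33, 34, 35, 37, 38],
    [0, 4, 8, 9, 12, 15, 16, 20, 23, 25, 26, 27, 32, 33, 35, 36, 37],
    [1, 2, 3, 4, 5, 8, 10, 17, 22, 28, 29, 30, 31],
    [1, 2, 3, 5, 17, 22, 28, 29, 30, 31],
    [4, 6, 8, 11, 12, 13, 15, 16, 18, 19, 21, 23, 24, 25, 32, 33, 38],
    [4, 8, 10, 12, 13, 15, 16, 18, 23, 25, 26, 32, 33, 36],
    [1, 2, 3, 5, 6, 10, 13, 16, 17, 18, 19, 22, 23, 28, 29, 30, 31, 32, 38],
    [0, 1, 2, 3, 5, 6, 7, 11, 14, 17, 19, 22, 24, 28, 29, 30, 31, 35, 38],
    [4, 8, 11, 12, 13, 15, 16, 18, 21, 23, 25, 32, 33, 38],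
    [0, 6, 7, 11, 14, 19, 20, 21, 24, 27, 34, 35, 37, 38],
    [9, 11, 12, 13, 15, 16, 18, 20, 21, 23, 25, 26, 27, 32, 33, 36, 38],
    [0, 1, 2, 3, 5, 6, 9, 10, 17, 19, 22, 27, 28, 29, 30, 31],
    [0, 9, 20, 26, 27, 35, 36, 37],
    [0, 1, 2, 3, 5, 9, 17, 22, 27, 28, 29, 30, 31],
    [0, 1, 2, 3, 4, 5, 8, 10, 17, 22, 29, 30, 31],
    [0, 1, 2, 3, 4, 5, 8, 10, 12, 15, 17, 22, 29, 30, 31, 33],
    [0, 7, 9, 11, 14, 16, 20, 21, 24, 25, 26, 27, 32, 34, 35, 36, 37],
    [13, 16, 18, 20, 23, 25, 32, 36],
    [9, 16, 20, 21, 25, 26, 27, 32, 34, 36, 37],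
    [6, 7, 11, 13, 14, 16, 19, 20, 21, 24, 25, 32, 34, 35, 36, 37, 38],
    [0, 1, 2, 3, 4, 5, 8, 9, 10, 17, 22, 27, 28, 29, 30, 31],
    [0, 1, 2, 3, 4, 5, 9, 12, 17, 22, 26, 27, 28, 29, 30, 31],
    [6, 11, 13, 16, 18, 19, 21, 23, 24, 32, 38],
    [6, 11, 13, 15, 16, 18, 19, 21, 23, 24, 25, 32, 33, 38],
    [7, 11, 13, 14, 16, 18, 20, 21, 23, 24, 25, 32, 34, 35, 36, 37, 38],
    [1, 2, 3, 5, 6, 7, 10, 14, 17, 19, 22, 24, 28, 29, 30, 31],
    [0, 1, 2, 3, 4, 5, 7, 8, 10, 12, 15, 17, 22, 28, 29, 30, 31, 33, 35],
    [0, 1, 2, 3, 4, 5, 8, 9, 10, 12, 17, 20, 22, 26, 27, 29, 30, 31, 36],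
    [11, 13, 14, 16, 18, 21, 23, 24, 32, 34, 38],
    [0, 1, 2, 3, 5, 6, 7, 10, 14, 19, 22, 24, 28, 29, 30, 31, 34, 35, 37],
    [0, 1, 2, 3, 5, 7, 14, 17, 22, 28, 29, 30, 31, 34, 35, 37],
    [12, 15, 25, 26, 36],
    [0, 1, 2, 3, 4, 5, 6, 8, 10, 12, 15, 17, 19, 22, 28, 29, 30, 31, 33],
    [7, 14, 34, 35, 37],
    [4, 8, 12, 15, 16, 23, 25, 33],
    [9, 12, 15, 20, 25, 26, 27, 36],
    [0, 1, 2, 3, 5, 7, 9, 17, 20, 22, 26, 27, 28, 29, 30, 31, 35, 36, 37],
    [6, 7, 14, 24, 28, 34, 35, 37],
    [6, 9, 11, 13, 16, 18, 19, 20, 21, 23, 24, 25, 26, 27, 32, 36, 38],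
    [8, 10, 18, 23, 33],
    [13, 16, 18, 23, 32],
    [11, 13, 16, 18, 21, 23, 32, 38],
    [11, 13, 16, 18, 20, 21, 23, 25, 32, 36, 38],
    [6, 11, 14, 19, 21, 24, 34, 38],
    [6, 11, 12, 13, 15, 16, 18, 19, 21, 23, 24, 25, 26, 32, 33, 36, 38],
    [6, 7, 11, 13, 14, 16, 18, 19, 20, 21, 23, 24, 32, 34, 35, 37, 38],
    [4, 8, 10, 12, 13, 15, 16, 18, 19, 23, 25, 32, 33, 38],
    [0, 1, 2, 3, 5, 7, 9, 10, 17, 22, 27, 28, 29, 30, 31, 35],
    [9, 20, 26, 27, 36],
    [11, 13, 15, 16, 18, 21, 23, 25, 32, 33, 38],
    [0, 7, 9, 11, 14, 20, 21, 24, 26, 27, 34, 35, 36, 37],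
    [6, 11, 13, 14, 16, 18, 19, 20, 21, 23, 24, 25, 32, 34, 36, 37, 38],
    [4, 8, 10, 12, 13, 15, 18, 19, 23, 33, 38],
    [7, 14, 20, 21, 32, 34, 35, 37],
    [0, 1, 2, 3, 5, 10, 22, 29, 30, 31],
    [0, 6, 7, 9, 11, 14, 19, 20, 21, 24, 26, 27, 34, 35, 36, 37, 38],
    [15, 16, 23, 25, 33],
    [4, 8, 9, 12, 15, 16, 20, 23, 25, 26, 27, 32, 33, 36],
    [1, 2, 3, 4, 5, 8, 10, 12, 15, 17, 22, 28, 29, 30, 31, 33],
    [0, 4, 7, 8, 9, 12, 14, 15, 20, 25, 26, 27, 33, 34, 35, 36, 37],
    [0, 1, 2, 3, 5, 7, 9, 14, 17, 20, 22, 27, 28, 29, 30, 31, 34, 35, 37],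
    [1, 2, 3, 4, 5, 8, 10, 13, 16, 17, 18, 22, 23, 28, 29, 30, 31, 32, 33],
    [8, 10, 13, 16, 18, 23, 32, 33],
    [0, 7, 9, 12, 14, 15, 20, 25, 26, 27, 34, 35, 36, 37],
    [4, 8, 9, 12, 13, 15, 16, 17, 18, 20, 23, 25, 26, 27, 32, 33, 36],
    [10, 13, 16, 18, 19, 23, 32, 38],
    [0, 4, 8, 9, 12, 15, 20, 25, 26, 27, 33, 35, 36, 37],
    [0, 1, 2, 3, 4, 5, 9, 12, 15, 17, 22, 25, 26, 27, 28, 29, 30, 31, 36],
    [0, 1, 2, 3, 5, 6, 10, 11, 19, 22, 24, 28, 29, 30, 31, 38],
    [11, 13, 21, 32, 38],
    [0, 1, 2, 3, 5, 9, 10, 17, 20, 22, 26, 27, 29, 30, 31, 36],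
    [9, 11, 14, 16, 20, 21, 24, 25, 26, 27, 32, 34, 36, 37],
    [4, 8, 12, 13, 15, 16, 18, 20, 21, 23, 25, 26, 32, 33, 34, 36, 37],
    [0, 1, 2, 3, 5, 6, 10, 19, 22, 28, 29, 30, 31],
    [0, 1, 2, 3, 5, 7, 17, 22, 28, 29, 30, 31, 35],
    [4, 8, 11, 12, 13, 14, 15, 16, 18, 21, 23, 24, 25, 32, 33, 34, 38],
    [0, 7, 9, 14, 20, 26, 27, 34, 35, 36, 37],
    [4, 8, 12, 13, 15, 16, 18, 20, 23, 25, 26, 32, 33, 36],
    [0, 9, 16, 20, 25, 26, 27, 32, 35, 36, 37],
    [0, 1, 2, 3, 5, 9, 10, 17, 22, 27, 29, 30, 31],
    [6, 7, 11, 13, 14, 19, 20, 21, 24, 32, 34, 35, 37, 38],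
    [6, 11, 13, 19, 21, 24, 32, 38],
    [0, 1, 2, 3, 4, 5, 6, 8, 10, 17, 19, 22, 28, 29, 30, 31],
    [0, 1, 2, 3, 4, 5, 8, 9, 10, 17, 18, 22, 23, 27, 28, 29, 30, 31, 33],
    [0, 1, 2, 3, 5, 9, 17, 20, 22, 26, 27, 28, 29, 30, 31, 36],
    [7, 9, 13, 14, 16, 18, 20, 21, 23, 25, 26, 27, 32, 34, 35, 36, 37],
    [6, 7, 11, 14, 19, 24, 28, 38],
    [7, 11, 13, 14, 16, 18, 21, 23, 24, 32, 34, 35, 37, 38],
    [0, 1, 2, 3, 5, 7, 9, 10, 14, 17, 22, 27, 28, 29, 30, 31, 34, 35, 37],
    [9, 13, 16, 18, 20, 21, 23, 25, 26, 27, 32, 34, 36, 37],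
    [6, 7, 10, 11, 13, 14, 18, 19, 21, 24, 34, 35, 37, 38],
    [12, 15, 16, 20, 25, 26, 32, 36],
    [4, 9, 12, 17, 20, 26, 27, 36],
    [1, 2, 3, 5, 10, 17, 22, 29, 30, 31],
    [4, 8, 12, 13, 15, 16, 18, 23, 25, 32, 33],
    [4, 8, 9, 12, 15, 16, 20, 21, 23, 25, 26, 27, 32, 33, 34, 36, 37],
    [4, 8, 9, 12, 15, 16, 17, 20, 23, 25, 26, 27, 33, 36],
    [0, 1, 2, 3, 5, 7, 10, 14, 22, 28, 29, 30, 31, 34, 35, 37],
    [9, 13, 16, 18, 20, 23, 25, 26, 27, 32, 36],
    [4, 8, 9, 12, 15, 17, 26, 33],
    [0, 1, 2, 3, 5, 6, 9, 10, 11, 17, 19, 22, 24, 27, 28, 29, 30, 31, 38],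
    [9, 11, 13, 16, 18, 20, 21, 23, 25, 26, 27, 32, 36, 38],
    [4, 8, 10, 12, 15, 18, 23, 33],
    [0, 1, 2, 3, 5, 6, 7, 10, 11, 14, 19, 22, 24, 28, 29, 30, 31, 35, 38],
    [16, 20, 25, 32, 36],
    [6, 7, 11, 13, 14, 19, 21, 24, 28, 32, 34, 35, 37, 38],
    [4, 6, 8, 10, 11, 12, 13, 15, 18, 19, 23, 24, 33, 38],
    [7, 14, 16, 20, 21, 25, 32, 34, 35, 36, 37],
    [0, 1, 2, 3, 4, 5, 7, 8, 10, 14, 17, 22, 28, 29, 30, 31, 34, 35, 37]]"

definition cycles39 :: "nat list list" where
  "cycles39 = [
    [0, 1, 2, 3, 17, 9, 27, 20, 36, 26, 12, 15, 25, 16, 32, 13, 18, 23, 33, 8, 10, 30, 29, 22, 5,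
    31, 28, 7, 14, 24, 6, 19, 38, 11, 21, 34, 37, 35],
    [0, 1, 2, 22, 29, 30, 10, 31, 28, 6, 19, 38, 11, 24, 14, 7, 35, 37, 34, 21, 32, 13, 18, 23, 16,
    25, 36, 20, 27, 9, 26, 12, 15, 33, 8, 4, 17, 3],
    [0, 1, 28, 7, 35, 37, 34, 14, 24, 11, 21, 32, 16, 25, 36, 20, 27, 9, 26, 12, 15, 33, 23, 18, 13,
    38, 19, 10, 8, 4, 17, 30, 29, 31, 5, 22, 2, 3],
    [0, 1, 2, 3, 17, 9, 27, 20, 36, 26, 12, 4, 8, 33, 15, 25, 16, 23, 18, 13, 32, 21, 11, 38, 19,
    10, 30, 29, 22, 5, 31, 28, 6, 24, 14, 34, 37, 35],
    [0, 1, 2, 3, 17, 4, 12, 26, 9, 27, 20, 36, 25, 15, 33, 23, 16, 32, 13, 18, 10, 30, 29, 22, 5,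
    31, 28, 7, 14, 24, 6, 19, 38, 11, 21, 34, 37, 35],
    [0, 1, 5, 31, 28, 6, 24, 11, 38, 19, 10, 30, 29, 22, 2, 3, 17, 4, 8, 33, 15, 12, 26, 36, 25, 16,
    23, 18, 13, 32, 21, 34, 14, 7, 35, 37, 20, 27],
    [0, 1, 5, 31, 28, 6, 19, 38, 11, 24, 14, 7, 35, 37, 34, 21, 32, 13, 18, 23, 16, 25, 36, 20, 27,
    9, 26, 12, 15, 33, 8, 4, 17, 30, 29, 22, 2, 3],
    [0, 1, 2, 3, 17, 9, 27, 20, 36, 26, 12, 4, 8, 33, 15, 25, 16, 23, 18, 10, 30, 29, 22, 5, 31, 28,
    7, 14, 24, 6, 19, 38, 13, 32, 21, 34, 37, 35],
    [0, 1, 5, 31, 28, 6, 24, 11, 21, 34, 14, 7, 35, 37, 20, 32, 16, 23, 18, 13, 38, 19, 10, 30, 29,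
    22, 2, 3, 17, 4, 8, 33, 15, 25, 36, 26, 9, 27],
    [0, 1, 2, 3, 17, 22, 5, 31, 29, 30, 10, 18, 23, 16, 32, 21, 34, 14, 24, 11, 38, 19, 6, 28, 7,
    35, 37, 20, 36, 25, 15, 33, 8, 4, 12, 26, 9, 27],
    [0, 1, 2, 22, 5, 31, 29, 30, 10, 19, 38, 11, 24, 6, 28, 7, 35, 37, 34, 21, 32, 13, 18, 23, 16,
    25, 36, 20, 27, 9, 26, 12, 15, 33, 8, 4, 17, 3],
    [0, 1, 2, 3, 17, 4, 12, 26, 9, 27, 20, 36, 25, 16, 32, 13, 18, 23, 33, 8, 10, 30, 29, 22, 5, 31,
    28, 7, 14, 24, 6, 19, 38, 11, 21, 34, 37, 35],
    [0, 1, 2, 3, 17, 9, 27, 20, 32, 13, 18, 23, 33, 15, 25, 36, 26, 12, 4, 8, 10, 30, 29, 22, 5, 31,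
    28, 7, 14, 24, 6, 19, 38, 11, 21, 34, 37, 35],
    [1, 2, 3, 0, 35, 7, 14, 24, 6, 19, 38, 11, 21, 34, 37, 20, 27, 9, 26, 36, 25, 16, 32, 13, 18,
    23, 33, 15, 12, 4, 8, 10, 30, 29, 22, 5, 31, 28],
    [0, 1, 2, 3, 17, 9, 26, 36, 25, 15, 12, 4, 8, 33, 23, 16, 32, 13, 38, 11, 21, 34, 14, 24, 6, 19,
    10, 30, 29, 22, 5, 31, 28, 7, 35, 37, 20, 27],
    [0, 1, 2, 3, 17, 22, 5, 31, 29, 30, 10, 8, 4, 12, 15, 33, 23, 18, 13, 38, 11, 24, 6, 28, 7, 14,
    34, 21, 32, 16, 25, 36, 26, 9, 27, 20, 37, 35],
    [0, 1, 2, 3, 17, 4, 12, 15, 33, 8, 10, 30, 29, 22, 5, 31, 28, 6, 19, 38, 11, 24, 14, 7, 35, 37,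
    34, 21, 32, 13, 18, 23, 16, 25, 36, 26, 9, 27],
    [0, 1, 2, 3, 17, 22, 5, 31, 29, 30, 10, 8, 4, 12, 15, 33, 23, 18, 13, 32, 16, 25, 36, 26, 9, 27,
    20, 37, 34, 14, 24, 11, 38, 19, 6, 28, 7, 35],
    [1, 2, 3, 0, 35, 37, 34, 21, 11, 24, 14, 7, 28, 6, 19, 38, 13, 32, 16, 25, 36, 20, 27, 9, 26,
    12, 15, 33, 23, 18, 10, 8, 4, 17, 30, 29, 31, 5],
    [0, 1, 2, 3, 17, 9, 27, 20, 36, 26, 12, 4, 8, 33, 15, 25, 16, 32, 13, 18, 10, 30, 29, 22, 5, 31,
    28, 7, 14, 24, 6, 19, 38, 11, 21, 34, 37, 35],
    [0, 1, 2, 3, 17, 9, 26, 36, 25, 16, 32, 13, 18, 23, 33, 15, 12, 4, 8, 10, 30, 29, 22, 5, 31, 28,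
    6, 19, 38, 11, 21, 34, 14, 7, 35, 37, 20, 27],
    [1, 2, 3, 0, 27, 9, 26, 36, 20, 37, 35, 7, 14, 34, 21, 32, 16, 23, 18, 13, 38, 11, 24, 6, 19,
    10, 8, 33, 15, 12, 4, 17, 30, 29, 22, 5, 31, 28],
    [0, 1, 2, 3, 17, 9, 27, 20, 36, 25, 16, 32, 13, 18, 23, 33, 15, 12, 4, 8, 10, 30, 29, 22, 5, 31,
    28, 7, 14, 24, 6, 19, 38, 11, 21, 34, 37, 35],
    [0, 1, 5, 31, 28, 6, 24, 11, 21, 32, 16, 25, 15, 12, 4, 8, 33, 23, 18, 13, 38, 19, 10, 30, 29,
    22, 2, 3, 17, 9, 26, 36, 20, 37, 34, 14, 7, 35],
    [0, 1, 2, 3, 17, 22, 5, 31, 29, 30, 10, 8, 4, 12, 15, 33, 23, 18, 13, 38, 19, 6, 24, 11, 21, 32,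
    16, 25, 36, 26, 9, 27, 20, 37, 34, 14, 7, 35],
    [0, 1, 28, 7, 35, 37, 34, 14, 24, 6, 19, 38, 11, 21, 32, 13, 18, 23, 16, 25, 36, 20, 27, 9, 26,
    12, 15, 33, 8, 4, 17, 30, 10, 31, 5, 22, 2, 3],
    [0, 1, 5, 31, 29, 22, 2, 3, 17, 9, 27, 20, 36, 26, 12, 4, 8, 33, 15, 25, 16, 23, 18, 10, 19, 38,
    13, 32, 21, 11, 24, 6, 28, 7, 14, 34, 37, 35],
    [1, 2, 3, 0, 35, 37, 34, 21, 11, 24, 14, 7, 28, 6, 19, 38, 13, 32, 16, 25, 36, 20, 27, 9, 26,
    12, 15, 33, 23, 18, 10, 8, 4, 17, 30, 29, 22, 5],
    [0, 1, 2, 3, 17, 4, 12, 15, 33, 8, 10, 30, 29, 22, 5, 31, 28, 6, 19, 38, 13, 18, 23, 16, 25, 36,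
    26, 9, 27, 20, 37, 34, 21, 11, 24, 14, 7, 35],
    [0, 1, 2, 3, 17, 22, 5, 31, 29, 30, 10, 8, 4, 12, 15, 25, 16, 23, 18, 13, 32, 21, 34, 14, 24,
    11, 38, 19, 6, 28, 7, 35, 37, 20, 36, 26, 9, 27],
    [0, 1, 2, 3, 17, 4, 12, 15, 33, 8, 10, 30, 29, 22, 5, 31, 28, 7, 14, 24, 6, 19, 38, 11, 21, 32,
    13, 18, 23, 16, 25, 36, 26, 9, 27, 20, 37, 35],
    [0, 1, 2, 3, 17, 9, 26, 36, 25, 16, 32, 13, 18, 23, 33, 15, 12, 4, 8, 10, 30, 29, 22, 5, 31, 28,
    7, 14, 24, 6, 19, 38, 11, 21, 34, 37, 20, 27],
    [0, 1, 2, 3, 17, 4, 8, 33, 23, 16, 25, 15, 12, 26, 9, 27, 20, 32, 13, 18, 10, 30, 29, 22, 5, 31,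
    28, 7, 14, 24, 6, 19, 38, 11, 21, 34, 37, 35],
    [0, 1, 5, 31, 28, 6, 24, 11, 38, 19, 10, 30, 29, 22, 2, 3, 17, 9, 27, 20, 36, 26, 12, 4, 8, 33,
    15, 25, 16, 23, 18, 13, 32, 21, 34, 14, 7, 35],
    [0, 1, 2, 3, 17, 9, 27, 20, 36, 26, 12, 4, 8, 33, 15, 25, 16, 23, 18, 13, 32, 21, 11, 24, 6, 19,
    10, 30, 29, 22, 5, 31, 28, 7, 14, 34, 37, 35]]"
lemmas edges39 = edge_table[OF es39_def, simplified list.pred_inject prod.case simp_thms]

lemmas nth39 = nth_table[OF ps39_def, simplified list.pred_inject prod.case simp_thms enumerate_simps
  eval_num]

lemma edges_ok39: "edges_ok 39 es39"
  by (simp only: edges_ok_def es39_def eval_list eval_num)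

lemma nonham39:
  assumes "cycle_on {..<39} C" "C \<subseteq> edge_set es39"
  shows False
proof -
  have "list_all (cut_ok 39) cuts39"
    by (simp only: cut_ok_def cuts39_def eval_list eval_num) simp
  from cycle_clauses[OF assms edges_ok39 this] show False
    by (simp only: degree_clauses_def cut_clauses_def es39_def cuts39_def incident_def
        crossing_def upt_rec_numeral upt_conv_Cons zero_less_numeral exactly_two_3 exactly_two_4
        exactly_two_5 eval_list eval_num cong: if_weak_cong) sat
qed

lemma corners39_ok:
  "cycle_missing 39 (edge_set es39) 0
      [1, 2, 3, 17, 9, 27, 20, 36, 26, 12, 4, 8, 33, 15, 25, 16, 23, 18, 13, 32, 21, 34, 37, 35, 7,
      14, 24, 11, 38, 19, 6, 28, 31, 10, 30, 29, 22, 5]"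
  "cycle_missing 39 (edge_set es39) 1
      [2, 3, 0, 35, 37, 34, 21, 11, 24, 14, 7, 28, 6, 19, 38, 13, 32, 16, 25, 36, 20, 27, 9, 26, 12,
      15, 33, 23, 18, 10, 8, 4, 17, 30, 29, 31, 5, 22]"
  "cycle_missing 39 (edge_set es39) 2
      [3, 0, 1, 5, 22, 29, 30, 10, 31, 28, 6, 19, 38, 11, 24, 14, 7, 35, 37, 34, 21, 32, 13, 18, 23,
      16, 25, 36, 20, 27, 9, 26, 12, 15, 33, 8, 4, 17]"
  "cycle_missing 39 (edge_set es39) 3
      [0, 1, 2, 22, 5, 31, 29, 30, 17, 9, 27, 20, 36, 26, 12, 4, 8, 33, 15, 25, 16, 23, 18, 10, 19,
      38, 13, 32, 21, 11, 24, 6, 28, 7, 14, 34, 37, 35]"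
  by (simp_all only: cycle_missing_def cycle_edges_def path_edges.simps insert_subset
      empty_subsetI edges39 eval_list eval_num)

lemma cycles39_ok: "cycles_missing_from 39 (edge_set es39) 4 cycles39"
  by (simp only: cycles39_def cycles_missing_from.simps cycle_missing_def cycle_edges_def
      path_edges.simps insert_subset empty_subsetI edges39 eval_list eval_num)

lemma drawing39: "pairwise_list (compatible_edges ((!) ps39)) es39"
  by (simp only: es39_def pairwise_list.simps compatible_edges.simps nth39 orient.simps
      disjoint_segments.simps same_side_def eval_list eval_num cong: if_weak_cong) simp

lemma realizes39: "realizes 39"
proof -
  have sq: "{{0, 1}, {1, 2}, {2, 3}, {3, 0}} \<subseteq> edge_set es39"
    by (simp only: insert_subset empty_subsetI edges39 simp_thms)
  have dist: "distinct ps39"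
    by (simp only: ps39_def eval_list eval_num)
  have len: "length ps39 = 39"
    by (simp add: ps39_def)
  have box: "list_all (\<lambda>(x, y). - 20 \<le> x \<and> x \<le> 20 \<and> - 20 \<le> y \<and> y \<le> 20) ps39"
    by (simp add: ps39_def)
  have nth: "ps39 ! 0 = (20, 20)" "ps39 ! 1 = (- 20, 20)" "ps39 ! 2 = (- 20, - 20)"
    "ps39 ! 3 = (20, - 20)"
    by (simp_all only: nth39)
  show ?thesis
    by (rule realizes_certificate[OF edges_ok39 _ sq nonham39 corners39_ok cycles39_ok dist len
          box nth _ drawing39]) simp_all
qed

section \<open>All larger orders\<close>

lemma realizes_add_4:
  assumes "realizes n"
  shows "realizes (n + 4)"
proof -
  obtain V :: "nat set" and E v1 v2 v3 v4 pt m where card: "card V = n"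
    and hyp: "hypo_square V E v1 v2 v3 v4" and pl: "plane_straight V E pt"
    and fr: "framed V pt m v1 v2 v3 v4"
    using assms unfolding realizes_def by blast
  interpret hypo_square V E v1 v2 v3 v4 by (rule hyp)
  have fin: "finite V" using graph by (simp add: simple_graph_def)
  \<comment> \<open>All numbers from \<open>k\<close> on lie outside \<open>V\<close>, which
    supplies the four new corners.\<close>
  define k where "k = Suc (Max V)"
  have lt: "v < k" if "v \<in> V" for v
    using Max_ge[OF fin that] by (simp add: k_def)
  interpret square_extension V E v1 v2 v3 v4 k "k + 1" "k + 2" "k + 3"
    by unfold_locales (use lt in fastforce)+
  have "card V' = n + 4"
    using card fin lt unfolding V'_def by (subst card_Un_disjoint) fastforce+
  then show ?thesis
    unfolding realizes_def
    using extension plane_straight_extension[OF fr pl] framed_extension[OF fr] by metis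
qed

lemma realizes_from_36: "36 \<le> n \<Longrightarrow> realizes n"
proof (induction n rule: less_induct)
  case (less n)
  show ?case
  proof (cases "n < 40")
    case True
    with less.prems have "n = 36 \<or> n = 37 \<or> n = 38 \<or> n = 39" by auto
    then show ?thesis using realizes36 realizes37 realizes38 realizes39 by blast
  next
    case False
    \<comment> \<open>From 40 on, \<open>n - 4\<close> is still at least 36, so the truncated
      subtraction is exact and the induction hypothesis applies.\<close>
    then have "realizes (n - 4)" using less.IH[of "n - 4"] by simp
    from realizes_add_4[OF this] False show ?thesis by simp
  qed
qed

theorem theorem3p4:
  fixes n :: nat
  assumes "n \<ge> 40"
  shows "\<exists>G :: nat pair_pre_digraph.
           pair_graph G \<and> card (pverts G) = n \<and> planar G \<and> hypohamiltonian (with_proj G)"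
proof -
  obtain V :: "nat set" and E v1 v2 v3 v4 pt where card: "card V = n"
    and hyp: "hypo_square V E v1 v2 v3 v4" and pl: "plane_straight V E pt"
    using realizes_from_36[of n] assms unfolding realizes_def by auto
  interpret hypo_square V E v1 v2 v3 v4 by (rule hyp)
  have "card (pverts (graph_of V E)) = n" using card by (simp add: graph_of_def)
  then show ?thesis
    using pair_graph_graph_of[OF graph] planar_graph_of[OF graph pl] hypohamiltonian by blast
qed

end
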